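(* Let $F$ be an algebraically closed field of characteristic zero, let $G$ be a finite group (not necessarily commutative), and let $L=\bigoplus_{g\in G} L_g$ be a finite dimensional $G$-graded Lie algebra over $F$. Then the solvable radical $R$ of $L$ is a graded ideal of $L$, and there exists a Levi subalgebra $B$ of $L$ which is a graded subalgebra of $L$. Moreover, $B$ is a direct sum $B=H_1\oplus\cdots\oplus H_m$, where each $H_i$ is a graded subalgebra that is graded simple, the support $\mathrm{Supp}\,H_i$ is a commutative subset of $G$, and, in the non-graded sense, $H_i$ is a direct sum of pairwise isomorphic simple Lie algebras.
   Context: Let $G$ be a group (written multiplicatively) and $F$ a field. A Lie algebra $L$ over $F$ is $G$-graded if it is equipped with a vector space decomposition $L=\bigoplus_{g\in G}L_g$ such that $[L_g,L_h]\subseteq L_{gh}$ for all $g,h\in G$. A subspace (resp. subalgebra, ideal) $V\subseteq L$ is called graded (or homogeneous in the $G$-grading) if $V=\bigoplus_{g\in G}(V\cap L_g)$; a graded subalgebra $V$ is itself $G$-graded with components $V_g=V\cap L_g$. The support of a $G$-graded algebra $L$ is $\mathrm{Supp}\,L=\{g\in G\mid L_g\neq 0\}$. A $G$-graded Lie algebra $L$ is graded simple if $[L,L]\neq 0$ and $L$ has no graded ideals other than $0$ and $L$. A subset of $G$ is commutative if any two of its elements commute. A Levi subalgebra of $L$ is a maximal semisimple subalgebra $B$, so that $L=B+R$ with $B\cap R=0$, where $R$ is the solvable radical of $L$. The direct sum $H_1\oplus\cdots\oplus H_m$ is a direct sum of Lie algebras (distinct summands commute); the empty sum ($m=0$) is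 allowed when $B=0$. *)

theory Defs
  imports "HOL-Algebra.Group" "HOL-Computational_Algebra.Polynomial"
begin

text \<open>
  A Lie algebra is carried by a whole type; subalgebras and ideals are subsets of that type, and
  the notions below are stated for a subalgebra \<open>A\<close>, the whole algebra being \<open>A = UNIV\<close>.
\<close>

locale lie_algebra = vector_space scale
  for scale :: "'k::field \<Rightarrow> 'a::ab_group_add \<Rightarrow> 'a" +
  fixes bracket :: "'a \<Rightarrow> 'a \<Rightarrow> 'a"
  assumes bracket_add_left: "bracket (x + y) z = bracket x z + bracket y z"
    and bracket_add_right: "bracket x (y + z) = bracket x y + bracket x z"
    and bracket_scale_left: "bracket (scale c x) y = scale c (bracket x y)"
    and bracket_scale_right: "bracket x (scale c y) = scale c (bracket x y)"
    and bracket_self: "bracket x x = 0"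
    and jacobi: "bracket x (bracket y z) + bracket y (bracket z x) + bracket z (bracket x y) = 0"
begin

definition internal_direct_sum :: "'i set \<Rightarrow> ('i \<Rightarrow> 'a set) \<Rightarrow> 'a set \<Rightarrow> bool" where
  "internal_direct_sum I V W \<longleftrightarrow>
     (\<forall>i\<in>I. subspace (V i)) \<and>
     W = span (\<Union>i\<in>I. V i) \<and>
     (\<forall>J x. finite J \<and> J \<subseteq> I \<and> (\<forall>j\<in>J. x j \<in> V j) \<and> (\<Sum>j\<in>J. x j) = 0 \<longrightarrow> (\<forall>j\<in>J. x j = 0))"

definition bracket_space :: "'a set \<Rightarrow> 'a set \<Rightarrow> 'a set" where
  "bracket_space A B = span {bracket a b |a b. a \<in> A \<and> b \<in> B}"

definition lie_subalgebra :: "'a set \<Rightarrow> bool" where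
  "lie_subalgebra A \<longleftrightarrow> subspace A \<and> (\<forall>x\<in>A. \<forall>y\<in>A. bracket x y \<in> A)"

definition lie_ideal :: "'a set \<Rightarrow> 'a set \<Rightarrow> bool" where
  "lie_ideal A I \<longleftrightarrow> subspace I \<and> I \<subseteq> A \<and> (\<forall>x\<in>A. \<forall>y\<in>I. bracket x y \<in> I)"

definition solvable :: "'a set \<Rightarrow> bool" where
  "solvable A \<longleftrightarrow> (\<exists>n. ((\<lambda>D. bracket_space D D) ^^ n) A = {0})"

text \<open>The solvable radical is the greatest solvable ideal; such an ideal is unique.\<close>

definition solvable_radical :: "'a set \<Rightarrow> 'a set \<Rightarrow> bool" where
  "solvable_radical A R \<longleftrightarrow>
     lie_ideal A R \<and> solvable R \<and> (\<forall>I. lie_ideal A I \<and> solvable I \<longrightarrow> I \<subseteq> R)"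

text \<open>The zero algebra counts as semisimple.\<close>

definition semisimple_subalgebra :: "'a set \<Rightarrow> bool" where
  "semisimple_subalgebra B \<longleftrightarrow> lie_subalgebra B \<and> solvable_radical B {0}"

text \<open>
  A maximal semisimple subalgebra of the whole algebra. That it is a complement of the radical
  is not built in.
\<close>

definition levi_subalgebra :: "'a set \<Rightarrow> bool" where
  "levi_subalgebra B \<longleftrightarrow> semisimple_subalgebra B \<and>
     (\<forall>C. semisimple_subalgebra C \<and> B \<subseteq> C \<longrightarrow> C = B)"

definition simple_subalgebra :: "'a set \<Rightarrow> bool" where
  "simple_subalgebra S \<longleftrightarrow> lie_subalgebra S \<and> bracket_space S S \<noteq> {0} \<and>
     (\<forall>I. lie_ideal S I \<longrightarrow> I = {0} \<or> I = S)"

text \<open>Only the values of the isomorphism on \<open>S\<close> are constrained.\<close>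

definition lie_isomorphic :: "'a set \<Rightarrow> 'a set \<Rightarrow> bool" where
  "lie_isomorphic S T \<longleftrightarrow> (\<exists>f. bij_betw f S T \<and>
     (\<forall>x\<in>S. \<forall>y\<in>S. f (x + y) = f x + f y) \<and>
     (\<forall>c. \<forall>x\<in>S. f (scale c x) = scale c (f x)) \<and>
     (\<forall>x\<in>S. \<forall>y\<in>S. f (bracket x y) = bracket (f x) (f y)))"

definition lie_direct_sum :: "'i set \<Rightarrow> ('i \<Rightarrow> 'a set) \<Rightarrow> 'a set \<Rightarrow> bool" where
  "lie_direct_sum I H B \<longleftrightarrow>
     internal_direct_sum I H B \<and>
     (\<forall>i\<in>I. lie_subalgebra (H i)) \<and>
     (\<forall>i\<in>I. \<forall>j\<in>I. i \<noteq> j \<longrightarrow> (\<forall>x\<in>H i. \<forall>y\<in>H j. bracket x y = 0))"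

end

text \<open>
  The component of degree \<open>g\<close> is \<open>comp g\<close>; its values outside \<open>carrier G\<close> are irrelevant.
\<close>

locale graded_lie_algebra = lie_algebra scale bracket + group G
  for scale :: "'k::field \<Rightarrow> 'a::ab_group_add \<Rightarrow> 'a"
    and bracket :: "'a \<Rightarrow> 'a \<Rightarrow> 'a"
    and G :: "('g, 'm) monoid_scheme" (structure) +
  fixes comp :: "'g \<Rightarrow> 'a set"
  assumes decomposition: "internal_direct_sum (carrier G) comp UNIV"
    and bracket_comp: "\<lbrakk>g \<in> carrier G; h \<in> carrier G; x \<in> comp g; y \<in> comp h\<rbrakk>
      \<Longrightarrow> bracket x y \<in> comp (g \<otimes> h)"
begin

definition graded :: "'a set \<Rightarrow> bool" where
  "graded V \<longleftrightarrow> internal_direct_sum (carrier G) (\<lambda>g. V \<inter> comp g) V"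

definition support :: "'a set \<Rightarrow> 'g set" where
  "support V = {g \<in> carrier G. V \<inter> comp g \<noteq> {0}}"

text \<open>
  A graded subalgebra \<open>H\<close> has the components \<open>H \<inter> comp g\<close>, so for \<open>I \<subseteq> H\<close> being graded in \<open>H\<close>
  is the same as \<open>graded I\<close>.
\<close>

definition graded_simple :: "'a set \<Rightarrow> bool" where
  "graded_simple H \<longleftrightarrow> lie_subalgebra H \<and> graded H \<and> bracket_space H H \<noteq> {0} \<and>
     (\<forall>I. lie_ideal H I \<and> graded I \<longrightarrow> I = {0} \<or> I = H)"

end

definition commutative_subset :: "('g, 'm) monoid_scheme \<Rightarrow> 'g set \<Rightarrow> bool" where
  "commutative_subset G S \<longleftrightarrow> (\<forall>g\<in>S. \<forall>h\<in>S. g \<otimes>\<^bsub>G\<^esub> h = h \<otimes>\<^bsub>G\<^esub> g)"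

end

theory Submission
  imports Defs "HOL-Library.Function_Algebras"
begin

text \<open>
  The largest graded solvable ideal \<open>R\<close> is the radical: the trace form of the adjoint representation
  on \<open>L / R\<close> pairs the component of degree \<open>g\<close> with the component of degree \<open>g\<inverse>\<close> only, so its
  kernel is graded, and by Cartan's criterion this kernel is solvable, hence equal to \<open>R\<close>.
  For the Levi subalgebra, take a graded subalgebra \<open>K\<close> of minimal dimension with \<open>K + R = L\<close>. If
  \<open>N = K \<inter> R\<close> were nonzero, a Casimir element for a graded-irreducible quotient \<open>N / W\<close> would give
  an operator on \<open>K\<close> that is a derivation modulo \<open>W\<close> with values in \<open>N\<close>; its degree-preserving part
  is invertible on \<open>N / W\<close>, and the elements sent to \<open>W\<close> form a smaller choice of \<open>K\<close>.
  The Levi subalgebra splits into graded simple ideals by orthogonality. In such an ideal noncommuting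
  degrees annihilate each other, so the support is commutative and lies in an abelian group, whose
  characters act by automorphisms permuting the simple ideals transitively.

  Quotients are avoided: an operator on \<open>U / W\<close> is represented by a linear map of the whole space,
  compressed by a projection onto a complement of \<open>W\<close> in \<open>U\<close>.
\<close>

text \<open>For abelian \<open>G\<close> the graded subspaces are those stable under the characters
  of \<open>G\<close>, so invariance of the radical under automorphisms would show that it is
  graded. A noncommutative \<open>G\<close> has too few characters; they return only for a graded
  simple ideal, once its support is known to commute. Until then degrees have to be handled
  directly, through trace forms and through the degree-preserving part of an operator, which has the
  same trace and inherits the derivation property. There is no evident way to make a given Levi
  complement graded, so gradedness is built into the minimal choice of \<open>K\<close>, and
  \<open>N / W\<close> is irreducible in the graded sense only. Schur's lemma is therefore replaced
  by two facts: the kernel of the degree-preserving part on \<open>N / W\<close> is a graded ideal,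
  and the trace is not zero. If \<open>K\<close> acts trivially on \<open>N / W\<close>, its trace
  form is zero and yields no Casimir element; this forces a separate central case, in which
  \<open>[K, K] + W\<close> is the smaller subalgebra.\<close>

locale lin_space = vector_space scale
  for scale :: "'a::field \<Rightarrow> 'b::ab_group_add \<Rightarrow> 'b"
begin

section \<open>Linear maps of a vector space to itself\<close>

abbreviation endo :: "('b \<Rightarrow> 'b) \<Rightarrow> bool" where
  "endo T \<equiv> Vector_Spaces.linear scale scale T"

lemma endoI:
  assumes "\<And>x y. T (x + y) = T x + T y" "\<And>c x. T (scale c x) = scale c (T x)"
  shows "endo T"
  using assms vector_space_axioms by (simp add: Vector_Spaces.linear_iff)

lemma endo_add: "endo T \<Longrightarrow> T (x + y) = T x + T y"
  and endo_scale: "endo T \<Longrightarrow> T (scale c x) = scale c (T x)"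
  by (simp_all add: Vector_Spaces.linear_iff)

lemma endo_0: "endo T \<Longrightarrow> T 0 = 0"
  and endo_neg: "endo T \<Longrightarrow> T (- x) = - T x"
  and endo_diff: "endo T \<Longrightarrow> T (x - y) = T x - T y"
  and endo_sum: "endo T \<Longrightarrow> T (sum f A) = (\<Sum>a\<in>A. T (f a))"
  by (simp_all add: module_hom_iff_linear[symmetric] module_hom.zero module_hom.neg module_hom.diff
      module_hom.sum)

lemmas endo_simps = endo_add endo_scale endo_0 endo_neg endo_diff endo_sum

lemma endo_comp: "endo S \<Longrightarrow> endo T \<Longrightarrow> endo (\<lambda>x. S (T x))"
  by (rule endoI) (simp_all add: endo_simps)

lemma endo_minus: "endo S \<Longrightarrow> endo T \<Longrightarrow> endo (\<lambda>x. S x - T x)"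
  by (rule endoI) (simp_all add: endo_simps scale_right_diff_distrib)

lemma endo_scaled: "endo T \<Longrightarrow> endo (\<lambda>x. scale c (T x))"
  by (rule endoI) (simp_all add: endo_simps scale_right_distrib mult.commute)

lemma endo_zero: "endo (\<lambda>x. 0)"
  by (rule endoI) simp_all

lemma endo_id: "endo (\<lambda>x. x)"
  by (rule endoI) simp_all

lemma endo_setsum: "(\<And>i. i \<in> I \<Longrightarrow> endo (T i)) \<Longrightarrow> endo (\<lambda>x. \<Sum>i\<in>I. T i x)"
  by (rule endoI) (simp_all add: endo_simps sum.distrib scale_sum_right)

lemma endo_funpow: "endo T \<Longrightarrow> endo (T ^^ n)"
  by (induction n) (simp_all add: endo_id id_def endo_comp comp_def)

lemma subspace_preimage: "endo T \<Longrightarrow> subspace S \<Longrightarrow> subspace {x. T x \<in> S}"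
  by (auto intro!: subspaceI simp: endo_simps subspace_0 subspace_add subspace_scale)

lemma subspace_image: "endo T \<Longrightarrow> subspace S \<Longrightarrow> subspace (T ` S)"
  by (simp add: module_hom_iff_linear[symmetric] module_hom.subspace_image)

lemma projection_exists:
  assumes "subspace U"
  obtains p where "endo p" "\<And>x. p x \<in> U" "\<And>x. x \<in> U \<Longrightarrow> p x = x"
proof -
  interpret vector_space_pair scale scale by unfold_locales
  show thesis
    using linear_exists_left_inverse_on[OF endo_id assms] that by (auto simp: image_subset_iff)
qed

section \<open>Generalized eigenvectors\<close>

definition shift :: "('b \<Rightarrow> 'b) \<Rightarrow> 'a \<Rightarrow> 'b \<Rightarrow> 'b" where
  "shift T a = (\<lambda>v. T v - scale a v)"

lemma endo_shift: "endo T \<Longrightarrow> endo (shift T a)"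
  unfolding shift_def by (intro endo_minus endo_scaled endo_id)

lemma shift_commute: "endo T \<Longrightarrow> shift T a (shift T b v) = shift T b (shift T a v)"
  by (simp add: shift_def endo_simps algebra_simps)

lemma funpow_commute:
  assumes "\<And>v. f (g v) = g (f v)" shows "(f ^^ m) ((g ^^ n) v) = (g ^^ n) ((f ^^ m) v)"
proof -
  have "f ((g ^^ n) v) = (g ^^ n) (f v)" for v
    by (induction n) (simp_all add: assms)
  then show ?thesis by (induction m) simp_all
qed

lemma funpow_zero_mono: 
  assumes "endo T" "(T ^^ n) v = 0" "n \<le> m" shows "(T ^^ m) v = 0"
proof -
  have "(T ^^ m) v = (T ^^ (m - n)) ((T ^^ n) v)"
    using assms(3) by (metis comp_apply funpow_add le_add_diff_inverse2)
  then show ?thesis using assms endo_0[OF endo_funpow] by simp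
qed

text \<open>By induction on \<open>n\<close> the vector \<open>shift T c w\<close> lies in
  \<open>S\<close> as well, and the two shifts of \<open>w\<close> differ by \<open>(c - d)\<close>
  times \<open>w\<close>.\<close>

lemma invariant_eigenvector_cancel1:
  assumes S: "subspace S" "\<And>v. v \<in> S \<Longrightarrow> T v \<in> S" and T: "endo T" and "c \<noteq> d"
    and "(shift T c ^^ n) w = 0" "shift T d w \<in> S"
  shows "w \<in> S"
  using assms(5,6)
proof (induction n arbitrary: w)
  case 0
  then show ?case using S by (simp add: subspace_0)
next
  case (Suc n)
  have inv: "shift T c v \<in> S" if "v \<in> S" for v
    using S that by (simp add: shift_def subspace_diff subspace_scale)
  have "shift T c w \<in> S"
  proof (rule Suc.IH)
    show "(shift T c ^^ n) (shift T c w) = 0" using Suc.prems by (simp add: funpow_swap1)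
    show "shift T d (shift T c w) \<in> S"
      by (subst shift_commute[OF T]) (rule inv[OF Suc.prems(2)])
  qed
  then have "scale (inverse (c - d)) (shift T d w - shift T c w) \<in> S"
    using S Suc.prems by (intro subspace_scale subspace_diff)
  moreover have "shift T d w - shift T c w = scale (c - d) w"
    by (simp add: shift_def algebra_simps)
  ultimately show ?case using \<open>c \<noteq> d\<close> by simp
qed

lemma invariant_eigenvector_cancel:
  assumes S: "subspace S" "\<And>v. v \<in> S \<Longrightarrow> T v \<in> S" and T: "endo T" and "c \<noteq> d"
    and "(shift T c ^^ n) w = 0" "(shift T d ^^ m) w \<in> S"
  shows "w \<in> S"
  using assms(5,6)
proof (induction m arbitrary: w)
  case (Suc m)
  have "shift T d w \<in> S"
  proof (rule Suc.IH)
    have "(shift T c ^^ n) ((shift T d ^^ 1) w) = (shift T d ^^ 1) ((shift T c ^^ n) w)"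
      by (rule funpow_commute) (rule shift_commute[OF T])
    then show "(shift T c ^^ n) (shift T d w) = 0"
      using Suc.prems endo_0[OF endo_shift[OF T]] by simp
    show "(shift T d ^^ m) (shift T d w) \<in> S" using Suc.prems by (simp add: funpow_swap1)
  qed
  then show ?case using invariant_eigenvector_cancel1[OF S T \<open>c \<noteq> d\<close>] Suc.prems by blast
qed simp

text \<open>A power of \<open>shift T d\<close> removes the summand for \<open>d\<close>; the
  induction hypothesis applies to what is left, and the power is cancelled again on the other
  eigenspaces. With \<open>S = {0}\<close> this is the independence of generalized
  eigenspaces.\<close>

lemma invariant_subspace_components:
  assumes S: "subspace S" "\<And>v. v \<in> S \<Longrightarrow> T v \<in> S" and T: "endo T"
    and "finite I" "\<And>i. i \<in> I \<Longrightarrow> \<exists>n. (shift T i ^^ n) (z i) = 0" "(\<Sum>i\<in>I. z i) \<in> S"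
  shows "\<forall>i\<in>I. z i \<in> S"
  using assms(4-6)
proof (induction I arbitrary: z rule: finite_induct)
  case (insert d I)
  obtain m where m: "(shift T d ^^ m) (z d) = 0" using insert.prems by auto
  define E where "E = shift T d ^^ m"
  have E: "endo E" unfolding E_def by (intro endo_funpow endo_shift T)
  have Einv: "E v \<in> S" if "v \<in> S" for v
    unfolding E_def using that
    by (induction m arbitrary: v)
      (simp_all add: funpow_swap1 shift_def S subspace_diff subspace_scale)
  have "\<forall>i\<in>I. E (z i) \<in> S"
  proof (rule insert.IH)
    show "\<exists>n. (shift T i ^^ n) (E (z i)) = 0" if i: "i \<in> I" for i
    proof -
      obtain n where n: "(shift T i ^^ n) (z i) = 0" using insert.prems(1)[of i] i by blast
      have "(shift T i ^^ n) (E (z i)) = E ((shift T i ^^ n) (z i))"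
        unfolding E_def by (rule funpow_commute) (rule shift_commute[OF T])
      then show ?thesis using n endo_0[OF E] by auto
    qed
    have "E (\<Sum>i\<in>insert d I. z i) \<in> S" using insert.prems Einv by blast
    then show "(\<Sum>i\<in>I. E (z i)) \<in> S"
      using insert.hyps m by (simp add: endo_simps[OF E]) (simp add: E_def)
  qed
  then have I: "z i \<in> S" if i: "i \<in> I" for i
  proof -
    obtain n where "(shift T i ^^ n) (z i) = 0" using insert.prems(1)[of i] i by blast
    moreover have "i \<noteq> d" using insert.hyps i by blast
    ultimately show ?thesis
      using invariant_eigenvector_cancel[OF S T, of i d n "z i" m] \<open>\<forall>i\<in>I. E (z i) \<in> S\<close> i
      by (simp add: E_def)
  qed
  then have "(\<Sum>i\<in>I. z i) \<in> S" using S by (auto intro: subspace_sum)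
  then have "(\<Sum>i\<in>insert d I. z i) - (\<Sum>i\<in>I. z i) \<in> S" using insert.prems S subspace_diff by blast
  then show ?case using I insert.hyps by auto
qed simp

text \<open>On a generalized eigenspace for \<open>a\<close> the map \<open>shift T d\<close> is the
  nonzero scalar \<open>a - d\<close> plus a nilpotent map. The recursion sums the corresponding
  geometric series.\<close>

lemma shift_preimage:
  assumes T: "endo T" and "a \<noteq> d" "(shift T a ^^ n) w = 0"
  shows "\<exists>u. (shift T a ^^ n) u = 0 \<and> shift T d u = w"
  using assms(3)
proof (induction n arbitrary: w)
  case 0
  then show ?case using endo_0[OF endo_shift[OF T]] by auto
next
  case (Suc n)
  note L = endo_simps[OF endo_funpow[OF endo_shift[OF T]]]
  obtain u' where u': "(shift T a ^^ n) u' = 0" "shift T d u' = shift T a w"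
    using Suc.IH[of "shift T a w"] Suc.prems by (auto simp: funpow_swap1)
  have "(shift T a ^^ Suc n) u' = 0" by (rule funpow_zero_mono[OF endo_shift[OF T] u'(1)]) simp
  then have "(shift T a ^^ Suc n) (scale (inverse (a - d)) (w - u')) = 0"
    using Suc.prems by (simp only: L) simp
  moreover have "shift T d w = scale (a - d) w + shift T a w"
    by (simp add: shift_def algebra_simps)
  then have "shift T d (scale (inverse (a - d)) (w - u')) = w"
    using \<open>a \<noteq> d\<close> u' by (simp add: endo_simps[OF endo_shift[OF T]])
  ultimately show ?case by blast
qed

text \<open>Preimages under \<open>shift T d\<close> of the components for the other scalars are
  subtracted from \<open>v\<close>; a power of \<open>shift T d\<close> kills the remainder. This
  takes the place of a partial fraction argument.\<close>

lemma eigenvector_decomposition: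
  assumes T: "endo T" and "fold (shift T) as v = 0"
  shows "\<exists>z. (\<forall>a\<in>set as. \<exists>n. (shift T a ^^ n) (z a) = 0) \<and> v = (\<Sum>a\<in>set as. z a)"
  using assms(2)
proof (induction as arbitrary: v)
  case (Cons d as)
  obtain z where z: "\<forall>a\<in>set as. \<exists>n. (shift T a ^^ n) (z a) = 0" 
      "shift T d v = (\<Sum>a\<in>set as. z a)"
    using Cons.IH[of "shift T d v"] Cons.prems by auto
  \<comment> \<open>The list may contain \<open>d\<close> again, and \<open>shift T d\<close> has no
    inverse on that component.\<close>
  define A where "A = set as - {d}"
  have "\<exists>u. (\<exists>n. (shift T a ^^ n) u = 0) \<and> shift T d u = z a" if "a \<in> A" for a
    using shift_preimage[OF T, of a d _ "z a"] z that unfolding A_def by blast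
  then obtain u where u: "\<And>a. a \<in> A \<Longrightarrow> \<exists>n. (shift T a ^^ n) (u a) = 0"
      "\<And>a. a \<in> A \<Longrightarrow> shift T d (u a) = z a" by metis
  define v' where "v' = v - (\<Sum>a\<in>A. u a)"
  have s: "shift T d v' = (\<Sum>a\<in>set as. z a) - (\<Sum>a\<in>A. z a)"
    using z u by (simp add: v'_def endo_simps[OF endo_shift[OF T]])
  have "\<exists>n. (shift T d ^^ n) (shift T d v') = 0"
  proof (cases "d \<in> set as")
    case True
    then have "shift T d v' = z d" unfolding s A_def by (simp add: sum_diff1)
    then show ?thesis using z True by simp
  next
    case False
    then have "shift T d v' = 0" unfolding s A_def by simp
    then have "(shift T d ^^ 0) (shift T d v') = 0" by simp
    then show ?thesis by blast
  qed
  then obtain n where "(shift T d ^^ n) (shift T d v') = 0" by blast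
  then have "(shift T d ^^ Suc n) v' = 0" by (simp add: funpow_swap1)
  then have "\<exists>n. (shift T d ^^ n) v' = 0" by blast
  moreover define z' where "z' a = (if a = d then v' else u a)" for a
  moreover have "(\<Sum>a\<in>set (d # as). z' a) = v"
  proof -
    have *: "set (d # as) = insert d A" "d \<notin> A" "finite A" by (auto simp: A_def)
    have "(\<Sum>a\<in>A. z' a) = (\<Sum>a\<in>A. u a)" by (rule sum.cong) (auto simp: z'_def A_def)
    then show ?thesis unfolding *(1) using *(2,3) by (simp add: z'_def v'_def)
  qed
  ultimately show ?case using u by (intro exI[of _ z']) (auto simp: A_def)
qed simp

end

locale fd_lin_space = lin_space scale + finite_dimensional_vector_space scale Basis
  for scale :: "'a::field \<Rightarrow> 'b::ab_group_add \<Rightarrow> 'b" and Basis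
begin

section \<open>The trace\<close>

definition tr :: "('b \<Rightarrow> 'b) \<Rightarrow> 'a" where
  "tr T = (\<Sum>b\<in>Basis. representation Basis (T b) b)"

lemma tr_add: "tr (\<lambda>x. S x + T x) = tr S + tr T"
  by (simp add: tr_def representation_add independent_Basis span_Basis sum.distrib)

lemma tr_diff: "tr (\<lambda>x. S x - T x) = tr S - tr T"
  by (simp add: tr_def representation_diff independent_Basis span_Basis sum_subtractf)

lemma tr_scale: "tr (\<lambda>x. scale c (T x)) = c * tr T"
  by (simp add: tr_def representation_scale independent_Basis span_Basis sum_distrib_left)

lemma tr_zero: "tr (\<lambda>x. 0) = 0"
  by (simp add: tr_def representation_zero)

lemma tr_sum: "tr (\<lambda>x. \<Sum>i\<in>I. T i x) = (\<Sum>i\<in>I. tr (T i))"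
  by (induction I rule: infinite_finite_induct) (simp_all add: tr_zero tr_add)

lemma sum_representation: "(\<Sum>b\<in>Basis. scale (representation Basis x b) b) = x"
  using sum_representation_eq[OF independent_Basis _ finite_Basis order_refl, of x]
  by (simp add: span_Basis)

lemma tr_comm:
  assumes "endo S" "endo T"
  shows "tr (\<lambda>x. S (T x)) = tr (\<lambda>x. T (S x))"
proof -
  let ?r = "representation Basis"
  have *: "tr (\<lambda>x. S (T x)) = (\<Sum>b\<in>Basis. \<Sum>c\<in>Basis. ?r (T b) c * ?r (S c) b)"
    if "endo S" "endo T" for S T
  proof -
    have "?r (S (T b)) b = (\<Sum>c\<in>Basis. ?r (T b) c * ?r (S c) b)" for b
    proof -
      have "S (T b) = (\<Sum>c\<in>Basis. scale (?r (T b) c) (S c))"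
        by (subst sum_representation[of "T b", symmetric])
           (simp add: endo_simps[OF that(1)] del: sum_representation)
      then show ?thesis
        by (simp add: representation_sum representation_scale independent_Basis span_Basis)
    qed
    then show ?thesis by (simp add: tr_def)
  qed
  show ?thesis
    unfolding *[OF assms] *[OF assms(2,1)] by (subst sum.swap) (simp add: mult.commute)
qed

text \<open>Traces of projections and of Casimir operators are evaluated by writing them as sums of
  rank-one maps.\<close>

lemma tr_rank_one:
  assumes "\<And>x y. f (x + y) = f x + f y" "\<And>c x. f (scale c x) = c * f x"
  shows "tr (\<lambda>x. scale (f x) v) = f v"
proof -
  let ?r = "representation Basis"
  have f0: "f 0 = 0" using assms(2)[of 0 0] by simp
  have fs: "f (sum g A) = (\<Sum>a\<in>A. f (g a))" for g and A :: "'b set"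
    by (induction A rule: infinite_finite_induct) (simp_all add: assms f0)
  have "f v = f (\<Sum>b\<in>Basis. scale (?r v b) b)" by (simp add: sum_representation)
  also have "\<dots> = (\<Sum>b\<in>Basis. f b * ?r v b)" by (simp add: fs assms mult.commute)
  finally show ?thesis
    by (simp add: tr_def representation_scale independent_Basis span_Basis)
qed

lemma endo_eqI_Basis:
  assumes "endo S" "endo T" "\<And>b. b \<in> Basis \<Longrightarrow> S b = T b"
  shows "S x = T x"
proof -
  interpret vector_space_pair scale scale by unfold_locales
  show ?thesis using linear_eq_on[OF assms(1,2), of x Basis] assms(3) span_Basis by auto
qed

text \<open>If \<open>p\<close> projects onto the range of \<open>T\<close>, then
  \<open>T = p T\<close> has the same trace as \<open>T p\<close>, whose nilpotency exponent is
  smaller by one.\<close>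

lemma tr_nilpotent:
  assumes "endo T" "\<And>x. (T ^^ n) x = 0"
  shows "tr T = 0"
  using assms
proof (induction n arbitrary: T)
  case 0
  have "T x = 0" for x using 0(2)[of "T x"] by simp
  then show ?case by (simp add: tr_zero)
next
  case (Suc n)
  have "subspace (range T)" using subspace_image[OF Suc.prems(1)] by simp
  then obtain p where p: "endo p" "\<And>x. p x \<in> range T" "\<And>x. x \<in> range T \<Longrightarrow> p x = x"
    using projection_exists by blast
  have pT: "p (T x) = T x" for x using p by blast
  have "tr T = tr (\<lambda>x. p (T x))" by (simp add: pT)
  also have "\<dots> = tr (\<lambda>x. T (p x))" by (rule tr_comm) (use p Suc in auto)
  also have "\<dots> = 0"
  proof (cases n)
    case 0
    then have "T x = 0" for x using Suc.prems(2)[of x] by simp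
    then show ?thesis by (simp add: tr_zero)
  next
    case (Suc k)
    have *: "((\<lambda>x. T (p x)) ^^ j) (T y) = (T ^^ j) (T y)" for j y
    proof (induction j arbitrary: y)
      case (Suc j)
      have "((\<lambda>x. T (p x)) ^^ Suc j) (T y) = ((\<lambda>x. T (p x)) ^^ j) (T (p (T y)))"
        by (simp only: funpow_Suc_right comp_def)
      also have "\<dots> = (T ^^ Suc j) (T y)" by (simp only: pT Suc funpow_Suc_right comp_def)
      finally show ?case .
    qed simp
    have "((\<lambda>x. T (p x)) ^^ n) x = 0" for x
    proof -
      obtain y where y: "p x = T y" using p(2) by blast
      have "((\<lambda>x. T (p x)) ^^ n) x = ((\<lambda>x. T (p x)) ^^ k) (T (p x))"
        unfolding Suc by (simp only: funpow_Suc_right comp_def)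
      also have "\<dots> = (T ^^ k) (T (T y))" by (simp only: * y)
      also have "\<dots> = (T ^^ Suc n) y" unfolding Suc by (simp only: funpow_Suc_right comp_def)
      finally show ?thesis using Suc.prems by simp
    qed
    then show ?thesis using Suc.IH endo_comp[OF Suc.prems(1) p(1)] by blast
  qed
  finally show ?case .
qed

lemma tr_projection:
  assumes "subspace U" "endo p" "\<And>x. p x \<in> U" "\<And>x. x \<in> U \<Longrightarrow> p x = x"
  shows "tr p = of_nat (dim U)"
proof -
  obtain C where C: "C \<subseteq> U" "independent C" "U \<subseteq> span C" "card C = dim U"
    using basis_exists by blast
  have fin: "finite C" using C(2) finiteI_independent by blast
  let ?f = "\<lambda>c x. representation C (p x) c"
  have sp: "p x \<in> span C" for x using C assms by blast
  have "p = (\<lambda>x. \<Sum>c\<in>C. scale (?f c x) c)"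
    using sum_representation_eq[OF C(2) sp fin order_refl] by auto
  then have "tr p = tr (\<lambda>x. \<Sum>c\<in>C. scale (?f c x) c)" by (rule arg_cong)
  also have "\<dots> = (\<Sum>c\<in>C. tr (\<lambda>x. scale (?f c x) c))" by (rule tr_sum)
  also have "\<dots> = (\<Sum>c\<in>C. ?f c c)"
    by (intro sum.cong refl tr_rank_one)
      (simp_all add: endo_simps[OF assms(2)] representation_add[OF C(2) sp sp]
        representation_scale[OF C(2) sp])
  also have "\<dots> = (\<Sum>c\<in>C. 1)"
    using C assms by (intro sum.cong refl) (auto simp: representation_basis subset_iff)
  finally show ?thesis using C by simp
qed

lemma uniform_exponent:
  assumes "endo T" "endo S" "\<And>x. \<exists>n. (T ^^ n) (S x) = 0"
  obtains n where "\<And>x. (T ^^ n) (S x) = 0"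
proof -
  obtain e where e: "\<And>x. (T ^^ e x) (S x) = 0" using assms by metis
  define n where "n = Max (insert 0 (e ` Basis))"
  have "(T ^^ n) (S b) = 0" if "b \<in> Basis" for b
  proof (rule funpow_zero_mono[OF assms(1) e])
    show "e b \<le> n" unfolding n_def using that finite_Basis by (intro Max_ge) auto
  qed
  then have "(T ^^ n) (S x) = 0" for x
    by (rule endo_eqI_Basis[OF endo_comp[OF endo_funpow[OF assms(1)] assms(2)] endo_zero])
  then show thesis using that by blast
qed

end

text \<open>Operators become vectors themselves, so that the results on generalized eigenvectors can
  be applied to the commutator with a fixed operator.\<close>

lemma (in vector_space) vector_space_fun: "vector_space (\<lambda>c (f::'c \<Rightarrow> 'b) v. scale c (f v))"
  by unfold_locales (auto simp: fun_eq_iff scale_right_distrib scale_left_distrib)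

text \<open>The field is a vector space over the rationals, and \<open>{a}\<close> is independent in
  it. In Cartan's criterion such functionals play the part of complex conjugation: rational squares
  are nonnegative, so each term of a vanishing sum of them is zero.\<close>

lemma rational_linear_functional:
  fixes a :: "'k::field_char_0"
  assumes "a \<noteq> 0"
  obtains f :: "'k \<Rightarrow> rat" where "\<And>x y. f (x + y) = f x + f y" "\<And>r x. f (of_rat r * x) = r * f x" "f a = 1"
proof -
  interpret K: vector_space "\<lambda>r x. of_rat r * x :: 'k"
    by unfold_locales (auto simp: algebra_simps of_rat_add of_rat_mult)
  interpret Q: vector_space "(*) :: rat \<Rightarrow> rat \<Rightarrow> rat"
    by unfold_locales (auto simp: algebra_simps)
  interpret KQ: vector_space_pair "\<lambda>r x. of_rat r * x :: 'k" "(*) :: rat \<Rightarrow> rat \<Rightarrow> rat"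
    by unfold_locales
  have "K.independent {a}" using assms by simp
  then obtain f where f: "Vector_Spaces.linear (\<lambda>r x. of_rat r * x) (*) f" "f a = 1"
    using KQ.linear_independent_extend[of "{a}" "\<lambda>_. 1"] by auto
  then show thesis using that[of f] by (auto simp: Vector_Spaces.linear_iff)
qed

context lin_space
begin

definition gen_eigenspace :: "('b \<Rightarrow> 'b) \<Rightarrow> 'a \<Rightarrow> 'b set" where
  "gen_eigenspace T a = {v. \<exists>n. (shift T a ^^ n) v = 0}"

lemma subspace_gen_eigenspace:
  assumes "endo T" shows "subspace (gen_eigenspace T a)"
proof (rule subspaceI)
  note L = endo_simps[OF endo_funpow[OF endo_shift[OF assms]]]
  show "0 \<in> gen_eigenspace T a" by (auto simp: gen_eigenspace_def intro!: exI[of _ 0])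
  show "scale c x \<in> gen_eigenspace T a" if "x \<in> gen_eigenspace T a" for c x
    using that by (auto simp: gen_eigenspace_def L)
  fix x y assume "x \<in> gen_eigenspace T a" "y \<in> gen_eigenspace T a"
  then obtain m n where mn: "(shift T a ^^ m) x = 0" "(shift T a ^^ n) y = 0"
    by (auto simp: gen_eigenspace_def)
  have "(shift T a ^^ (m + n)) x = 0" "(shift T a ^^ (m + n)) y = 0"
    using funpow_zero_mono[OF endo_shift[OF assms] mn(1), of "m + n"]
      funpow_zero_mono[OF endo_shift[OF assms] mn(2), of "m + n"] by auto
  then show "x + y \<in> gen_eigenspace T a"
    unfolding gen_eigenspace_def mem_Collect_eq by (intro exI[of _ "m + n"]) (simp add: L)
qed

end

section \<open>Primary decomposition over an algebraically closed field\<close>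

context fd_lin_space
begin

definition poly_op :: "('b \<Rightarrow> 'b) \<Rightarrow> 'a poly \<Rightarrow> 'b \<Rightarrow> 'b" where
  "poly_op T p v = (\<Sum>i\<le>degree p. scale (coeff p i) ((T ^^ i) v))"

lemma poly_op_altdef:
  assumes "degree p \<le> n"
  shows "poly_op T p v = (\<Sum>i\<le>n. scale (coeff p i) ((T ^^ i) v))"
  unfolding poly_op_def using assms
  by (intro sum.mono_neutral_left) (auto simp: coeff_eq_0)

lemma poly_op_linear_factor:
  assumes "endo T"
  shows "poly_op T ([:-a, 1:] * q) v = poly_op T q (shift T a v)"
proof -
  let ?n = "Suc (degree q)"
  have "degree ([:-a, 1:] * q) \<le> ?n" using degree_mult_le[of "[:-a, 1:]" q] by simp
  then have "poly_op T ([:-a, 1:] * q) v = (\<Sum>i\<le>?n. scale (coeff ([:-a, 1:] * q) i) ((T ^^ i) v))"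
    by (rule poly_op_altdef)
  also have "\<dots> = (\<Sum>i\<le>?n. scale (coeff (pCons 0 q) i) ((T ^^ i) v))
      - scale a (\<Sum>i\<le>?n. scale (coeff q i) ((T ^^ i) v))"
    by (simp add: sum_subtractf[symmetric] scale_sum_right scale_left_diff_distrib del: sum.atMost_Suc)
  also have "(\<Sum>i\<le>?n. scale (coeff (pCons 0 q) i) ((T ^^ i) v)) = poly_op T q (T v)"
    unfolding sum.atMost_Suc_shift by (simp add: poly_op_def funpow_swap1)
  also have "(\<Sum>i\<le>?n. scale (coeff q i) ((T ^^ i) v)) = poly_op T q v"
    by (rule poly_op_altdef[symmetric]) simp
  also have "poly_op T q (T v) - scale a (poly_op T q v) = poly_op T q (shift T a v)"
    unfolding poly_op_def shift_def
    by (simp add: scale_sum_right sum_subtractf[symmetric] endo_simps[OF endo_funpow[OF assms]]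
        scale_right_diff_distrib mult.commute)
  finally show ?thesis .
qed

lemma poly_op_linear_factors:
  assumes "endo T"
  shows "poly_op T (\<Prod>a\<leftarrow>as. [:-a, 1:]) v = fold (shift T) as v"
proof (induction as arbitrary: v)
  case Nil
  then show ?case by (simp add: poly_op_def)
next
  case (Cons a as)
  then show ?case using poly_op_linear_factor[OF assms] by (simp del: mult_pCons_left)
qed

text \<open>The vectors \<open>T^i v\<close> with \<open>i \<le> card Basis\<close> are too many to
  be independent. The polynomial depends on \<open>v\<close>, which suffices because vectors are
  decomposed one at a time.\<close>

lemma annihilating_polynomial:
  obtains p where "p \<noteq> 0" "poly_op T p v = 0"
proof -
  let ?N = "card Basis" and ?f = "\<lambda>i. (T ^^ i) v"
  have "\<exists>c. (\<exists>i\<le>?N. c i \<noteq> 0) \<and> (\<Sum>i\<le>?N. scale (c i) (?f i)) = 0"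
  proof (cases "inj_on ?f {..?N}")
    case True
    have "dependent (?f ` {..?N})"
    proof (rule ccontr)
      assume "\<not> dependent (?f ` {..?N})"
      then have "card (?f ` {..?N}) \<le> dim UNIV"
        by (intro independent_card_le_dim) auto
      then show False using card_image[OF True] by simp
    qed
    then obtain u where u: "\<exists>w\<in>?f ` {..?N}. u w \<noteq> 0" "(\<Sum>w\<in>?f ` {..?N}. scale (u w) w) = 0"
      using dependent_finite[of "?f ` {..?N}"] by auto
    then show ?thesis
      by (intro exI[of _ "\<lambda>i. u (?f i)"]) (auto simp: sum.reindex[OF True])
  next
    case False
    then obtain i j where ij: "i \<le> ?N" "j \<le> ?N" "i \<noteq> j" "?f i = ?f j" by (auto simp: inj_on_def)
    \<comment> \<open>Coinciding iterates would merge in the image set, so here the relation is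
      simply their difference.\<close>
    define c where "c k = (if k = i then 1 else if k = j then -1 else (0::'a))" for k
    have "(\<Sum>k\<le>?N. scale (c k) (?f k)) = (\<Sum>k\<in>{i, j}. scale (c k) (?f k))"
      using ij by (intro sum.mono_neutral_right) (auto simp: c_def)
    also have "\<dots> = 0" using ij by (simp add: c_def)
    finally show ?thesis using ij by (intro exI[of _ c]) (auto simp: c_def)
  qed
  then obtain c where c: "\<exists>i\<le>?N. c i \<noteq> 0" "(\<Sum>i\<le>?N. scale (c i) (?f i)) = 0" by blast
  define p where "p = (\<Sum>i\<le>?N. monom (c i) i)"
  have coeff: "coeff p i = (if i \<le> ?N then c i else 0)" for i
    by (simp add: p_def coeff_sum if_distrib[of "\<lambda>x. x = _"] sum.delta' cong: if_cong)
  then have deg: "degree p \<le> ?N" by (intro degree_le) auto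
  have "p \<noteq> 0" using c coeff by (metis coeff_0)
  moreover have "poly_op T p v = 0" unfolding poly_op_altdef[OF deg] using c by (simp add: coeff)
  ultimately show thesis using that by blast
qed

text \<open>Serves both the generalized eigenspaces of an operator and the components of the
  grading.\<close>

lemma direct_sum_projections:
  assumes "finite I" "\<And>i. i \<in> I \<Longrightarrow> subspace (V i)"
    and sums: "\<And>x. \<exists>z. (\<forall>i\<in>I. z i \<in> V i) \<and> x = (\<Sum>i\<in>I. z i)"
    and indep: "\<And>z. \<forall>i\<in>I. z i \<in> V i \<Longrightarrow> (\<Sum>i\<in>I. z i) = 0 \<Longrightarrow> \<forall>i\<in>I. z i = 0"
  obtains \<pi> where "\<And>i. i \<in> I \<Longrightarrow> endo (\<pi> i)" "\<And>i x. i \<in> I \<Longrightarrow> \<pi> i x \<in> V i"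
    "\<And>i j x. i \<in> I \<Longrightarrow> j \<in> I \<Longrightarrow> x \<in> V j \<Longrightarrow> \<pi> i x = (if i = j then x else 0)"
    "\<And>x. (\<Sum>i\<in>I. \<pi> i x) = x"
proof -
  obtain p where p: "\<And>x i. i \<in> I \<Longrightarrow> p x i \<in> V i" "\<And>x. x = (\<Sum>i\<in>I. p x i)"
    using sums by metis
  have unique: "p x i = z i" if "\<forall>i\<in>I. z i \<in> V i" "x = (\<Sum>i\<in>I. z i)" "i \<in> I" for x z i
  proof -
    have "(\<Sum>i\<in>I. p x i - z i) = 0" using that p(2)[of x] by (simp add: sum_subtractf)
    moreover have "\<forall>i\<in>I. p x i - z i \<in> V i" using assms p that by (auto intro: subspace_diff)
    ultimately have "p x i - z i = 0" using indep[of "\<lambda>i. p x i - z i"] \<open>i \<in> I\<close> by blast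
    then show ?thesis by simp
  qed
  show thesis
  proof (rule that[of "\<lambda>i x. p x i"])
    fix i assume i: "i \<in> I"
    show "endo (\<lambda>x. p x i)"
    proof (rule endoI)
      show "p (x + y) i = p x i + p y i" for x y
        using p(1) assms(2)
        by (intro unique[OF _ _ i]) (auto intro: subspace_add simp: sum.distrib p(2)[symmetric])
      show "p (scale c x) i = scale c (p x i)" for c x
        using p(1) assms(2)
        by (intro unique[OF _ _ i])
          (auto intro: subspace_scale simp: scale_sum_right[symmetric] p(2)[symmetric])
    qed
    show "p x i \<in> V i" for x using p i by blast
    fix j x assume j: "j \<in> I" "x \<in> V j"
    have "p x i = (\<lambda>i. if i = j then x else 0) i"
      using assms j by (intro unique[OF _ _ i]) (auto simp: subspace_0)
    then show "p x i = (if i = j then x else 0)" by simp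
  next
    show "(\<Sum>i\<in>I. p x i) = x" for x using p by simp
  qed
qed

end

locale fd_lin_space_closed = fd_lin_space scale Basis
  for scale :: "'k::{alg_closed_field, field_char_0} \<Rightarrow> 'a::ab_group_add \<Rightarrow> 'a" and Basis
begin

lemma gen_eigenspace_sum:
  assumes T: "endo T"
  shows "\<exists>as z. (\<forall>a\<in>set as. z a \<in> gen_eigenspace T a) \<and> v = (\<Sum>a\<in>set as. z a)"
proof -
  obtain p where p: "p \<noteq> 0" "poly_op T p v = 0" by (rule annihilating_polynomial)
  obtain A where A: "p = smult (lead_coeff p) (\<Prod>a\<in>#A. [:-a, 1:])"
    using alg_closed_imp_factorization[OF p(1)] by blast
  obtain as where as: "mset as = A" using ex_mset by blast
  define q where "q = (\<Prod>a\<leftarrow>as. [:-a, 1:])"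
  have q: "p = smult (lead_coeff p) q" using A as by (metis mset_map prod_mset_prod_list q_def)
  have "poly_op T p v = scale (lead_coeff p) (poly_op T q v)"
  proof (subst q)
    have "degree (smult (lead_coeff p) q) = degree q" using p(1) by simp
    then show "poly_op T (smult (lead_coeff p) q) v = scale (lead_coeff p) (poly_op T q v)"
      by (simp add: poly_op_def scale_sum_right)
  qed
  then have "fold (shift T) as v = 0"
    using p by (simp add: q_def poly_op_linear_factors[OF T])
  from eigenvector_decomposition[OF T this] show ?thesis
    unfolding gen_eigenspace_def by blast
qed

lemma eigenspace_projections:
  assumes T: "endo T"
  obtains D \<pi> where "finite D" "\<And>a. a \<in> D \<Longrightarrow> endo (\<pi> a)" "\<And>a x. a \<in> D \<Longrightarrow> \<pi> a x \<in> gen_eigenspace T a"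
    "\<And>a b x. a \<in> D \<Longrightarrow> b \<in> D \<Longrightarrow> x \<in> gen_eigenspace T b \<Longrightarrow> \<pi> a x = (if a = b then x else 0)"
    "\<And>x. (\<Sum>a\<in>D. \<pi> a x) = x"
proof -
  obtain as z where z: "\<And>v a. a \<in> set (as v) \<Longrightarrow> z v a \<in> gen_eigenspace T a"
      "\<And>v. v = (\<Sum>a\<in>set (as v). z v a)"
    using gen_eigenspace_sum[OF T] by metis
  \<comment> \<open>These are roots of annihilating polynomials that need not be minimal, so
    \<open>D\<close> may contain scalars whose generalized eigenspace is zero.\<close>
  define D where "D = (\<Union>b\<in>Basis. set (as b))"
  have fin: "finite D" unfolding D_def using finite_Basis by blast
  let ?w = "\<lambda>b a. if a \<in> set (as b) then z b a else 0"
  let ?r = "representation Basis"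
  note sub = subspace_gen_eigenspace[OF T]
  obtain \<pi> where "\<And>a. a \<in> D \<Longrightarrow> endo (\<pi> a)" "\<And>a x. a \<in> D \<Longrightarrow> \<pi> a x \<in> gen_eigenspace T a"
    "\<And>a b x. a \<in> D \<Longrightarrow> b \<in> D \<Longrightarrow> x \<in> gen_eigenspace T b \<Longrightarrow> \<pi> a x = (if a = b then x else 0)"
    "\<And>x. (\<Sum>a\<in>D. \<pi> a x) = x"
  proof (rule direct_sum_projections[OF fin, of "gen_eigenspace T"])
    show "subspace (gen_eigenspace T a)" for a by (rule sub)
    show "\<exists>u. (\<forall>a\<in>D. u a \<in> gen_eigenspace T a) \<and> x = (\<Sum>a\<in>D. u a)" for x
    proof (intro exI conjI ballI)
      let ?u = "\<lambda>a. \<Sum>b\<in>Basis. scale (?r x b) (?w b a)"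
      show "?u a \<in> gen_eigenspace T a" for a
        using z(1) sub by (intro subspace_sum subspace_scale) (auto simp: subspace_0)
      have w: "(\<Sum>a\<in>D. ?w b a) = b" if "b \<in> Basis" for b
      proof -
        have "(\<Sum>a\<in>D. ?w b a) = (\<Sum>a\<in>set (as b). z b a)"
          using that fin by (intro sum.mono_neutral_cong_right) (auto simp: D_def)
        then show ?thesis using z(2)[of b] by simp
      qed
      have "(\<Sum>a\<in>D. ?u a) = (\<Sum>b\<in>Basis. scale (?r x b) (\<Sum>a\<in>D. ?w b a))"
        by (subst sum.swap) (simp add: scale_sum_right)
      also have "\<dots> = x" by (simp add: w sum_representation)
      finally show "x = (\<Sum>a\<in>D. ?u a)" by simp
    qed
    show "\<forall>a\<in>D. u a = 0" if "\<forall>a\<in>D. u a \<in> gen_eigenspace T a" "(\<Sum>a\<in>D. u a) = 0" for u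
      using invariant_subspace_components[of "{0}" T D u] T fin that
      by (auto simp: gen_eigenspace_def endo_0)
  qed blast
  then show thesis using that fin by blast
qed

end

section \<open>Characters of finite abelian subgroups\<close>

lemma nth_root_exists:
  fixes z :: "'k::alg_closed_field"
  assumes "m > 0" obtains \<mu> where "\<mu> ^ m = z"
proof -
  let ?p = "monom 1 m - [:z:]"
  have "coeff ?p m = 1" using assms by (cases m) auto
  then have "degree ?p > 0" using assms le_degree[of ?p m] by simp
  then obtain \<mu> where "poly ?p \<mu> = 0" using alg_closed_imp_poly_has_root by blast
  then show thesis using that[of \<mu>] by (simp add: poly_monom)
qed

text \<open>A root of \<open>1 + x + ... + x^(m-1)\<close> will do: its value at 1 is
  \<open>m\<close>, which is not zero in characteristic zero.\<close>

lemma nontrivial_root_of_unity_exists: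
  assumes "m > 1" obtains \<mu> :: "'k::{alg_closed_field, field_char_0}" where "\<mu> ^ m = 1" "\<mu> \<noteq> 1"
proof -
  let ?p = "(\<Sum>i<m. monom 1 i) :: 'k poly"
  have "coeff ?p (m - 1) = 1" using assms by (simp add: coeff_sum)
  then have "degree ?p > 0" using assms le_degree[of ?p "m - 1"] by simp
  then obtain \<mu> where "poly ?p \<mu> = 0" using alg_closed_imp_poly_has_root by blast
  then have sum: "(\<Sum>i<m. \<mu> ^ i) = 0" by (simp add: poly_sum poly_monom)
  have "\<mu> \<noteq> 1" using sum assms by auto
  moreover have "\<mu> ^ m = 1" 
    using sum geometric_sum[OF \<open>\<mu> \<noteq> 1\<close>, of m] \<open>\<mu> \<noteq> 1\<close> by simp
  ultimately show thesis using that by blast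
qed

context group
begin

definition character :: "'a set \<Rightarrow> ('a \<Rightarrow> 'k::field) \<Rightarrow> bool" where
  "character A \<chi> \<longleftrightarrow> (\<forall>a\<in>A. \<forall>b\<in>A. \<chi> (a \<otimes> b) = \<chi> a * \<chi> b) \<and> (\<forall>a\<in>A. \<chi> a \<noteq> 0)"

lemma characterD:
  assumes "character A \<chi>"
  shows "a \<in> A \<Longrightarrow> b \<in> A \<Longrightarrow> \<chi> (a \<otimes> b) = \<chi> a * \<chi> b" "a \<in> A \<Longrightarrow> \<chi> a \<noteq> 0"
  using assms by (auto simp: character_def)

lemma character_one: "character A \<chi> \<Longrightarrow> \<one> \<in> A \<Longrightarrow> \<chi> \<one> = 1"
  using characterD(1)[of A \<chi> \<one> \<one>] characterD(2)[of A \<chi> \<one>] by auto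

lemma finite_group_period_exists:
  assumes "finite (carrier G)" "b \<in> carrier G" obtains n :: nat where "0 < n" "b [^] n = \<one>"
proof -
  have "finite (range (\<lambda>n::nat. b [^] n))" by (rule finite_subset[OF _ assms(1)]) (use assms(2) in auto)
  then have "\<not> inj (\<lambda>n::nat. b [^] n)" using finite_imageD by blast
  then have "\<exists>i j :: nat. i \<noteq> j \<and> b [^] i = b [^] j" by (auto simp: inj_def)
  then obtain i j :: nat where ij: "i < j" "b [^] i = b [^] j" by (metis linorder_neqE_nat)
  have "b [^] (j - i) \<otimes> b [^] i = b [^] j" using nat_pow_mult[of b "j - i" i] ij(1) assms(2) by simp
  also have "\<dots> = \<one> \<otimes> b [^] i" using ij(2) assms(2) by simp
  finally have "b [^] (j - i) \<otimes> b [^] i = \<one> \<otimes> b [^] i" .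
  then have "b [^] (j - i) = \<one>" using assms(2) by (metis nat_pow_closed one_closed right_cancel)
  then show thesis using that[of "j - i"] ij(1) by simp
qed

lemma subgroup_nat_pow: "subgroup K G \<Longrightarrow> b \<in> K \<Longrightarrow> b [^] (n::nat) \<in> K"
  by (induction n) (auto simp: subgroup.one_closed subgroup.m_closed)

lemma character_nat_pow:
  "character K \<chi> \<Longrightarrow> subgroup K G \<Longrightarrow> b \<in> K \<Longrightarrow> \<chi> (b [^] (n::nat)) = \<chi> b ^ n"
  by (induction n) (auto simp: character_one subgroup.one_closed characterD subgroup_nat_pow)

text \<open>Here \<open>m\<close> is the order of \<open>b\<close> modulo \<open>K\<close>, so any
  \<open>m\<close>-th root of \<open>\<chi> (b^m)\<close> is admissible as the value at
  \<open>b\<close>.\<close>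

lemma character_extend:
  fixes \<chi> :: "'a \<Rightarrow> 'k::field"
  assumes fin: "finite (carrier G)" and K: "subgroup K G" and \<chi>: "character K \<chi>" and b: "b \<in> carrier G"
    and comm: "\<And>k. k \<in> K \<Longrightarrow> k \<otimes> b = b \<otimes> k"
    and m: "m > 0" "b [^] m \<in> K" "\<And>i. 0 < i \<Longrightarrow> i < m \<Longrightarrow> b [^] i \<notin> K" and \<mu>: "\<mu> ^ m = \<chi> (b [^] m)"
  obtains K' \<chi>' where "subgroup K' G" "K \<subseteq> K'" "b \<in> K'" "K' \<subseteq> {k \<otimes> b [^] (i::nat) |k i. k \<in> K}" "character K' \<chi>'"
    "\<And>k. k \<in> K \<Longrightarrow> \<chi>' k = \<chi> k" "\<chi>' b = \<mu>"
proof -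
  have Kc: "K \<subseteq> carrier G" and K1: "\<one> \<in> K" using K by (auto simp: subgroup.subset subgroup.one_closed)
  have Km: "k \<otimes> l \<in> K" "inv k \<in> K" if "k \<in> K" "l \<in> K" for k l
    using K that by (auto simp: subgroup.m_closed subgroup.m_inv_closed)
  have commp: "k \<otimes> b [^] (i::nat) = b [^] i \<otimes> k" if "k \<in> K" for k i
  proof (induction i)
    case 0
    then show ?case using that Kc by auto
  next
    case (Suc i)
    have kc: "k \<in> carrier G" using that Kc by blast
    have "k \<otimes> b [^] Suc i = (k \<otimes> b [^] i) \<otimes> b" using kc b by (simp add: m_assoc)
    also have "\<dots> = b [^] i \<otimes> (k \<otimes> b)" using kc b by (simp add: Suc m_assoc)
    also have "\<dots> = b [^] Suc i \<otimes> k" using kc b by (simp add: comm[OF that] m_assoc)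
    finally show ?case .
  qed
  have mult: "(k \<otimes> b [^] i) \<otimes> (l \<otimes> b [^] j) = (k \<otimes> l) \<otimes> b [^] (i + j)"
    if kl: "k \<in> K" "l \<in> K" for k l and i j :: nat
  proof -
    have c: "k \<in> carrier G" "l \<in> carrier G" using kl Kc by auto
    have "(k \<otimes> b [^] i) \<otimes> (l \<otimes> b [^] j) = k \<otimes> (b [^] i \<otimes> l) \<otimes> b [^] j" using c b by (simp add: m_assoc)
    also have "b [^] i \<otimes> l = l \<otimes> b [^] i" by (rule commp[OF kl(2), symmetric])
    also have "k \<otimes> (l \<otimes> b [^] i) \<otimes> b [^] j = (k \<otimes> l) \<otimes> (b [^] i \<otimes> b [^] j)" using c b by (simp add: m_assoc)
    finally show ?thesis using b by (simp add: nat_pow_mult)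
  qed
  have \<mu>0: "\<mu> \<noteq> 0" using \<mu> m(1) characterD(2)[OF \<chi> m(2)] by (auto simp: zero_power)
  have pow: "\<chi> (b [^] n) = \<mu> ^ n" if n: "b [^] n \<in> K" for n :: nat
  proof -
    \<comment> \<open>Together with \<open>b^n\<close> also \<open>b^(n mod m)\<close> lies in
      \<open>K\<close>, and the minimality of \<open>m\<close> makes the remainder zero.\<close>
    define q r where "q = n div m" and "r = n mod m"
    have nq: "n = m * q + r" by (simp add: q_def r_def)
    have bm: "(b [^] m) [^] q \<in> K" by (rule subgroup_nat_pow[OF K m(2)])
    have "b [^] n = (b [^] m) [^] q \<otimes> b [^] r" using b by (simp add: nq nat_pow_mult[symmetric] nat_pow_pow)
    then have "b [^] r = inv ((b [^] m) [^] q) \<otimes> b [^] n" using b by (simp add: m_assoc[symmetric])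
    then have "b [^] r \<in> K" using Km bm n by metis
    moreover have "r < m" using m by (simp add: r_def)
    ultimately have "r = 0" using m(3) by blast
    then have "b [^] n = (b [^] m) [^] q" "n = m * q" using b nq by (simp_all add: nat_pow_pow)
    then show ?thesis using character_nat_pow[OF \<chi> K m(2), of q] \<mu> by (simp add: power_mult)
  qed
  have wd: "\<chi> k * \<mu> ^ i = \<chi> l * \<mu> ^ j"
    if kl: "k \<in> K" "l \<in> K" "k \<otimes> b [^] i = l \<otimes> b [^] j" "i \<le> j" for k l and i j :: nat
  proof -
    have c: "k \<in> carrier G" "l \<in> carrier G" using kl Kc by auto
    have "k \<otimes> b [^] i = (l \<otimes> b [^] (j - i)) \<otimes> b [^] i"
      using kl(3,4) c b by (simp add: m_assoc nat_pow_mult)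
    then have k: "k = l \<otimes> b [^] (j - i)" using c b by simp
    then have "b [^] (j - i) = inv l \<otimes> k" using c b by (simp add: m_assoc[symmetric])
    then have bK: "b [^] (j - i) \<in> K" using Km kl by metis
    have "\<chi> k = \<chi> l * \<mu> ^ (j - i)"
      using characterD(1)[OF \<chi> kl(2) bK] pow[OF bK] by (simp add: k[symmetric])
    then show ?thesis using kl(4) by (simp add: power_add[symmetric])
  qed
  define K' where "K' = {k \<otimes> b [^] (i::nat) |k i. k \<in> K}"
  \<comment> \<open>An element has many representations \<open>k \<otimes> b^i\<close>; by
    \<open>wd\<close> they all give the same value.\<close>
  define \<chi>' where "\<chi>' x = (SOME c. \<exists>k\<in>K. \<exists>i::nat. x = k \<otimes> b [^] i \<and> c = \<chi> k * \<mu> ^ i)" for x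
  have val: "\<chi>' (k \<otimes> b [^] i) = \<chi> k * \<mu> ^ i" if k: "k \<in> K" for k and i :: nat
    unfolding \<chi>'_def
  proof (rule some_equality)
    show "\<exists>l\<in>K. \<exists>j::nat. k \<otimes> b [^] i = l \<otimes> b [^] j \<and> \<chi> k * \<mu> ^ i = \<chi> l * \<mu> ^ j" using k by blast
    fix c assume "\<exists>l\<in>K. \<exists>j::nat. k \<otimes> b [^] i = l \<otimes> b [^] j \<and> c = \<chi> l * \<mu> ^ j"
    then obtain l and j :: nat where l: "l \<in> K" "k \<otimes> b [^] i = l \<otimes> b [^] j" "c = \<chi> l * \<mu> ^ j" by blast
    show "c = \<chi> k * \<mu> ^ i"
      using wd[OF k l(1,2)] wd[OF l(1) k l(2)[symmetric]] l(3) by (cases "i \<le> j") auto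
  qed
  have KK': "k \<in> K'" if "k \<in> K" for k
  proof -
    have "k = k \<otimes> b [^] (0::nat)" using that Kc by auto
    then show ?thesis unfolding K'_def using that by blast
  qed
  have bK': "b \<in> K'"
  proof -
    have "b = \<one> \<otimes> b [^] (1::nat)" using b by simp
    then show ?thesis unfolding K'_def using K1 by blast
  qed
  show thesis
  proof (rule that[of K' \<chi>'])
    show "subgroup K' G"
    proof (rule subgroupI)
      show "K' \<subseteq> carrier G" using Kc b by (auto simp: K'_def)
      show "K' \<noteq> {}" using bK' by blast
      show "x \<otimes> y \<in> K'" if "x \<in> K'" "y \<in> K'" for x y
      proof -
        obtain k l and i j :: nat where "x = k \<otimes> b [^] i" "y = l \<otimes> b [^] j" "k \<in> K" "l \<in> K"
          using \<open>x \<in> K'\<close> \<open>y \<in> K'\<close> by (auto simp: K'_def)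
        then show ?thesis unfolding K'_def using mult Km by blast
      qed
      show "inv x \<in> K'" if "x \<in> K'" for x
      proof -
        obtain k and i :: nat where x: "x = k \<otimes> b [^] i" "k \<in> K"
          using \<open>x \<in> K'\<close> by (auto simp: K'_def)
        obtain N :: nat where N: "0 < N" "b [^] N = \<one>" by (rule finite_group_period_exists[OF fin b])
        \<comment> \<open>As \<open>b^N = \<one>\<close>, this gives
          \<open>b^(i + n) = (b^N)^i = \<one>\<close>; inverses are thus reached with natural
          exponents.\<close>
        define n where "n = i * (N - 1)"
        have "i + n = N * i" using N(1) by (cases N) (auto simp: n_def)
        then have "b [^] (i + n) = (b [^] N) [^] i" using b by (simp add: nat_pow_pow)
        then have "b [^] (i + n) = \<one>" using N(2) by simp
        then have "x \<otimes> (inv k \<otimes> b [^] n) = \<one>"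
          using mult[OF x(2) Km(2)[OF x(2) x(2)], of i n] x Kc by auto
        moreover have "inv k \<otimes> b [^] n \<in> K'" unfolding K'_def using Km(2)[OF x(2) x(2)] by blast
        moreover have "x \<in> carrier G" "inv k \<otimes> b [^] n \<in> carrier G" using x Kc b by auto
        ultimately show ?thesis using inv_comm by (metis inv_equality)
      qed
    qed
    show "K \<subseteq> K'" using KK' by blast
    show "b \<in> K'" by (rule bK')
    show "K' \<subseteq> {k \<otimes> b [^] (i::nat) |k i. k \<in> K}" by (auto simp: K'_def)
    show "\<chi>' k = \<chi> k" if k: "k \<in> K" for k
      using val[OF k, of 0] k Kc by auto
    show "\<chi>' b = \<mu>" using val[OF K1, of 1] b character_one[OF \<chi> K1] by simp
    show "character K' \<chi>'"
      unfolding character_def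
    proof (intro conjI ballI)
      fix x y assume "x \<in> K'" "y \<in> K'"
      then obtain k l and i j :: nat where xy: "x = k \<otimes> b [^] i" "y = l \<otimes> b [^] j" "k \<in> K" "l \<in> K"
        by (auto simp: K'_def)
      show "\<chi>' (x \<otimes> y) = \<chi>' x * \<chi>' y"
        unfolding xy(1,2) mult[OF xy(3,4)] val[OF Km(1)[OF xy(3,4)]] val[OF xy(3)] val[OF xy(4)]
        by (simp add: characterD(1)[OF \<chi> xy(3,4)] power_add)
      show "\<chi>' x \<noteq> 0"
        unfolding xy(1) val[OF xy(3)] using \<mu>0 characterD(2)[OF \<chi> xy(3)] by simp
    qed
  qed
qed

text \<open>A nontrivial root of unity is prescribed at \<open>c\<close> on the subgroup of its
  powers. A subgroup of maximal cardinality with a character that is nontrivial at \<open>c\<close>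
  must be all of \<open>A\<close>.\<close>

lemma characters_separate:
  assumes fin: "finite (carrier G)" and A: "subgroup A G"
    and comm: "\<And>a b. a \<in> A \<Longrightarrow> b \<in> A \<Longrightarrow> a \<otimes> b = b \<otimes> a" and c: "c \<in> A" "c \<noteq> \<one>"
  shows "\<exists>\<chi> :: 'a \<Rightarrow> 'k::{alg_closed_field, field_char_0}. character A \<chi> \<and> \<chi> c \<noteq> 1"
proof -
  have Ac: "A \<subseteq> carrier G" and finA: "finite A"
    using subgroup.subset[OF A] finite_subset[OF _ fin] by auto
  have least: "\<exists>m::nat. 0 < m \<and> b [^] m \<in> K \<and> (\<forall>i. 0 < i \<and> i < m \<longrightarrow> b [^] i \<notin> K)"
    if K: "subgroup K G" and b: "b \<in> carrier G" for K b
  proof -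
    define m where "m = (LEAST m. 0 < m \<and> b [^] (m::nat) \<in> K)"
    obtain N :: nat where "0 < N" "b [^] N = \<one>" by (rule finite_group_period_exists[OF fin b])
    then have "0 < N \<and> b [^] N \<in> K" using K by (simp add: subgroup.one_closed)
    then have "0 < m \<and> b [^] m \<in> K" unfolding m_def by (rule LeastI)
    moreover have "b [^] i \<notin> K" if i: "0 < i" "i < m" for i
      using not_less_Least[OF i(2)[unfolded m_def]] i(1) by blast
    ultimately show ?thesis by blast
  qed
  have sub: "{k \<otimes> b [^] (i::nat) |k i. k \<in> K} \<subseteq> A" if "K \<subseteq> A" "b \<in> A" for K b
    using that A subgroup_nat_pow[OF A] by (auto intro: subgroup.m_closed)
  define P where "P K \<longleftrightarrow> subgroup K G \<and> K \<subseteq> A \<and> c \<in> K \<and>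
    (\<exists>\<chi> :: 'a \<Rightarrow> 'k. character K \<chi> \<and> \<chi> c \<noteq> 1)" for K
  have "\<exists>K. P K"
  proof -
    have triv: "subgroup {\<one>} G" by (rule triv_subgroup)
    have cc: "c \<in> carrier G" using c Ac by blast
    obtain m :: nat where m: "0 < m" "c [^] m \<in> {\<one>}" "\<And>i. 0 < i \<Longrightarrow> i < m \<Longrightarrow> c [^] i \<notin> {\<one>}"
      using least[OF triv cc] by blast
    have "m \<noteq> 1" using m(2) c cc by auto
    then have "m > 1" using m(1) by simp
    then obtain \<mu> :: 'k where \<mu>: "\<mu> ^ m = 1" "\<mu> \<noteq> 1" by (rule nontrivial_root_of_unity_exists)
    show ?thesis
    proof (rule character_extend[OF fin triv _ cc _ m, of "\<lambda>_. 1" \<mu>])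
      show "character {\<one>} (\<lambda>_. 1 :: 'k)" by (simp add: character_def)
      show "k \<otimes> c = c \<otimes> k" if "k \<in> {\<one>}" for k using that cc by simp
      show "\<mu> ^ m = 1" by (rule \<mu>(1))
      fix K' and \<chi>' :: "'a \<Rightarrow> 'k"
      assume K': "subgroup K' G" "c \<in> K'" "K' \<subseteq> {k \<otimes> c [^] (i::nat) |k i. k \<in> {\<one>}}"
        "character K' \<chi>'" "\<chi>' c = \<mu>"
      have "{\<one>} \<subseteq> A" using A by (simp add: subgroup.one_closed)
      then have "K' \<subseteq> A" using K'(3) sub[of "{\<one>}" c] c(1) by (meson subset_trans)
      then have "P K'" using K' \<mu>(2) by (auto simp: P_def)
      then show ?thesis by blast
    qed
  qed
  moreover have "\<forall>K. P K \<longrightarrow> card K < Suc (card A)"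
    using finA by (auto simp: P_def card_mono less_Suc_eq_le)
  ultimately obtain K where K: "P K" and max: "\<And>K'. P K' \<Longrightarrow> card K' \<le> card K"
    using ex_has_greatest_nat[of P _ card "Suc (card A)"] by blast
  then obtain \<chi> :: "'a \<Rightarrow> 'k" where \<chi>: "subgroup K G" "K \<subseteq> A" "c \<in> K" "character K \<chi>" "\<chi> c \<noteq> 1"
    by (auto simp: P_def)
  have "K = A"
  proof (rule ccontr)
    assume "K \<noteq> A"
    then obtain b where b: "b \<in> A" "b \<notin> K" using \<chi>(2) by blast
    then have bc: "b \<in> carrier G" using Ac by blast
    obtain m :: nat where m: "0 < m" "b [^] m \<in> K" "\<And>i. 0 < i \<Longrightarrow> i < m \<Longrightarrow> b [^] i \<notin> K"
      using least[OF \<chi>(1) bc] by blast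
    obtain \<mu> :: 'k where \<mu>: "\<mu> ^ m = \<chi> (b [^] m)" using nth_root_exists[OF m(1)] by blast
    have cm: "k \<otimes> b = b \<otimes> k" if "k \<in> K" for k using comm b(1) \<chi>(2) that by blast
    show False
    proof (rule character_extend[OF fin \<chi>(1,4) bc cm m \<mu>])
      fix K' and \<chi>' :: "'a \<Rightarrow> 'k"
      assume K': "subgroup K' G" "K \<subseteq> K'" "b \<in> K'" "K' \<subseteq> {k \<otimes> b [^] (i::nat) |k i. k \<in> K}" "character K' \<chi>'"
        "\<And>k. k \<in> K \<Longrightarrow> \<chi>' k = \<chi> k"
      have KA: "K' \<subseteq> A" using K'(4) sub[OF \<chi>(2) b(1)] by blast
      have "P K'" using K' KA \<chi>(3,5) by (auto simp: P_def)
      then have "card K' \<le> card K" by (rule max)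
      moreover have "card K < card K'"
        using K'(2,3) b(2) finite_subset[OF KA finA] by (intro psubset_card_mono) auto
      ultimately show False by simp
    qed
  qed
  then show ?thesis using \<chi> by blast
qed

definition centralizer :: "'a set \<Rightarrow> 'a set" where
  "centralizer S = {x \<in> carrier G. \<forall>s\<in>S. x \<otimes> s = s \<otimes> x}"

lemma subgroup_centralizer:
  assumes "S \<subseteq> carrier G" shows "subgroup (centralizer S) G"
proof (rule subgroupI)
  show "centralizer S \<subseteq> carrier G" by (auto simp: centralizer_def)
  show "centralizer S \<noteq> {}" using assms by (auto simp: centralizer_def intro!: exI[of _ \<one>])
  fix k assume "k \<in> centralizer S"
  then have k: "k \<in> carrier G" "\<And>g. g \<in> S \<Longrightarrow> k \<otimes> g = g \<otimes> k" by (auto simp: centralizer_def)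
  have "inv k \<otimes> g = g \<otimes> inv k" if g: "g \<in> S" for g
  proof -
    have gc: "g \<in> carrier G" using g assms by blast
    have "inv k \<otimes> g = inv k \<otimes> (g \<otimes> k) \<otimes> inv k" using k(1) gc by (simp add: m_assoc)
    also have "\<dots> = inv k \<otimes> (k \<otimes> g) \<otimes> inv k" by (simp only: k(2)[OF g])
    also have "\<dots> = g \<otimes> inv k" using k(1) gc by (simp add: m_assoc[symmetric])
    finally show ?thesis .
  qed
  then show "inv k \<in> centralizer S" using k by (simp add: centralizer_def)
  fix l assume "l \<in> centralizer S"
  then have l: "l \<in> carrier G" "\<And>g. g \<in> S \<Longrightarrow> l \<otimes> g = g \<otimes> l" by (auto simp: centralizer_def)
  have "(k \<otimes> l) \<otimes> g = g \<otimes> (k \<otimes> l)" if g: "g \<in> S" for g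
  proof -
    have gc: "g \<in> carrier G" using g assms by blast
    have "(k \<otimes> l) \<otimes> g = k \<otimes> (g \<otimes> l)" using k(1) l gc g by (simp add: m_assoc)
    also have "\<dots> = (k \<otimes> g) \<otimes> l" using k(1) l(1) gc by (simp add: m_assoc)
    also have "\<dots> = g \<otimes> (k \<otimes> l)" unfolding k(2)[OF g] using k(1) l(1) gc by (simp add: m_assoc)
    finally show ?thesis .
  qed
  then show "k \<otimes> l \<in> centralizer S" using k l by (simp add: centralizer_def)
qed

text \<open>The double centralizer of \<open>S\<close> works: \<open>S\<close> lies in its own
  centralizer, so the double centralizer is contained in the centralizer, with which it
  commutes.\<close>

lemma commutative_subset_in_abelian_subgroup:
  assumes S: "S \<subseteq> carrier G" "commutative_subset G S"
  obtains A where "subgroup A G" "S \<subseteq> A" "commutative_subset G A"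
proof (rule that)
  let ?C = "centralizer S"
  show "subgroup (centralizer ?C) G" by (rule subgroup_centralizer) (auto simp: centralizer_def)
  show "S \<subseteq> centralizer ?C" using S by (auto simp: centralizer_def)
  have "S \<subseteq> ?C" using S by (auto simp: centralizer_def commutative_subset_def)
  then have "centralizer ?C \<subseteq> ?C" by (auto simp: centralizer_def)
  then show "commutative_subset G (centralizer ?C)"
    by (auto simp: centralizer_def commutative_subset_def)
qed

end

section \<open>Ideals, derived series and solvability\<close>

context lie_algebra
begin

lemma bracket_0: "bracket 0 y = 0" "bracket x 0 = 0"
  using bracket_scale_left[of 0 0 y] bracket_scale_right[of x 0 0] by auto

lemma bracket_neg: "bracket (- x) y = - bracket x y" "bracket x (- y) = - bracket x y"
  using bracket_scale_left[of "-1" x y] bracket_scale_right[of x "-1" y] by auto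

lemma bracket_diff:
  "bracket (x - y) z = bracket x z - bracket y z" "bracket x (y - z) = bracket x y - bracket x z"
  using bracket_add_left[of x "- y" z] bracket_add_right[of x y "- z"] by (auto simp: bracket_neg)

lemma bracket_sum:
  "bracket (sum f A) y = (\<Sum>a\<in>A. bracket (f a) y)" "bracket x (sum f A) = (\<Sum>a\<in>A. bracket x (f a))"
  by (induction A rule: infinite_finite_induct)
    (auto simp: bracket_0 bracket_add_left bracket_add_right)

lemmas bracket_simps = bracket_0 bracket_neg bracket_diff bracket_sum bracket_add_left
  bracket_add_right bracket_scale_left bracket_scale_right

lemma bracket_anticomm: "bracket x y = - bracket y x"
proof -
  have "bracket (x + y) (x + y) = bracket x x + bracket x y + (bracket y x + bracket y y)"
    by (simp only: bracket_add_left bracket_add_right ac_simps)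
  then have "bracket x y + bracket y x = 0" by (simp only: bracket_self add_0_left add_0_right)
  then show ?thesis by (rule eq_neg_iff_add_eq_0[THEN iffD2])
qed

lemma bracket_in_sym: "subspace S \<Longrightarrow> bracket x y \<in> S \<longleftrightarrow> bracket y x \<in> S"
  by (subst bracket_anticomm) (metis minus_minus subspace_neg)

lemma jacobi_left: "bracket (bracket x y) z = bracket x (bracket y z) - bracket y (bracket x z)"
proof -
  have "bracket z (bracket x y) + (bracket x (bracket y z) + bracket y (bracket z x)) = 0"
    using jacobi[of x y z] by (simp only: ac_simps)
  then have "bracket z (bracket x y) = - (bracket x (bracket y z) + bracket y (bracket z x))"
    by (rule eq_neg_iff_add_eq_0[THEN iffD2])
  moreover have "bracket y (bracket z x) = - bracket y (bracket x z)"
    by (subst bracket_anticomm[of z]) (rule bracket_neg)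
  ultimately show ?thesis by (subst bracket_anticomm) simp
qed

lemma bracket_bracket: "bracket x (bracket y z) = bracket (bracket x y) z + bracket y (bracket x z)"
  by (simp add: jacobi_left)

lemma bracket_spaceI: "a \<in> A \<Longrightarrow> b \<in> B \<Longrightarrow> bracket a b \<in> bracket_space A B"
  unfolding bracket_space_def by (rule span_base) blast

lemma subspace_bracket_space: "subspace (bracket_space A B)"
  by (simp add: bracket_space_def)

lemma bracket_space_mono: "A \<subseteq> A' \<Longrightarrow> B \<subseteq> B' \<Longrightarrow> bracket_space A B \<subseteq> bracket_space A' B'"
  unfolding bracket_space_def by (rule span_mono) blast

lemma bracket_space_subset:
  "subspace S \<Longrightarrow> (\<And>a b. a \<in> A \<Longrightarrow> b \<in> B \<Longrightarrow> bracket a b \<in> S) \<Longrightarrow> bracket_space A B \<subseteq> S"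
  unfolding bracket_space_def by (rule span_minimal) auto

abbreviation derived :: "nat \<Rightarrow> 'a set \<Rightarrow> 'a set" where
  "derived n A \<equiv> ((\<lambda>D. bracket_space D D) ^^ n) A"

text \<open>Nonzero perfect subalgebras are the certificates of nonsolvability. They allow
  solvability modulo \<open>R\<close> to be discussed without forming a quotient.\<close>

definition perfect :: "'a set \<Rightarrow> bool" where
  "perfect J \<longleftrightarrow> lie_subalgebra J \<and> bracket_space J J = J"

lemma derived_mono: "A \<subseteq> B \<Longrightarrow> derived n A \<subseteq> derived n B"
  by (induction n) (simp_all add: bracket_space_mono)

lemma derived_perfect: "perfect J \<Longrightarrow> derived n J = J"
  by (induction n) (simp_all add: perfect_def)

lemma perfect_subset_solvable:
  assumes "perfect J" "J \<subseteq> A" "solvable A" shows "J = {0}"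
proof -
  obtain n where "derived n A = {0}" using assms(3) by (auto simp: solvable_def)
  then have "J \<subseteq> {0}" using derived_mono[OF assms(2), of n] derived_perfect[OF assms(1)] by auto
  then show ?thesis using assms(1) subspace_0 by (auto simp: perfect_def lie_subalgebra_def)
qed

lemma lie_subalgebra_derived: "lie_subalgebra A \<Longrightarrow> lie_subalgebra (derived n A)"
proof (induction n)
  case (Suc n)
  have "bracket_space (derived n A) (derived n A) \<subseteq> derived n A"
    using Suc by (intro bracket_space_subset) (auto simp: lie_subalgebra_def)
  then have "bracket x y \<in> bracket_space (derived n A) (derived n A)"
    if "x \<in> bracket_space (derived n A) (derived n A)" "y \<in> bracket_space (derived n A) (derived n A)"
    for x y using that by (intro bracket_spaceI) auto
  then show ?case using subspace_bracket_space by (simp add: lie_subalgebra_def)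
qed simp

lemma derived_Suc_subset: "lie_subalgebra A \<Longrightarrow> derived (Suc n) A \<subseteq> derived n A"
  using lie_subalgebra_derived[of A n] bracket_space_subset[of "derived n A" "derived n A" "derived n A"]
  by (simp add: lie_subalgebra_def)

lemma derived_subset: "lie_subalgebra A \<Longrightarrow> derived n A \<subseteq> A"
proof (induction n)
  case (Suc n)
  then show ?case using derived_Suc_subset[of A n] by (meson subset_trans)
qed simp

lemma lie_ideal_subalgebra: "lie_ideal A I \<Longrightarrow> lie_subalgebra I"
  by (auto simp: lie_ideal_def lie_subalgebra_def)

lemma lie_ideal_bracket2: "lie_ideal A I \<Longrightarrow> x \<in> I \<Longrightarrow> y \<in> A \<Longrightarrow> bracket x y \<in> I"
  using bracket_in_sym unfolding lie_ideal_def by blast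

lemma lie_ideal_bracket_space:
  assumes "lie_ideal A I" "lie_ideal A J" shows "lie_ideal A (bracket_space I J)"
proof -
  let ?S = "bracket_space I J"
  have sub: "subspace {y. bracket x y \<in> ?S}" for x
    using subspace_bracket_space
    by (auto intro!: subspaceI simp: bracket_simps subspace_0 subspace_add subspace_scale)
  have "{bracket a b |a b. a \<in> I \<and> b \<in> J} \<subseteq> {y. bracket x y \<in> ?S}" if "x \<in> A" for x
  proof clarify
    fix a b assume "a \<in> I" "b \<in> J"
    then have "bracket (bracket x a) b + bracket a (bracket x b) \<in> ?S"
      using assms that subspace_bracket_space
      by (auto intro!: subspace_add bracket_spaceI simp: lie_ideal_def)
    then show "bracket x (bracket a b) \<in> ?S" by (simp add: jacobi_left)
  qed
  then have "?S \<subseteq> {y. bracket x y \<in> ?S}" if "x \<in> A" for x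
    using that sub unfolding bracket_space_def by (intro span_minimal) auto
  moreover have "?S \<subseteq> J"
    using assms by (intro bracket_space_subset) (auto simp: lie_ideal_def)
  ultimately show ?thesis
    using assms subspace_bracket_space unfolding lie_ideal_def by blast
qed

lemma lie_ideal_derived: "lie_ideal A I \<Longrightarrow> lie_ideal A (derived n I)"
  by (induction n) (simp_all add: lie_ideal_bracket_space)

lemma lie_ideal_Int: "lie_ideal A I \<Longrightarrow> lie_ideal A J \<Longrightarrow> lie_ideal A (I \<inter> J)"
  by (auto simp: lie_ideal_def subspace_inter)

lemma lie_ideal_sum:
  assumes "lie_ideal A I" "lie_ideal A J" "subspace A"
  shows "lie_ideal A {x + y |x y. x \<in> I \<and> y \<in> J}"
  unfolding lie_ideal_def
proof (intro conjI ballI)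
  show "subspace {x + y |x y. x \<in> I \<and> y \<in> J}" using assms by (auto simp: lie_ideal_def intro: subspace_sums)
  show "{x + y |x y. x \<in> I \<and> y \<in> J} \<subseteq> A" using assms by (auto simp: lie_ideal_def intro!: subspace_add)
  fix z w assume "z \<in> A" "w \<in> {x + y |x y. x \<in> I \<and> y \<in> J}"
  then obtain x y where "w = x + y" "x \<in> I" "y \<in> J" by blast
  then have "bracket z w = bracket z x + bracket z y" "bracket z x \<in> I" "bracket z y \<in> J"
    using assms \<open>z \<in> A\<close> by (auto simp: bracket_simps lie_ideal_def)
  then show "bracket z w \<in> {x + y |x y. x \<in> I \<and> y \<in> J}" by blast
qed

lemma solvable_zero: "solvable {0}"
  by (auto simp: solvable_def intro!: exI[of _ 0])

text \<open>The maps are defined and linear everywhere, but brackets are respected on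
  \<open>J\<close> only: the compressed adjoint maps \<open>ad_sub\<close> represent just those
  subalgebras that stabilize the subquotient.\<close>

definition lie_rep :: "'a set \<Rightarrow> ('a \<Rightarrow> 'a \<Rightarrow> 'a) \<Rightarrow> bool" where
  "lie_rep J \<rho> \<longleftrightarrow> (\<forall>x. Vector_Spaces.linear scale scale (\<rho> x)) \<and>
     (\<forall>v. Vector_Spaces.linear scale scale (\<lambda>x. \<rho> x v)) \<and>
     (\<forall>x\<in>J. \<forall>y\<in>J. \<forall>v. \<rho> (bracket x y) v = \<rho> x (\<rho> y v) - \<rho> y (\<rho> x v))"

end

locale fd_lie_algebra = lie_algebra scale bracket + fd_lin_space_closed scale Basis
  for scale :: "'k::{alg_closed_field, field_char_0} \<Rightarrow> 'a::ab_group_add \<Rightarrow> 'a"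
    and bracket :: "'a \<Rightarrow> 'a \<Rightarrow> 'a" and Basis
begin

lemma endo_bracket: "endo (\<lambda>y. bracket x y)" "endo (\<lambda>x. bracket x y)"
  by (auto intro!: endoI simp: bracket_simps)

text \<open>The derived series stops at a term of least dimension, and this term is perfect.\<close>

lemma not_solvable_perfect:
  assumes "lie_subalgebra A" "\<not> solvable A"
  obtains J where "J \<subseteq> A" "perfect J" "J \<noteq> {0}"
proof -
  define n where "n = (ARG_MIN (\<lambda>n. dim (derived n A)) n. True)"
  have n: "dim (derived n A) \<le> dim (derived m A)" for m
    unfolding n_def by (rule arg_min_nat_le) simp
  have sub: "subspace (derived m A)" for m
    using lie_subalgebra_derived[OF assms(1)] by (auto simp: lie_subalgebra_def)
  have "derived (Suc n) A = derived n A"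
    using subspace_dim_equal[OF sub sub derived_Suc_subset[OF assms(1)] n] .
  then have "perfect (derived n A)"
    using lie_subalgebra_derived[OF assms(1), of n] by (simp add: perfect_def)
  moreover have "derived n A \<noteq> {0}" using assms(2) by (auto simp: solvable_def)
  ultimately show thesis by (rule that[OF derived_subset[OF assms(1)]])
qed

lemma solvable_subset:
  assumes "lie_subalgebra A" "A \<subseteq> B" "solvable B" shows "solvable A"
proof (rule ccontr)
  assume "\<not> solvable A"
  then obtain J where "J \<subseteq> A" "perfect J" "J \<noteq> {0}" using not_solvable_perfect assms(1) by blast
  then show False using perfect_subset_solvable[of J B] assms by blast
qed

text \<open>A perfect subalgebra of \<open>I + R\<close> lies in \<open>derived n I + R\<close> for
  every \<open>n\<close>, hence in \<open>R\<close>. This stands for the closure of solvability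
  under extensions.\<close>

lemma solvable_sum:
  assumes I: "lie_subalgebra I" "solvable I" and R: "lie_ideal UNIV R" "solvable R"
    and A: "lie_subalgebra A" "A \<subseteq> {x + y |x y. x \<in> I \<and> y \<in> R}"
  shows "solvable A"
proof (rule ccontr)
  assume "\<not> solvable A"
  then obtain J where J: "J \<subseteq> A" "perfect J" "J \<noteq> {0}" using not_solvable_perfect A(1) by blast
  have subR: "subspace R" and idR: "\<And>x y. y \<in> R \<Longrightarrow> bracket x y \<in> R" "\<And>x y. x \<in> R \<Longrightarrow> bracket x y \<in> R"
    using R(1) lie_ideal_bracket2[OF R(1)] by (auto simp: lie_ideal_def)
  have *: "J \<subseteq> {x + y |x y. x \<in> derived n I \<and> y \<in> R}" for n
  proof (induction n)
    case 0
    then show ?case using J A by auto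
  next
    case (Suc n)
    let ?S = "{x + y |x y. x \<in> derived (Suc n) I \<and> y \<in> R}"
    have "bracket_space J J \<subseteq> ?S"
    proof (rule bracket_space_subset)
      show "subspace ?S"
        using lie_subalgebra_derived[OF I(1), of "Suc n"] subR
        by (intro subspace_sums) (auto simp: lie_subalgebra_def)
      fix a b assume "a \<in> J" "b \<in> J"
      with Suc obtain x y x' y' where xy: "x \<in> derived n I" "y \<in> R" "x' \<in> derived n I" "y' \<in> R"
        "a = x + y" "b = x' + y'" by blast
      then have "bracket a b = bracket x x' + (bracket x y' + bracket y x' + bracket y y')"
        by (simp add: bracket_simps algebra_simps)
      moreover have "bracket x x' \<in> derived (Suc n) I" using xy by (simp add: bracket_spaceI)
      moreover have "bracket x y' + bracket y x' + bracket y y' \<in> R"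
        using xy idR subR by (intro subspace_add) auto
      ultimately show "bracket a b \<in> ?S" by blast
    qed
    then show ?case using J by (simp add: perfect_def)
  qed
  obtain n where "derived n I = {0}" using I by (auto simp: solvable_def)
  then have "J \<subseteq> R" using *[of n] by auto
  then show False using perfect_subset_solvable J R by blast
qed

section \<open>Cartan's criterion\<close>

definition trace_form :: "('a \<Rightarrow> 'a \<Rightarrow> 'a) \<Rightarrow> 'a \<Rightarrow> 'a \<Rightarrow> 'k" where
  "trace_form \<rho> x y = tr (\<lambda>v. \<rho> x (\<rho> y v))"

lemma lie_repD:
  assumes "lie_rep J \<rho>"
  shows "endo (\<rho> x)" "endo (\<lambda>x. \<rho> x v)" "\<rho> (x + y) v = \<rho> x v + \<rho> y v"
    "\<rho> (scale c x) v = scale c (\<rho> x v)" "\<rho> (sum f I) v = (\<Sum>i\<in>I. \<rho> (f i) v)" "\<rho> 0 v = 0"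
    "x \<in> J \<Longrightarrow> y \<in> J \<Longrightarrow> \<rho> (bracket x y) v = \<rho> x (\<rho> y v) - \<rho> y (\<rho> x v)"
  using assms endo_simps[of "\<lambda>x. \<rho> x v"] by (auto simp: lie_rep_def)

lemma trace_form_linear:
  assumes "lie_rep J \<rho>"
  shows "trace_form \<rho> (x + x') y = trace_form \<rho> x y + trace_form \<rho> x' y"
    "trace_form \<rho> (scale c x) y = c * trace_form \<rho> x y"
    "trace_form \<rho> x y = trace_form \<rho> y x"
    "trace_form \<rho> x (y + y') = trace_form \<rho> x y + trace_form \<rho> x y'"
    "trace_form \<rho> x (scale c y) = c * trace_form \<rho> x y"
  unfolding trace_form_def
  using lie_repD[OF assms]
  by (simp_all add: tr_add tr_scale endo_simps[OF lie_repD(1)[OF assms]] tr_comm)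

lemma trace_form_invariant:
  assumes "lie_rep J \<rho>" "x \<in> J" "y \<in> J" "z \<in> J"
  shows "trace_form \<rho> (bracket x y) z = trace_form \<rho> x (bracket y z)"
proof -
  note R = lie_repD[OF assms(1)]
  have "tr (\<lambda>v. \<rho> y (\<rho> x (\<rho> z v))) = tr (\<lambda>v. \<rho> x (\<rho> z (\<rho> y v)))"
    using tr_comm[of "\<rho> y" "\<lambda>v. \<rho> x (\<rho> z v)"] R(1) endo_comp by blast
  then show ?thesis
    using assms(2-4) by (simp add: trace_form_def R(7) endo_simps[OF R(1)] tr_diff)
qed

end

section \<open>Commutators with a fixed operator\<close>

context lin_space
begin

abbreviation fun_scale :: "'a \<Rightarrow> ('b \<Rightarrow> 'b) \<Rightarrow> 'b \<Rightarrow> 'b" where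
  "fun_scale c \<phi> \<equiv> (\<lambda>v. scale c (\<phi> v))"

lemma lin_space_fun: "lin_space fun_scale"
  by (rule lin_space.intro) (rule vector_space_fun)

definition commutator :: "('b \<Rightarrow> 'b) \<Rightarrow> ('b \<Rightarrow> 'b) \<Rightarrow> 'b \<Rightarrow> 'b" where
  "commutator X \<phi> = (\<lambda>v. X (\<phi> v) - \<phi> (X v))"

lemma endo_commutator: "endo X \<Longrightarrow> lin_space.endo fun_scale (commutator X)"
proof -
  interpret E: lin_space fun_scale by (rule lin_space_fun)
  assume "endo X"
  then show ?thesis
    by (intro E.endoI) (auto simp: commutator_def fun_eq_iff endo_simps algebra_simps)
qed

text \<open>The shifted commutator sends \<open>\<phi>\<close> to
  \<open>(X - a) \<phi> - \<phi> (X - b)\<close>, a difference of commuting operations that are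
  nilpotent on \<open>\<phi>\<close>; induction on \<open>m + n\<close> replaces the binomial
  theorem. It gives the eigenvalue of a block between two eigenspaces and, for
  \<open>a = b = 0\<close>, the nilpotency needed in Engel's theorem.\<close>

lemma commutator_shift_nilpotent:
  assumes X: "endo X" and "endo \<phi>"
    and "\<And>v. (shift X a ^^ m) (\<phi> v) = 0" "\<And>v. \<phi> ((shift X b ^^ n) v) = 0"
  shows "(lin_space.shift fun_scale (commutator X) (a - b) ^^ (m + n)) \<phi> = 0"
  using assms(2-)
proof (induction "m + n" arbitrary: \<phi> m n)
  case 0
  then show ?case by (auto simp: fun_eq_iff)
next
  case (Suc k)
  interpret E: lin_space fun_scale by (rule lin_space_fun)
  let ?D = "E.shift (commutator X) (a - b)"
  have D: "E.endo (?D ^^ j)" for j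
    by (intro E.endo_funpow E.endo_shift endo_commutator X)
  show ?case
  proof (cases "m = 0 \<or> n = 0")
    case True
    then have "\<phi> = 0" using Suc.prems(2,3) by (auto simp: fun_eq_iff)
    then show ?thesis using E.endo_0[OF D] by simp
  next
    case False
    then obtain m' n' where mn: "m = Suc m'" "n = Suc n'" by (metis not0_implies_Suc)
    define \<phi>1 where "\<phi>1 = (\<lambda>v. shift X a (\<phi> v))"
    define \<phi>2 where "\<phi>2 = (\<lambda>v. \<phi> (shift X b v))"
    have e: "endo \<phi>1" "endo \<phi>2" unfolding \<phi>1_def \<phi>2_def
      using endo_comp[OF endo_shift[OF X] Suc.prems(1)] endo_comp[OF Suc.prems(1) endo_shift[OF X]]
      by auto
    have "?D \<phi> = \<phi>1 - \<phi>2"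
      by (auto simp: fun_eq_iff \<phi>1_def \<phi>2_def E.shift_def shift_def commutator_def
          endo_simps[OF Suc.prems(1)] scale_left_diff_distrib)
    moreover have "(?D ^^ (m' + n)) \<phi>1 = 0"
    proof (rule Suc.hyps(1)[OF _ e(1)])
      show "k = m' + n" using Suc.hyps mn by simp
      show "(shift X a ^^ m') (\<phi>1 v) = 0" for v
        using Suc.prems(2)[of v] by (simp add: mn \<phi>1_def funpow_swap1)
      show "\<phi>1 ((shift X b ^^ n) v) = 0" for v
        by (simp add: \<phi>1_def Suc.prems(3) endo_0[OF endo_shift[OF X]])
    qed
    moreover have "(?D ^^ (m + n')) \<phi>2 = 0"
    proof (rule Suc.hyps(1)[OF _ e(2)])
      show "k = m + n'" using Suc.hyps mn by simp
      show "(shift X a ^^ m) (\<phi>2 v) = 0" for v by (simp add: \<phi>2_def Suc.prems(2))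
      show "\<phi>2 ((shift X b ^^ n') v) = 0" for v
        using Suc.prems(3)[of v] by (simp add: mn \<phi>2_def)
    qed
    moreover have "m' + n = k" "m + n' = k" "m + n = Suc k" using Suc.hyps mn by auto
    ultimately show ?thesis
      using E.endo_diff[OF D, of k \<phi>1 \<phi>2] by (simp add: funpow_swap1)
  qed
qed

end

context fd_lie_algebra
begin

text \<open>
  Let \<open>X = \<rho> x\<close> have the generalized eigenvalues \<open>a\<close> with projections \<open>\<pi> a\<close>, and let \<open>f\<close> be a rational
  linear functional on the field. Since \<open>\<rho> ` J\<close> is stable under the commutator with \<open>X\<close>, it contains
  the generalized eigencomponents of its elements, hence it is also stable under the commutator with
  \<open>y = (\<Sum>a. f a \<cdot> \<pi> a)\<close>. As \<open>J\<close> is perfect, the trace of \<open>X y\<close> vanishes, and applying \<open>f\<close> to it shows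
  that the sum of the \<open>f a ^ 2\<close> with multiplicities is zero.
\<close>

lemma cartan_nilpotent:
  assumes J: "perfect J" and rep: "lie_rep J \<rho>"
    and form: "\<And>x y. x \<in> J \<Longrightarrow> y \<in> J \<Longrightarrow> trace_form \<rho> x y = 0" and x: "x \<in> J"
  shows "\<exists>n. \<forall>v. (\<rho> x ^^ n) v = 0"
proof -
  note R = lie_repD[OF rep]
  have subJ: "subspace J" and brJ: "\<And>u v. u \<in> J \<Longrightarrow> v \<in> J \<Longrightarrow> bracket u v \<in> J"
    using J by (auto simp: perfect_def lie_subalgebra_def)
  interpret E: lin_space fun_scale by (rule lin_space_fun)
  define X where "X = \<rho> x"
  have X: "endo X" unfolding X_def by (rule R)
  obtain D \<pi> where D: "finite D" and \<pi>: "\<And>a. a \<in> D \<Longrightarrow> endo (\<pi> a)"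
    "\<And>a v. a \<in> D \<Longrightarrow> \<pi> a v \<in> gen_eigenspace X a"
    "\<And>a b v. a \<in> D \<Longrightarrow> b \<in> D \<Longrightarrow> v \<in> gen_eigenspace X b \<Longrightarrow> \<pi> a v = (if a = b then v else 0)"
    "\<And>v. (\<Sum>a\<in>D. \<pi> a v) = v"
    by (rule eigenspace_projections[OF X]) blast
  have Xinv: "X v \<in> gen_eigenspace X a" if v: "v \<in> gen_eigenspace X a" for v a
  proof -
    obtain n where "(shift X a ^^ n) v = 0" using v by (auto simp: gen_eigenspace_def)
    moreover have "(shift X a ^^ n) ((X ^^ 1) v) = (X ^^ 1) ((shift X a ^^ n) v)"
      by (rule funpow_commute) (simp add: shift_def endo_simps[OF X])
    ultimately show ?thesis using endo_0[OF X] by (auto simp: gen_eigenspace_def)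
  qed
  have comm: "\<pi> a (X v) = X (\<pi> a v)" if "a \<in> D" for a v
  proof -
    have "\<pi> a (X v) = \<pi> a (X (\<Sum>b\<in>D. \<pi> b v))" by (simp add: \<pi>(4))
    also have "\<dots> = (\<Sum>b\<in>D. \<pi> a (X (\<pi> b v)))"
      by (simp add: endo_simps[OF X] endo_simps[OF \<pi>(1)[OF that]])
    also have "\<dots> = (\<Sum>b\<in>D. if a = b then X (\<pi> b v) else 0)"
      using that Xinv \<pi>(2) by (intro sum.cong refl \<pi>(3)) auto
    finally show ?thesis using that D by simp
  qed
  have comms: "\<pi> a (shift X b v) = shift X b (\<pi> a v)" if "a \<in> D" for a b v
    using that by (simp add: shift_def comm endo_simps[OF \<pi>(1)])
  have commp: "\<pi> a ((shift X b ^^ n) v) = (shift X b ^^ n) (\<pi> a v)" if "a \<in> D" for a b n v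
    by (induction n) (simp_all add: comms that)
  have "\<exists>n. \<forall>v. (shift X a ^^ n) (\<pi> a v) = 0" if "a \<in> D" for a
  proof (rule uniform_exponent[OF endo_shift[OF X] \<pi>(1)[OF that]])
    show "\<exists>n. (shift X a ^^ n) (\<pi> a v) = 0" for v
      using \<pi>(2)[OF that] by (auto simp: gen_eigenspace_def)
  qed blast
  then obtain N where N: "\<And>a v. a \<in> D \<Longrightarrow> (shift X a ^^ N a) (\<pi> a v) = 0" by metis
  define d where "d a = dim (gen_eigenspace X a)" for a
  \<comment> \<open>On the eigenspace \<open>X\<close> is the scalar \<open>a\<close> plus a
    nilpotent operator, which is traceless.\<close>
  have trX: "tr (\<lambda>v. X (\<pi> a v)) = a * of_nat (d a)" if a: "a \<in> D" for a
  proof -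
    let ?S = "\<lambda>v. shift X a (\<pi> a v)"
    have pow: "(?S ^^ Suc n) v = (shift X a ^^ Suc n) (\<pi> a v)" for n v
    proof (induction n)
      case (Suc n)
      have "\<pi> a (\<pi> a v) = \<pi> a v" using \<pi>(3)[OF a a \<pi>(2)[OF a]] by simp
      then have "\<pi> a ((shift X a ^^ Suc n) (\<pi> a v)) = (shift X a ^^ Suc n) (\<pi> a v)"
        by (subst commp[OF a]) simp
      then show ?case by (simp only: funpow.simps(2)[of "Suc n"] comp_apply Suc)
    qed simp
    have "(?S ^^ Suc (N a)) v = 0" for v
      unfolding pow by (rule funpow_zero_mono[OF endo_shift[OF X] N[OF a]]) simp
    then have "tr ?S = 0" by (rule tr_nilpotent[OF endo_comp[OF endo_shift[OF X] \<pi>(1)[OF a]]])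
    moreover have "tr (\<pi> a) = of_nat (d a)"
      unfolding d_def using a \<pi>(2,3) by (intro tr_projection[OF subspace_gen_eigenspace[OF X] \<pi>(1)]) auto
    moreover have "(\<lambda>v. X (\<pi> a v)) = (\<lambda>v. ?S v + scale a (\<pi> a v))" by (simp add: shift_def)
    ultimately show ?thesis by (simp add: tr_add tr_scale)
  qed
  have eig0: "a = 0" if a: "a \<in> D" "d a \<noteq> 0" for a
  proof (rule ccontr)
    assume "a \<noteq> 0"
    then obtain f :: "'k \<Rightarrow> rat" where f: "\<And>x y. f (x + y) = f x + f y"
      "\<And>r x. f (of_rat r * x) = r * f x" "f a = 1"
      by (rule rational_linear_functional) blast
    have f0: "f 0 = 0" using f(2)[of 0 0] by simp
    have fdiff: "f (x - y) = f x - f y" for x y using f(1)[of "x - y" y] by simp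
    have fsum: "f (sum g A) = (\<Sum>a\<in>A. f (g a))" for g and A :: "'k set"
      by (induction A rule: infinite_finite_induct) (simp_all add: f f0)
    let ?f = "\<lambda>a. of_rat (f a) :: 'k"
    define y where "y = (\<lambda>v. \<Sum>a\<in>D. scale (?f a) (\<pi> a v))"
    have y: "endo y" unfolding y_def by (intro endo_setsum endo_scaled \<pi>(1))
    have key: "\<exists>w\<in>J. \<forall>v. y (\<rho> z v) - \<rho> z (y v) = \<rho> w v" if z: "z \<in> J" for z
    proof -
      define blk where "blk = (\<lambda>(a, b) v. \<pi> a (\<rho> z (\<pi> b v)))"
      let ?d = "\<lambda>(a, b). a - b"
      define C where "C = ?d ` (D \<times> D)"
      \<comment> \<open>Different blocks may share a difference \<open>a - b\<close>, and only their
        total is known to come from an element of \<open>J\<close>. Since \<open>f\<close> is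
        additive, \<open>f a - f b\<close> depends on the difference alone, so the totals
        suffice.\<close>
      define zc where "zc c = (\<Sum>p\<in>{p \<in> D \<times> D. ?d p = c}. blk p)" for c
      have fin: "finite (D \<times> D)" "finite C" using D by (auto simp: C_def)
      have S: "E.subspace (\<rho> ` J)"
      proof (rule E.subspaceI)
        have "\<rho> 0 = 0" using R(6) by (auto simp: fun_eq_iff)
        then show "0 \<in> \<rho> ` J" using imageI[OF subspace_0[OF subJ], of \<rho>] by simp
        show "\<phi> + \<psi> \<in> \<rho> ` J" if h: "\<phi> \<in> \<rho> ` J" "\<psi> \<in> \<rho> ` J" for \<phi> \<psi>
        proof -
          obtain p q where pq: "\<phi> = \<rho> p" "\<psi> = \<rho> q" "p \<in> J" "q \<in> J" using h by blast
          have "\<phi> + \<psi> = \<rho> (p + q)" using R(3) pq by (auto simp: fun_eq_iff)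
          then show ?thesis using subspace_add[OF subJ pq(3,4)] by blast
        qed
        show "fun_scale c \<phi> \<in> \<rho> ` J" if h: "\<phi> \<in> \<rho> ` J" for c \<phi>
        proof -
          obtain p where p: "\<phi> = \<rho> p" "p \<in> J" using h by blast
          have "fun_scale c \<phi> = \<rho> (scale c p)" using R(4) p by (auto simp: fun_eq_iff)
          then show ?thesis using subspace_scale[OF subJ p(2)] by blast
        qed
      qed
      have inv: "commutator X \<phi> \<in> \<rho> ` J" if h: "\<phi> \<in> \<rho> ` J" for \<phi>
      proof -
        obtain p where p: "\<phi> = \<rho> p" "p \<in> J" using h by blast
        have "commutator X \<phi> = \<rho> (bracket x p)"
          using R(7)[OF x p(2)] p by (auto simp: fun_eq_iff commutator_def X_def)
        then show ?thesis using brJ[OF x p(2)] by blast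
      qed
      have gen: "zc c \<in> E.gen_eigenspace (commutator X) c" for c
        unfolding zc_def
      proof (rule E.subspace_sum[OF E.subspace_gen_eigenspace[OF endo_commutator[OF X]]], clarify)
        fix a b assume ab: "a \<in> D" "b \<in> D"
        have "(E.shift (commutator X) (a - b) ^^ (N a + N b)) (blk (a, b)) = 0"
        proof (rule commutator_shift_nilpotent[OF X])
          show "endo (blk (a, b))" 
            using endo_comp[OF \<pi>(1)[OF ab(1)] endo_comp[OF R(1) \<pi>(1)[OF ab(2)]]] by (simp add: blk_def)
          show "(shift X a ^^ N a) (blk (a, b) v) = 0" for v by (simp add: blk_def N ab)
          show "blk (a, b) ((shift X b ^^ N b) v) = 0" for v
            using ab by (simp add: blk_def commp N endo_0[OF R(1)] endo_0[OF \<pi>(1)])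
        qed
        then show "blk (a, b) \<in> E.gen_eigenspace (commutator X) (a - b)"
          by (auto simp: E.gen_eigenspace_def)
      qed
      have grp: "(\<Sum>c\<in>C. \<Sum>p\<in>{p \<in> D \<times> D. ?d p = c}. g p) = (\<Sum>p\<in>D \<times> D. g p)"
        for g :: "'k \<times> 'k \<Rightarrow> 'a"
        using fin by (intro sum.group) (auto simp: C_def)
      have fsum_apply: "(\<Sum>i\<in>I. g i) v = (\<Sum>i\<in>I. g i v)" for I and g :: "'i \<Rightarrow> 'a \<Rightarrow> 'a" and v
        by (induction I rule: infinite_finite_induct) auto
      have blk_sum: "(\<Sum>p\<in>D \<times> D. scale (h (fst p)) (blk p v)) = (\<Sum>a\<in>D. scale (h a) (\<pi> a (\<rho> z v)))"
        for h v
      proof -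
        have "\<pi> a (\<rho> z v) = (\<Sum>b\<in>D. blk (a, b) v)" if "a \<in> D" for a
        proof -
          have "\<pi> a (\<rho> z v) = \<pi> a (\<rho> z (\<Sum>b\<in>D. \<pi> b v))" by (simp add: \<pi>(4))
          then show ?thesis by (simp add: blk_def endo_simps[OF R(1)] endo_simps[OF \<pi>(1)[OF that]])
        qed
        then show ?thesis by (simp add: sum.cartesian_product' scale_sum_right)
      qed
      have "(\<Sum>c\<in>C. zc c) = \<rho> z"
      proof
        fix v
        have "(\<Sum>c\<in>C. zc c) v = (\<Sum>p\<in>D \<times> D. blk p v)" by (simp add: fsum_apply zc_def grp)
        also have "\<dots> = \<rho> z v" using blk_sum[of "\<lambda>_. 1" v] by (simp add: \<pi>(4))
        finally show "(\<Sum>c\<in>C. zc c) v = \<rho> z v" .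
      qed
      then have "(\<Sum>c\<in>C. zc c) \<in> \<rho> ` J" using z by simp
      then have "\<forall>c\<in>C. zc c \<in> \<rho> ` J"
        using gen fin(2)
        by (intro E.invariant_subspace_components[OF S inv endo_commutator[OF X]])
          (auto simp: E.gen_eigenspace_def)
      then have "(\<Sum>c\<in>C. fun_scale (?f c) (zc c)) \<in> \<rho> ` J"
        using S by (intro E.subspace_sum E.subspace_scale) auto
      then obtain w where w: "w \<in> J" "(\<Sum>c\<in>C. fun_scale (?f c) (zc c)) = \<rho> w" by auto
      have "y (\<rho> z v) - \<rho> z (y v) = \<rho> w v" for v
      proof -
        have "\<rho> w v = (\<Sum>c\<in>C. \<Sum>p\<in>{p \<in> D \<times> D. ?d p = c}. scale (?f (?d p)) (blk p v))"
          unfolding w(2)[symmetric] by (simp add: fsum_apply zc_def scale_sum_right)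
        also have "\<dots> = (\<Sum>p\<in>D \<times> D. scale (?f (?d p)) (blk p v))" by (rule grp)
        also have "\<dots> = (\<Sum>p\<in>D \<times> D. scale (?f (fst p)) (blk p v)) - (\<Sum>p\<in>D \<times> D. scale (?f (snd p)) (blk p v))"
          by (simp add: sum_subtractf[symmetric] split_def fdiff of_rat_diff scale_left_diff_distrib)
        also have "(\<Sum>p\<in>D \<times> D. scale (?f (fst p)) (blk p v)) = y (\<rho> z v)"
          using blk_sum[of ?f v] by (simp only: y_def)
        also have "(\<Sum>p\<in>D \<times> D. scale (?f (snd p)) (blk p v)) = (\<Sum>b\<in>D. scale (?f b) (\<Sum>a\<in>D. blk (a, b) v))"
          by (simp only: sum.cartesian_product' scale_sum_right fst_conv snd_conv) (rule sum.swap)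
        also have "\<dots> = \<rho> z (y v)"
          by (simp add: blk_def y_def \<pi>(4) endo_simps[OF R(1)])
        finally show ?thesis by simp
      qed
      then show ?thesis using w(1) by blast
    qed
    have "tr (\<lambda>v. \<rho> u (y v)) = 0" if "u \<in> J" for u
    proof -
      have "u \<in> span {bracket a b |a b. a \<in> J \<and> b \<in> J}"
        using J that by (simp add: perfect_def bracket_space_def)
      then show ?thesis
      proof (induction rule: span_induct)
        case base
        show ?case unfolding mem_Collect_eq
          by (rule subspaceI) (simp_all add: R tr_zero tr_add tr_scale)
      next
        case (step u)
        then obtain p q where pq: "u = bracket p q" "p \<in> J" "q \<in> J" by blast
        \<comment> \<open>By cyclicity the trace of \<open>[p, q] y\<close> is that of
          \<open>p [q, y]\<close>, and \<open>[q, y]\<close> is minus the operator of an element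
          \<open>w\<close> of \<open>J\<close>, to which the hypothesis on the form applies.\<close>
        obtain w where w: "w \<in> J" "\<And>v. y (\<rho> q v) - \<rho> q (y v) = \<rho> w v" using key[OF pq(3)] by blast
        have "tr (\<lambda>v. \<rho> u (y v)) = tr (\<lambda>v. \<rho> p (\<rho> q (y v))) - tr (\<lambda>v. \<rho> q (\<rho> p (y v)))"
          by (simp add: pq R(7) tr_diff)
        also have "tr (\<lambda>v. \<rho> q (\<rho> p (y v))) = tr (\<lambda>v. \<rho> p (y (\<rho> q v)))"
          using tr_comm[of "\<rho> q" "\<lambda>v. \<rho> p (y v)"] R(1) y endo_comp by blast
        also have "tr (\<lambda>v. \<rho> p (\<rho> q (y v))) - \<dots> = - tr (\<lambda>v. \<rho> p (\<rho> w v))"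
          by (simp add: w(2)[symmetric] endo_simps[OF R(1)] tr_diff)
        also have "\<dots> = 0" using form[OF pq(2) w(1)] by (simp add: trace_form_def)
        finally show ?case .
      qed
    qed
    then have "0 = tr (\<lambda>v. X (y v))" using x by (simp add: X_def)
    also have "\<dots> = (\<Sum>a\<in>D. ?f a * (a * of_nat (d a)))"
      by (simp add: y_def endo_simps[OF X] tr_sum tr_scale trX)
    finally have "f 0 = f (\<Sum>a\<in>D. ?f a * (a * of_nat (d a)))" by simp
    also have "\<dots> = (\<Sum>a\<in>D. f (of_rat (f a * of_nat (d a)) * a))"
      by (simp add: fsum of_rat_mult mult_ac)
    also have "\<dots> = (\<Sum>a\<in>D. (f a)\<^sup>2 * of_nat (d a))"
      by (simp only: f(2)) (simp add: power2_eq_square mult_ac)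
    finally have "(\<Sum>a\<in>D. (f a)\<^sup>2 * of_nat (d a)) = 0" using f0 by simp
    then have "(f a)\<^sup>2 * of_nat (d a) = 0"
      using D a(1) by (subst (asm) sum_nonneg_eq_0_iff) auto
    then show False using a(2) f(3) by simp
  qed
  have nil: "\<exists>n. (X ^^ n) v = 0" for v
  proof -
    have zero: "\<pi> a v = 0" if "a \<in> D" "a \<noteq> 0" for a
    proof -
      have "gen_eigenspace X a \<subseteq> {0}" using eig0[OF that(1)] that(2) by (auto simp: d_def)
      then show ?thesis using \<pi>(2)[OF that(1)] by blast
    qed
    have "v \<in> gen_eigenspace X 0"
    proof (cases "0 \<in> D")
      case True
      have "v = (\<Sum>a\<in>D. \<pi> a v)" by (rule \<pi>(4)[symmetric])
      also have "\<dots> = \<pi> 0 v" 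
        using zero by (subst sum.remove[OF D True]) (auto intro: sum.neutral)
      finally show ?thesis using \<pi>(2)[OF True, of v] by simp
    next
      case False
      then have "(\<Sum>a\<in>D. \<pi> a v) = 0" using zero by (intro sum.neutral) auto
      then have "v = 0" by (simp only: \<pi>(4))
      then show ?thesis using subspace_0[OF subspace_gen_eigenspace[OF X]] by simp
    qed
    then show ?thesis by (simp add: gen_eigenspace_def shift_def)
  qed
  show ?thesis
  proof (rule uniform_exponent[OF X endo_id nil])
    fix n assume "\<And>v. (X ^^ n) v = 0"
    then have "\<forall>v. (\<rho> x ^^ n) v = 0" by (simp add: X_def)
    then show ?thesis by (rule exI)
  qed
qed

end

section \<open>Engel's theorem for perfect subalgebras\<close>

context fd_lie_algebra
begin

lemma in_span_insert_subspace:
  assumes "subspace K" shows "z \<in> span (insert x K) \<longleftrightarrow> (\<exists>c. z - scale c x \<in> K)"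
proof -
  have "span K = K" by (rule span_eq_iff[THEN iffD2, OF assms])
  then show ?thesis unfolding span_insert by (simp only: mem_Collect_eq)
qed

lemma lie_subalgebra_insert:
  assumes K: "lie_subalgebra K" and x: "\<And>k. k \<in> K \<Longrightarrow> bracket k x \<in> K"
  shows "lie_subalgebra (span (insert x K))"
proof -
  have span: "z \<in> span (insert x K) \<longleftrightarrow> (\<exists>c. z - scale c x \<in> K)" for z
    using K in_span_insert_subspace by (simp add: lie_subalgebra_def)
  have "bracket y z \<in> span (insert x K)" if yz: "y \<in> span (insert x K)" "z \<in> span (insert x K)" for y z
  proof -
    obtain c d where cd: "y - scale c x \<in> K" "z - scale d x \<in> K" using yz span by blast
    define k l where "k = y - scale c x" and "l = z - scale d x"
    then have yz': "y = k + scale c x" "z = l + scale d x" and kl: "k \<in> K" "l \<in> K" using cd by auto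
    have "bracket x l \<in> K" using x[OF kl(2)] bracket_in_sym K by (auto simp: lie_subalgebra_def)
    then have "bracket y z \<in> K"
      using K x kl unfolding yz'
      by (auto simp: lie_subalgebra_def bracket_simps bracket_self subspace_add subspace_scale)
    then show ?thesis by (simp add: span_base)
  qed
  then show ?thesis by (simp add: lie_subalgebra_def)
qed

lemma maximal_subalgebra_exists:
  assumes "lie_subalgebra Z" "Z \<subset> J"
  obtains K where "lie_subalgebra K" "Z \<subseteq> K" "K \<subset> J"
    "\<And>K'. lie_subalgebra K' \<Longrightarrow> K \<subset> K' \<Longrightarrow> \<not> K' \<subset> J"
proof -
  define P where "P K \<longleftrightarrow> lie_subalgebra K \<and> Z \<subseteq> K \<and> K \<subset> J" for K
  have "P Z" using assms by (simp add: P_def)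
  moreover have "\<forall>K. P K \<longrightarrow> dim K < Suc (card Basis)"
    using dim_subset_UNIV by (simp add: dimension_def less_Suc_eq_le)
  ultimately obtain K where K: "P K" "\<And>K'. P K' \<Longrightarrow> dim K' \<le> dim K"
    using ex_has_greatest_nat[of P Z dim "Suc (card Basis)"] by blast
  have "\<not> K' \<subset> J" if K': "lie_subalgebra K'" "K \<subset> K'" for K'
  proof
    assume "K' \<subset> J"
    then have "P K'" using K K' by (auto simp: P_def)
    then have "dim K' \<le> dim K" by (rule K)
    then have "K = K'"
      using K K' by (intro subspace_dim_equal) (auto simp: P_def lie_subalgebra_def)
    then show False using K' by blast
  qed
  then show thesis using that[of K] K by (auto simp: P_def)
qed

text \<open>Engel's theorem in relative form, for \<open>K / Z\<close> acting on
  \<open>U / W\<close>. The induction on \<open>dim K\<close> runs over all pairs because it is used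
  twice: for \<open>K\<close> modulo a maximal subalgebra \<open>K'\<close>, which yields an element
  normalizing \<open>K'\<close>, and for \<open>K'\<close> acting on \<open>U / W\<close>.\<close>

lemma engel_invariant_pair:
  assumes Z: "lie_subalgebra Z" "\<And>z v. z \<in> Z \<Longrightarrow> v \<in> J \<Longrightarrow> bracket z v \<in> Z"
    and nil: "\<And>x v. x \<in> J \<Longrightarrow> v \<in> J \<Longrightarrow> \<exists>n. ((\<lambda>v. bracket x v) ^^ n) v \<in> Z"
    and K: "lie_subalgebra K" "Z \<subseteq> K" "K \<subseteq> J"
    and U: "subspace U" "U \<subseteq> J" "\<And>k u. k \<in> K \<Longrightarrow> u \<in> U \<Longrightarrow> bracket k u \<in> U"
    and W: "subspace W" "Z \<subseteq> W" "W \<subset> U" "\<And>k u. k \<in> K \<Longrightarrow> u \<in> W \<Longrightarrow> bracket k u \<in> W"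
  shows "\<exists>v\<in>U - W. \<forall>k\<in>K. bracket k v \<in> W"
  using K U W
proof (induction "dim K" arbitrary: K U W rule: less_induct)
  case less
  note K = less.prems(1-3) and U = less.prems(4-6) and W = less.prems(7-10)
  show ?case
  proof (cases "Z = K")
    case True
    then show ?thesis using W(2,3) Z(2) U(2) by blast
  next
    case False
    then obtain K' where K': "lie_subalgebra K'" "Z \<subseteq> K'" "K' \<subset> K"
        "\<And>K''. lie_subalgebra K'' \<Longrightarrow> K' \<subset> K'' \<Longrightarrow> \<not> K'' \<subset> K"
      using maximal_subalgebra_exists[OF Z(1), of K] K(2) by blast
    have dim: "dim K' < dim K"
      using K'(1,3) K(1) by (intro dim_psubset) (auto simp: lie_subalgebra_def span_eq_iff[THEN iffD2])
    have "\<exists>v\<in>K - K'. \<forall>k\<in>K'. bracket k v \<in> K'"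
      using K' K by (intro less.hyps[OF dim]) (auto simp: lie_subalgebra_def)
    then obtain x where x: "x \<in> K" "x \<notin> K'" "\<And>k. k \<in> K' \<Longrightarrow> bracket k x \<in> K'" by blast
    let ?K = "span (insert x K')"
    have "?K \<subseteq> K" using x K'(3) K(1) by (intro span_minimal) (auto simp: lie_subalgebra_def)
    moreover have "K' \<subset> ?K" using x span_superset[of "insert x K'"] by blast
    ultimately have KK: "K = ?K" using K'(4)[OF lie_subalgebra_insert[OF K'(1) x(3)]] by blast
    have "\<exists>v\<in>U - W. \<forall>k\<in>K'. bracket k v \<in> W"
      using K' K U W by (intro less.hyps[OF dim]) auto
    then obtain v0 where v0: "v0 \<in> U" "v0 \<notin> W" "\<forall>k\<in>K'. bracket k v0 \<in> W" by blast
    let ?x = "\<lambda>v. bracket x v"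
    obtain n where "(?x ^^ n) v0 \<in> W" using nil[of x v0] x(1) K(3) v0 U(2) W(2) by blast
    \<comment> \<open>The first iterate that \<open>x\<close> carries into \<open>W\<close>. Being
      annihilated by \<open>K'\<close> modulo \<open>W\<close> is inherited by all iterates, since
      \<open>x\<close> normalizes \<open>K'\<close>.\<close>
    then obtain m where m: "(?x ^^ m) v0 \<notin> W" "(?x ^^ Suc m) v0 \<in> W"
      using ex_least_nat_less[of "\<lambda>n. (?x ^^ n) v0 \<in> W" n] v0(2) by auto
    have inv: "(?x ^^ j) v0 \<in> U \<and> (\<forall>k\<in>K'. bracket k ((?x ^^ j) v0) \<in> W)" for j
    proof (induction j)
      case (Suc j)
      have "bracket k (bracket x ((?x ^^ j) v0)) \<in> W" if k: "k \<in> K'" for k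
      proof -
        have "bracket k (bracket x ((?x ^^ j) v0))
            = bracket (bracket k x) ((?x ^^ j) v0) + bracket x (bracket k ((?x ^^ j) v0))"
          by (rule bracket_bracket)
        then show ?thesis using Suc x k W(1,4) by (simp add: subspace_add)
      qed
      then show ?case using Suc U(3) x(1) by simp
    qed (use v0 in auto)
    have "bracket k ((?x ^^ m) v0) \<in> W" if k: "k \<in> K" for k
    proof -
      have "k \<in> span (insert x K')" using k KK by blast
      then obtain c where c: "k - scale c x \<in> K'"
        using K'(1) in_span_insert_subspace by (auto simp: lie_subalgebra_def)
      have "bracket (k - scale c x) ((?x ^^ m) v0) \<in> W" using inv c by blast
      moreover have "scale c (bracket x ((?x ^^ m) v0)) \<in> W" using m W(1) by (simp add: subspace_scale)
      moreover have "bracket k ((?x ^^ m) v0)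
          = bracket (k - scale c x) ((?x ^^ m) v0) + scale c (bracket x ((?x ^^ m) v0))"
        by (simp add: bracket_simps)
      ultimately show ?thesis using subspace_add[OF W(1)] by metis
    qed
    then show ?thesis using m inv by blast
  qed
qed

text \<open>Modulo the kernel \<open>Z\<close> of \<open>\<rho>\<close> on \<open>J\<close>, all
  adjoint maps of \<open>J\<close> are nilpotent. If \<open>Z\<close> were proper, Engel's theorem
  would make a maximal subalgebra above \<open>Z\<close> an ideal of codimension one, which would
  contain \<open>[J, J] = J\<close>.\<close>

lemma perfect_nilpotent_trivial:
  assumes J: "perfect J" and rep: "lie_rep J \<rho>"
    and nil: "\<And>x. x \<in> J \<Longrightarrow> \<exists>n. \<forall>v. (\<rho> x ^^ n) v = 0" and "x \<in> J"
  shows "\<rho> x v = 0"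
proof -
  note R = lie_repD[OF rep]
  have subJ: "lie_subalgebra J" "subspace J" and brJ: "\<And>u v. u \<in> J \<Longrightarrow> v \<in> J \<Longrightarrow> bracket u v \<in> J"
    using J by (auto simp: perfect_def lie_subalgebra_def)
  define Z where "Z = {x \<in> J. \<forall>v. \<rho> x v = 0}"
  have subZ: "subspace Z" unfolding Z_def
    by (rule subspaceI) (use subJ in \<open>auto simp: R subspace_0 subspace_add subspace_scale\<close>)
  have Zbr: "bracket z v \<in> Z" if "z \<in> Z" "v \<in> J" for z v
    using that brJ by (auto simp: Z_def R(7) endo_0[OF R(1)])
  have Z: "lie_subalgebra Z"
    using subZ Zbr unfolding lie_subalgebra_def by (auto simp: Z_def)
  have adnil: "\<exists>n. ((\<lambda>v. bracket x v) ^^ n) v \<in> Z" if xv: "x \<in> J" "v \<in> J" for x v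
  proof -
    interpret E: lin_space fun_scale by (rule lin_space_fun)
    obtain n where n: "\<And>v. (\<rho> x ^^ n) v = 0" using nil[OF xv(1)] by blast
    have s: "shift (\<rho> x) 0 = \<rho> x" "E.shift (commutator (\<rho> x)) 0 = commutator (\<rho> x)"
      by (auto simp: shift_def E.shift_def fun_eq_iff)
    have "(E.shift (commutator (\<rho> x)) (0 - 0) ^^ (n + n)) (\<rho> v) = 0"
      by (rule commutator_shift_nilpotent[OF R(1) R(1)]) (simp_all add: s n endo_0[OF R(1)])
    then have "(commutator (\<rho> x) ^^ (n + n)) (\<rho> v) = 0" by (simp add: s)
    moreover have "((\<lambda>v. bracket x v) ^^ k) v \<in> J
        \<and> \<rho> (((\<lambda>v. bracket x v) ^^ k) v) = (commutator (\<rho> x) ^^ k) (\<rho> v)" for k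
    proof (induction k)
      case (Suc k)
      let ?w = "((\<lambda>v. bracket x v) ^^ k) v"
      have "\<rho> (bracket x ?w) = commutator (\<rho> x) (\<rho> ?w)"
        using R(7)[OF xv(1), of ?w] Suc by (auto simp: fun_eq_iff commutator_def)
      then show ?case using Suc brJ xv(1) by simp
    qed (use xv in simp)
    ultimately have "((\<lambda>v. bracket x v) ^^ (n + n)) v \<in> Z" unfolding Z_def by simp
    then show ?thesis by blast
  qed
  have "Z = J"
  proof (rule ccontr)
    assume "Z \<noteq> J"
    then have "Z \<subset> J" by (auto simp: Z_def)
    then obtain K where K: "lie_subalgebra K" "Z \<subseteq> K" "K \<subset> J"
        "\<And>K'. lie_subalgebra K' \<Longrightarrow> K \<subset> K' \<Longrightarrow> \<not> K' \<subset> J"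
      using maximal_subalgebra_exists[OF Z, of J] by blast
    have "\<exists>v\<in>J - K. \<forall>k\<in>K. bracket k v \<in> K"
      using K subJ brJ by (intro engel_invariant_pair[OF Z Zbr adnil]) (auto simp: lie_subalgebra_def)
    then obtain x where x: "x \<in> J" "x \<notin> K" "\<And>k. k \<in> K \<Longrightarrow> bracket k x \<in> K" by blast
    let ?K = "span (insert x K)"
    have "?K \<subseteq> J" using x K(3) subJ by (intro span_minimal) auto
    moreover have "K \<subset> ?K" using x span_superset[of "insert x K"] by blast
    ultimately have KK: "J = ?K" using K(4)[OF lie_subalgebra_insert[OF K(1) x(3)]] by blast
    have "bracket y z \<in> K" if yz: "y \<in> J" "z \<in> J" for y z
    proof -
      have "\<exists>c. w - scale c x \<in> K" if "w \<in> J" for w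
        using that K(1) in_span_insert_subspace unfolding KK by (auto simp: lie_subalgebra_def)
      then obtain c d where cd: "y - scale c x \<in> K" "z - scale d x \<in> K" using yz by meson
      define k l where "k = y - scale c x" and "l = z - scale d x"
      then have yz': "y = k + scale c x" "z = l + scale d x" and kl: "k \<in> K" "l \<in> K" using cd by auto
      have "bracket x l \<in> K" using x(3)[OF kl(2)] bracket_in_sym K(1) by (auto simp: lie_subalgebra_def)
      then show "bracket y z \<in> K"
        using K(1) x(3) kl unfolding yz'
        by (auto simp: lie_subalgebra_def bracket_simps bracket_self subspace_add subspace_scale)
    qed
    then have "bracket_space J J \<subseteq> K" using K(1) by (intro bracket_space_subset) (auto simp: lie_subalgebra_def)
    then show False using J K(3) by (auto simp: perfect_def)
  qed
  then show ?thesis using \<open>x \<in> J\<close> by (auto simp: Z_def)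
qed

lemma cartan_criterion:
  assumes "perfect J" "lie_rep J \<rho>" "\<And>x y. x \<in> J \<Longrightarrow> y \<in> J \<Longrightarrow> trace_form \<rho> x y = 0" "x \<in> J"
  shows "\<rho> x v = 0"
  using perfect_nilpotent_trivial[OF assms(1,2)] cartan_nilpotent[OF assms(1-3)] assms(4) by blast

end

context fd_lie_algebra
begin

section \<open>Symmetric bilinear forms\<close>

definition sym_form :: "('a \<Rightarrow> 'a \<Rightarrow> 'k) \<Rightarrow> bool" where
  "sym_form \<beta> \<longleftrightarrow> (\<forall>x y. \<beta> x y = \<beta> y x) \<and> (\<forall>x y z. \<beta> (x + y) z = \<beta> x z + \<beta> y z) \<and>
     (\<forall>c x y. \<beta> (scale c x) y = c * \<beta> x y)"

lemma sym_form_sym: "sym_form \<beta> \<Longrightarrow> \<beta> x y = \<beta> y x"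
  by (simp add: sym_form_def)

lemma sym_form_left:
  assumes "sym_form \<beta>"
  shows "\<beta> (x + y) z = \<beta> x z + \<beta> y z" "\<beta> (scale c x) z = c * \<beta> x z" "\<beta> 0 z = 0"
    "\<beta> (x - y) z = \<beta> x z - \<beta> y z" "\<beta> (sum f A) z = (\<Sum>a\<in>A. \<beta> (f a) z)"
proof -
  show add: "\<beta> (x + y) z = \<beta> x z + \<beta> y z" and sc: "\<beta> (scale c x) z = c * \<beta> x z" for x y c
    using assms unfolding sym_form_def by blast+
  show zero: "\<beta> 0 z = 0" using sc[of 0 0] by simp
  show "\<beta> (x - y) z = \<beta> x z - \<beta> y z" using add[of "x - y" y] by simp
  show "\<beta> (sum f A) z = (\<Sum>a\<in>A. \<beta> (f a) z)"
    by (induction A rule: infinite_finite_induct) (simp_all add: zero add)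
qed

lemma sym_form_right:
  assumes "sym_form \<beta>"
  shows "\<beta> z (x + y) = \<beta> z x + \<beta> z y" "\<beta> z (scale c x) = c * \<beta> z x" "\<beta> z 0 = 0"
    "\<beta> z (x - y) = \<beta> z x - \<beta> z y" "\<beta> z (sum f A) = (\<Sum>a\<in>A. \<beta> z (f a))"
proof -
  have sym: "\<beta> z w = \<beta> w z" for w by (rule sym_form_sym[OF assms])
  show "\<beta> z (x + y) = \<beta> z x + \<beta> z y" unfolding sym[of "x + y"] sym[of x] sym[of y]
    by (rule sym_form_left[OF assms])
  show "\<beta> z (scale c x) = c * \<beta> z x" unfolding sym[of "scale c x"] sym[of x]
    by (rule sym_form_left[OF assms])
  show "\<beta> z 0 = 0" unfolding sym[of 0] by (rule sym_form_left[OF assms])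
  show "\<beta> z (x - y) = \<beta> z x - \<beta> z y" unfolding sym[of "x - y"] sym[of x] sym[of y]
    by (rule sym_form_left[OF assms])
  have "\<beta> z (f a) = \<beta> (f a) z" for a by (rule sym)
  then show "\<beta> z (sum f A) = (\<Sum>a\<in>A. \<beta> z (f a))" unfolding sym[of "sum f A"]
    by (simp only: sym_form_left(5)[OF assms])
qed

lemmas sym_form_simps = sym_form_left sym_form_right

lemma sym_form_trace_form: "lie_rep J \<rho> \<Longrightarrow> sym_form (trace_form \<rho>)"
  unfolding sym_form_def using trace_form_linear[of J \<rho>] by blast

definition perp :: "('a \<Rightarrow> 'a \<Rightarrow> 'k) \<Rightarrow> 'a set \<Rightarrow> 'a set" where
  "perp \<beta> D = {x. \<forall>y\<in>D. \<beta> x y = 0}"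

lemma subspace_perp: "sym_form \<beta> \<Longrightarrow> subspace (perp \<beta> D)"
  unfolding perp_def by (rule subspaceI) (auto simp: sym_form_simps)

text \<open>Dual bases of \<open>D\<close> modulo the radical of \<open>\<beta>\<close> on
  \<open>D\<close>: the form may be degenerate, so both expansions are congruences modulo that
  radical.\<close>

definition dual_pair :: "('a \<Rightarrow> 'a \<Rightarrow> 'k) \<Rightarrow> 'a set \<Rightarrow> 'a set \<Rightarrow> ('a \<Rightarrow> 'a) \<Rightarrow> bool" where
  "dual_pair \<beta> D C b \<longleftrightarrow> finite C \<and> C \<subseteq> D \<and> (\<forall>c\<in>C. b c \<in> D) \<and>
     (\<forall>c\<in>C. \<forall>d\<in>C. \<beta> (b c) d = (if d = c then 1 else 0)) \<and>
     (\<forall>x\<in>D. x - (\<Sum>c\<in>C. scale (\<beta> x (b c)) c) \<in> D \<inter> perp \<beta> D) \<and>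
     (\<forall>x\<in>D. x - (\<Sum>c\<in>C. scale (\<beta> c x) (b c)) \<in> D \<inter> perp \<beta> D)"

lemma dual_pairD:
  assumes "dual_pair \<beta> D C b"
  shows "finite C" "C \<subseteq> D" "\<And>c. c \<in> C \<Longrightarrow> b c \<in> D"
    "\<And>c d. c \<in> C \<Longrightarrow> d \<in> C \<Longrightarrow> \<beta> (b c) d = (if d = c then 1 else 0)"
    "\<And>x. x \<in> D \<Longrightarrow> x - (\<Sum>c\<in>C. scale (\<beta> x (b c)) c) \<in> D \<inter> perp \<beta> D"
    "\<And>x. x \<in> D \<Longrightarrow> x - (\<Sum>c\<in>C. scale (\<beta> c x) (b c)) \<in> D \<inter> perp \<beta> D"
  using assms unfolding dual_pair_def by blast+

text \<open>On a complement \<open>M\<close> of the radical in \<open>D\<close> the form is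
  nondegenerate, so the map \<open>T\<close> built from a basis of \<open>M\<close> is invertible
  there. The dual basis consists of the preimages of the basis vectors.\<close>

lemma dual_bases:
  assumes \<beta>: "sym_form \<beta>" and D: "subspace D"
  shows "\<exists>C b. dual_pair \<beta> D C b"
proof -
  note B = sym_form_simps[OF \<beta>]
  define N where "N = D \<inter> perp \<beta> D"
  have N: "subspace N" "N \<subseteq> D" using D subspace_perp[OF \<beta>] by (auto simp: N_def subspace_inter)
  have N0: "\<beta> x y = 0" "\<beta> y x = 0" if "x \<in> N" "y \<in> D" for x y
    using that sym_form_sym[OF \<beta>, of y x] by (auto simp: N_def perp_def)
  obtain p where p: "endo p" "\<And>x. p x \<in> N" "\<And>x. x \<in> N \<Longrightarrow> p x = x"
    using projection_exists[OF N(1)] by blast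
  define M where "M = D \<inter> {x. p x \<in> {0}}"
  have M: "subspace M" "M \<subseteq> D"
    unfolding M_def using subspace_inter[OF D subspace_preimage[OF p(1) subspace_single_0]] by auto
  have MN: "x = 0" if "x \<in> M" "x \<in> N" for x using that p(3) by (simp add: M_def)
  have Mc: "x - p x \<in> M" if "x \<in> D" for x
    using that N p D by (auto simp: M_def endo_diff[OF p(1)] intro!: subspace_diff)
  obtain C where C: "C \<subseteq> M" "independent C" "M \<subseteq> span C" by (rule basis_exists[of M])
  have fin: "finite C" using C(2) finiteI_independent by blast
  obtain r where r: "endo r" "\<And>x. r x \<in> M" "\<And>x. x \<in> M \<Longrightarrow> r x = x"
    using projection_exists[OF M(1)] by blast
  define T where "T x = (\<Sum>c\<in>C. scale (\<beta> x c) c)" for x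
  \<comment> \<open>Extended by the identity on the kernel of \<open>r\<close>, the map acts on the
    whole space, where injectivity gives surjectivity.\<close>
  define T' where "T' x = T (r x) + (x - r x)" for x
  have T: "endo T"
    by (rule endoI) (simp_all add: T_def B scale_left_distrib sum.distrib scale_sum_right)
  have TM: "T x \<in> M" for x unfolding T_def using C M by (auto intro!: subspace_sum subspace_scale)
  have T': "endo T'" unfolding T'_def
    by (rule endoI) (simp_all add: endo_simps[OF T] endo_simps[OF r(1)] scale_right_distrib
        scale_right_diff_distrib)
  have rT': "r (T' x) = T (r x)" for x
    using r TM by (simp add: T'_def endo_simps[OF r(1)])
  have orth: "x \<in> N" if "x \<in> M" "\<forall>c\<in>C. \<beta> x c = 0" for x
  proof -
    have sub: "subspace {y. \<beta> x y = 0}" by (rule subspaceI) (simp_all add: B)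
    have "C \<subseteq> {y. \<beta> x y = 0}" using that by blast
    then have "M \<subseteq> {y. \<beta> x y = 0}" using span_minimal[OF _ sub] C by blast
    then have "\<beta> x y = 0" if "y \<in> D" for y
    proof -
      have "\<beta> x (y - p y) = 0" using \<open>M \<subseteq> {y. \<beta> x y = 0}\<close> Mc[OF that] by blast
      moreover have "\<beta> x (p y) = 0" using N0 p \<open>x \<in> M\<close> M by blast
      ultimately show ?thesis by (simp add: B)
    qed
    then show ?thesis using that M by (auto simp: N_def perp_def)
  qed
  have "inj T'"
  proof (rule injI)
    fix x y assume "T' x = T' y"
    then have z: "T' (x - y) = 0" by (simp add: endo_simps[OF T'])
    define u where "u = r (x - y)"
    have Tu: "T u = 0" using rT'[of "x - y"] z endo_0[OF r(1)] by (simp add: u_def)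
    have "\<forall>c\<in>C. \<beta> u c = 0"
      using independentD[OF C(2) fin order_refl, of "\<lambda>c. \<beta> u c"] Tu by (auto simp: T_def)
    then have "u = 0" using MN orth r(2) by (auto simp: u_def)
    then show "x = y" using z Tu by (simp add: T'_def u_def)
  qed
  then have surj: "surj T'" using linear_inj_imp_surj[OF T'] by blast
  have "\<exists>b. b \<in> M \<and> T b = c" if "c \<in> C" for c
  proof -
    obtain x where "c = T' x" using surj by (meson surjE)
    then have "T (r x) = c" using rT'[of x] r(3)[of c] that C by auto
    then show ?thesis using r(2) by blast
  qed
  then obtain b where b: "\<And>c. c \<in> C \<Longrightarrow> b c \<in> M" "\<And>c. c \<in> C \<Longrightarrow> T (b c) = c" by metis
  have delta: "\<beta> (b c) d = (if d = c then 1 else 0)" if cd: "c \<in> C" "d \<in> C" for c d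
  proof -
    have "(\<Sum>d\<in>C. scale (\<beta> (b c) d - (if d = c then 1 else 0)) d) = T (b c) - (\<Sum>d\<in>C. if d = c then d else 0)"
      by (simp add: T_def scale_left_diff_distrib sum_subtractf if_distrib[of "\<lambda>k. scale k _"] cong: if_cong)
    also have "\<dots> = 0" using b(2) cd fin by simp
    finally have "\<beta> (b c) d - (if d = c then 1 else 0) = 0"
      using independentD[OF C(2) fin order_refl _ cd(2), of "\<lambda>d. \<beta> (b c) d - (if d = c then 1 else 0)"]
      by blast
    then show ?thesis by simp
  qed
  have "dual_pair \<beta> D C b"
    unfolding dual_pair_def
  proof (intro conjI ballI fin)
    show "C \<subseteq> D" using C M by auto
    show "b c \<in> D" if "c \<in> C" for c using b that M by auto
    show "\<beta> (b c) d = (if d = c then 1 else 0)" if "c \<in> C" "d \<in> C" for c d using delta that .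
  next
    fix x assume x: "x \<in> D"
    have "x - p x \<in> span C" using Mc[OF x] C by blast
    then obtain k where k: "x - p x = (\<Sum>c\<in>C. scale (k c) c)"
      unfolding span_finite[OF fin] by blast
    have "\<beta> x (b c) = k c" if c: "c \<in> C" for c
    proof -
      have "\<beta> x (b c) = \<beta> (x - p x) (b c)"
        using N0(1)[OF p(2), of "b c"] b(1)[OF c] M by (simp add: B subset_iff)
      also have "\<dots> = (\<Sum>d\<in>C. k d * (if d = c then 1 else 0))"
        unfolding k using c by (simp add: B sym_form_sym[OF \<beta>, of _ "b c"] delta)
      also have "\<dots> = k c" using c fin by (simp add: if_distrib[of "(*) _"] cong: if_cong)
      finally show ?thesis .
    qed
    then have "x - (\<Sum>c\<in>C. scale (\<beta> x (b c)) c) = p x" using k by (simp add: algebra_simps)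
    then show "x - (\<Sum>c\<in>C. scale (\<beta> x (b c)) c) \<in> D \<inter> perp \<beta> D" using p(2) N_def by simp
  next
    fix x assume x: "x \<in> D"
    let ?y = "x - (\<Sum>c\<in>C. scale (\<beta> c x) (b c))"
    have yD: "?y \<in> D" using x b M D by (auto intro!: subspace_diff subspace_sum subspace_scale)
    then have "?y - p ?y \<in> M" by (rule Mc)
    moreover have "\<beta> (?y - p ?y) c = 0" if c: "c \<in> C" for c
    proof -
      have "c \<in> D" using c C M by blast
      then have "\<beta> (?y - p ?y) c = \<beta> ?y c" using N0(1)[OF p(2)] by (simp add: B)
      also have "\<dots> = \<beta> x c - (\<Sum>d\<in>C. \<beta> d x * (if c = d then 1 else 0))"
        using c by (simp add: B delta)
      also have "\<dots> = 0" using c fin sym_form_sym[OF \<beta>, of c x] by (simp add: if_distrib[of "(*) _"] cong: if_cong)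
      finally show ?thesis .
    qed
    ultimately have "?y - p ?y = 0" using orth MN by blast
    then have "?y = p ?y" by simp
    then show "?y \<in> D \<inter> perp \<beta> D" using p(2)[of ?y] unfolding N_def by simp
  qed
  then show ?thesis by blast
qed

text \<open>The projection formula for dual bases. Elements of \<open>D\<close> are expanded only up
  to the radical, and \<open>rad\<close> makes \<open>x\<close> orthogonal to the error.\<close>

lemma orthogonal_decomposition:
  assumes \<beta>: "sym_form \<beta>" and D: "subspace D"
    and rad: "\<And>x n. x \<in> K \<Longrightarrow> n \<in> D \<inter> perp \<beta> D \<Longrightarrow> \<beta> x n = 0" and x: "x \<in> K"
  obtains d where "d \<in> D" "x - d \<in> perp \<beta> D"
proof -
  note B = sym_form_simps[OF \<beta>]
  obtain C b where dual: "dual_pair \<beta> D C b" using dual_bases[OF \<beta> D] by blast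
  note C = dual_pairD[OF dual]
  define d where "d = (\<Sum>c\<in>C. scale (\<beta> x (b c)) c)"
  have "\<beta> (x - d) y = 0" if y: "y \<in> D" for y
  proof -
    have "\<beta> x (y - (\<Sum>c\<in>C. scale (\<beta> c y) (b c))) = 0" using rad[OF x C(6)[OF y]] .
    then show ?thesis by (simp add: d_def B mult.commute)
  qed
  then have "x - d \<in> perp \<beta> D" by (simp add: perp_def)
  moreover have "d \<in> D" unfolding d_def using C D by (auto intro!: subspace_sum subspace_scale)
  ultimately show thesis using that by blast
qed

section \<open>Subquotients of the adjoint representation\<close>

definition subquotient_proj :: "('a \<Rightarrow> 'a) \<Rightarrow> 'a set \<Rightarrow> 'a set \<Rightarrow> bool" where
  "subquotient_proj q U W \<longleftrightarrow> endo q \<and> (\<forall>x. q x \<in> U) \<and> (\<forall>w\<in>W. q w = 0) \<and> (\<forall>x\<in>U. x - q x \<in> W) \<and>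
     (\<forall>x. q (q x) = q x)"

definition ad_sub :: "('a \<Rightarrow> 'a) \<Rightarrow> 'a \<Rightarrow> 'a \<Rightarrow> 'a" where
  "ad_sub q x v = q (bracket x (q v))"

lemma lie_rep_ad_sub:
  assumes q: "subquotient_proj q U W"
    and U: "\<And>x u. x \<in> K \<Longrightarrow> u \<in> U \<Longrightarrow> bracket x u \<in> U"
    and W: "\<And>x u. x \<in> K \<Longrightarrow> u \<in> W \<Longrightarrow> bracket x u \<in> W"
  shows "lie_rep K (ad_sub q)"
proof -
  have q': "endo q" "\<And>x. q x \<in> U" "\<And>w. w \<in> W \<Longrightarrow> q w = 0" "\<And>x. x \<in> U \<Longrightarrow> x - q x \<in> W"
    using q by (auto simp: subquotient_proj_def)
  \<comment> \<open>\<open>u - q u\<close> lies in \<open>W\<close>, which is stable under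
    \<open>x\<close> and killed by \<open>q\<close>.\<close>
  have qq: "q (bracket x (q u)) = q (bracket x u)" if "x \<in> K" "u \<in> U" for x u
    using q'(3)[OF W[OF that(1) q'(4)[OF that(2)]]] by (simp add: bracket_simps endo_simps[OF q'(1)])
  have "ad_sub q (bracket x y) v = ad_sub q x (ad_sub q y v) - ad_sub q y (ad_sub q x v)"
    if "x \<in> K" "y \<in> K" for x y v
    using that by (simp add: ad_sub_def qq U q' jacobi_left endo_simps[OF q'(1)])
  moreover have "endo (ad_sub q x)" "endo (\<lambda>x. ad_sub q x v)" for x v
    unfolding ad_sub_def by (rule endoI; simp add: endo_simps[OF q'(1)] bracket_simps)+
  ultimately show ?thesis by (simp add: lie_rep_def)
qed

lemma ad_sub_trivial_iff:
  assumes q: "subquotient_proj q U W" and "subspace W"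
    and U: "\<And>u. u \<in> U \<Longrightarrow> bracket x u \<in> U" and W: "\<And>u. u \<in> W \<Longrightarrow> bracket x u \<in> W"
  shows "(\<forall>v. ad_sub q x v = 0) \<longleftrightarrow> (\<forall>u\<in>U. bracket x u \<in> W)"
proof -
  have q': "endo q" "\<And>x. q x \<in> U" "\<And>w. w \<in> W \<Longrightarrow> q w = 0" "\<And>x. x \<in> U \<Longrightarrow> x - q x \<in> W"
    using q by (auto simp: subquotient_proj_def)
  have "bracket x u \<in> W" if u: "u \<in> U" and triv: "\<forall>v. ad_sub q x v = 0" for u
  proof -
    have "bracket x (q u) - q (bracket x (q u)) \<in> W" using q'(4)[OF U[OF q'(2)]] .
    then have "bracket x (q u) \<in> W" using triv by (simp add: ad_sub_def)
    moreover have "bracket x (u - q u) \<in> W" using W[OF q'(4)[OF u]] .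
    ultimately have "bracket x (q u) + bracket x (u - q u) \<in> W" by (rule subspace_add[OF assms(2)])
    then show ?thesis by (simp add: bracket_simps)
  qed
  then show ?thesis using q'(2,3) by (auto simp: ad_sub_def)
qed

end

section \<open>Homogeneous components\<close>

locale fd_graded_lie_algebra = graded_lie_algebra scale bracket G comp + fd_lie_algebra scale bracket Basis
  for scale :: "'k::{alg_closed_field, field_char_0} \<Rightarrow> 'a::ab_group_add \<Rightarrow> 'a"
    and bracket :: "'a \<Rightarrow> 'a \<Rightarrow> 'a" and G :: "('g, 'm) monoid_scheme" (structure)
    and comp :: "'g \<Rightarrow> 'a set" and Basis +
  assumes finite_carrier: "finite (carrier G)"
begin

lemma subspace_comp: "g \<in> carrier G \<Longrightarrow> subspace (comp g)"
  using decomposition by (simp add: internal_direct_sum_def)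

lemma comp_independent:
  assumes "\<forall>g\<in>carrier G. z g \<in> comp g" "(\<Sum>g\<in>carrier G. z g) = 0"
  shows "\<forall>g\<in>carrier G. z g = 0"
  using decomposition finite_carrier assms unfolding internal_direct_sum_def by blast

lemma comp_spans: "\<exists>z. (\<forall>g\<in>carrier G. z g \<in> comp g) \<and> x = (\<Sum>g\<in>carrier G. z g)"
proof -
  let ?S = "{x. \<exists>z. (\<forall>g\<in>carrier G. z g \<in> comp g) \<and> x = (\<Sum>g\<in>carrier G. z g)}"
  have "subspace ?S"
  proof (rule subspaceI)
    show "0 \<in> ?S" using subspace_comp by (auto intro!: exI[of _ "\<lambda>_. 0"] simp: subspace_0)
    fix x y c assume "x \<in> ?S" "y \<in> ?S"
    then obtain z w where zw: "\<forall>g\<in>carrier G. z g \<in> comp g" "x = (\<Sum>g\<in>carrier G. z g)"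
      "\<forall>g\<in>carrier G. w g \<in> comp g" "y = (\<Sum>g\<in>carrier G. w g)" by blast
    then show "x + y \<in> ?S" using subspace_comp
      by (auto intro!: exI[of _ "\<lambda>g. z g + w g"] simp: subspace_add sum.distrib)
    show "scale c x \<in> ?S" using zw subspace_comp
      by (auto intro!: exI[of _ "\<lambda>g. scale c (z g)"] simp: subspace_scale scale_sum_right)
  qed
  moreover have "comp g \<subseteq> ?S" if "g \<in> carrier G" for g
  proof
    fix x assume "x \<in> comp g"
    then show "x \<in> ?S" using that finite_carrier subspace_comp
      by (auto intro!: exI[of _ "\<lambda>h. if h = g then x else 0"] simp: subspace_0)
  qed
  ultimately have "span (\<Union>g\<in>carrier G. comp g) \<subseteq> ?S" by (intro span_minimal UN_least)
  moreover have "span (\<Union>g\<in>carrier G. comp g) = UNIV"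
    using decomposition by (simp add: internal_direct_sum_def)
  ultimately show ?thesis by blast
qed

definition homogeneous_part :: "'g \<Rightarrow> 'a \<Rightarrow> 'a" where
  "homogeneous_part = (SOME \<pi>. (\<forall>g\<in>carrier G. endo (\<pi> g) \<and> (\<forall>x. \<pi> g x \<in> comp g) \<and>
     (\<forall>h\<in>carrier G. \<forall>x\<in>comp h. \<pi> g x = (if g = h then x else 0))) \<and>
     (\<forall>x. (\<Sum>g\<in>carrier G. \<pi> g x) = x))"

abbreviation hp where "hp \<equiv> homogeneous_part"

lemma hp:
  shows endo_hp: "g \<in> carrier G \<Longrightarrow> endo (hp g)"
    and hp_in_comp: "g \<in> carrier G \<Longrightarrow> hp g x \<in> comp g"
    and hp_comp: "g \<in> carrier G \<Longrightarrow> h \<in> carrier G \<Longrightarrow> x \<in> comp h \<Longrightarrow> hp g x = (if g = h then x else 0)"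
    and sum_hp: "(\<Sum>g\<in>carrier G. hp g x) = x"
proof -
  let ?P = "\<lambda>\<pi>. (\<forall>g\<in>carrier G. endo (\<pi> g) \<and> (\<forall>x. \<pi> g x \<in> comp g) \<and>
     (\<forall>h\<in>carrier G. \<forall>x\<in>comp h. \<pi> g x = (if g = h then x else 0))) \<and>
     (\<forall>x. (\<Sum>g\<in>carrier G. \<pi> g x) = x)"
  have "\<exists>\<pi>. ?P \<pi>"
  proof (rule direct_sum_projections[OF finite_carrier subspace_comp comp_spans comp_independent])
    fix \<pi> assume "\<And>g. g \<in> carrier G \<Longrightarrow> endo (\<pi> g)" "\<And>g x. g \<in> carrier G \<Longrightarrow> \<pi> g x \<in> comp g"
      "\<And>g h x. g \<in> carrier G \<Longrightarrow> h \<in> carrier G \<Longrightarrow> x \<in> comp h \<Longrightarrow> \<pi> g x = (if g = h then x else 0)"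
      "\<And>x. (\<Sum>g\<in>carrier G. \<pi> g x) = x"
    then have "?P \<pi>" by simp
    then show ?thesis by (rule exI[of ?P])
  qed
  then have "?P hp" unfolding homogeneous_part_def by (rule someI_ex)
  then show "g \<in> carrier G \<Longrightarrow> endo (hp g)" "g \<in> carrier G \<Longrightarrow> hp g x \<in> comp g"
    "g \<in> carrier G \<Longrightarrow> h \<in> carrier G \<Longrightarrow> x \<in> comp h \<Longrightarrow> hp g x = (if g = h then x else 0)"
    "(\<Sum>g\<in>carrier G. hp g x) = x" by blast+
qed

lemma hp_hp: "g \<in> carrier G \<Longrightarrow> h \<in> carrier G \<Longrightarrow> hp g (hp h x) = (if g = h then hp h x else 0)"
  using hp_comp hp_in_comp by blast

lemma in_comp_iff: "g \<in> carrier G \<Longrightarrow> x \<in> comp g \<longleftrightarrow> hp g x = x"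
  using hp_comp[of g g x] hp_in_comp[of g x] by auto

lemma graded_iff: "graded V \<longleftrightarrow> subspace V \<and> (\<forall>x\<in>V. \<forall>g\<in>carrier G. hp g x \<in> V)"
proof
  assume V: "graded V"
  then have sp: "V = span (\<Union>g\<in>carrier G. V \<inter> comp g)"
    by (simp add: graded_def internal_direct_sum_def)
  then have sub: "subspace V" by (metis subspace_span)
  have "hp g x \<in> V" if "x \<in> V" "g \<in> carrier G" for x g
  proof -
    have "(\<Union>g\<in>carrier G. V \<inter> comp g) \<subseteq> {x. hp g x \<in> V}"
      using that(2) hp_comp sub by (auto simp: subspace_0)
    then have "span (\<Union>g\<in>carrier G. V \<inter> comp g) \<subseteq> {x. hp g x \<in> V}"
      using subspace_preimage[OF endo_hp[OF that(2)] sub] by (rule span_minimal)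
    then show ?thesis using that sp by blast
  qed
  with sub show "subspace V \<and> (\<forall>x\<in>V. \<forall>g\<in>carrier G. hp g x \<in> V)" by blast
next
  assume V: "subspace V \<and> (\<forall>x\<in>V. \<forall>g\<in>carrier G. hp g x \<in> V)"
  let ?U = "\<Union>g\<in>carrier G. V \<inter> comp g"
  have "V = span ?U"
  proof
    show "V \<subseteq> span ?U"
    proof
      fix x assume x: "x \<in> V"
      have "hp g x \<in> span ?U" if "g \<in> carrier G" for g
        using V x that hp_in_comp by (intro span_base) blast
      then have "(\<Sum>g\<in>carrier G. hp g x) \<in> span ?U" by (intro span_sum)
      then show "x \<in> span ?U" by (simp add: sum_hp)
    qed
    show "span ?U \<subseteq> V" using V by (intro span_minimal) auto
  qed
  moreover have "\<forall>g\<in>carrier G. subspace (V \<inter> comp g)" using V subspace_comp by (simp add: subspace_inter)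
  ultimately show "graded V"
    using decomposition unfolding graded_def internal_direct_sum_def by blast
qed

text \<open>In a noncommutative group the degree of the other factor is
  \<open>inv g \<otimes> k\<close> or \<open>k \<otimes> inv h\<close>, according to the side on
  which the homogeneous element stands. Both cases enter the proof that the degree-preserving part
  of a derivation is a derivation.\<close>

lemma hp_bracket_left:
  assumes "g \<in> carrier G" "k \<in> carrier G" "x \<in> comp g"
  shows "hp k (bracket x y) = bracket x (hp (inv g \<otimes> k) y)"
proof -
  have "hp k (bracket x (hp h y)) = (if h = inv g \<otimes> k then bracket x (hp h y) else 0)"
    if h: "h \<in> carrier G" for h
  proof -
    have "bracket x (hp h y) \<in> comp (g \<otimes> h)" using assms h by (intro bracket_comp hp_in_comp)
    moreover have "k = g \<otimes> h \<longleftrightarrow> h = inv g \<otimes> k" using assms h inv_solve_left by auto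
    ultimately show ?thesis using hp_comp[of k "g \<otimes> h"] assms h by simp
  qed
  then have "(\<Sum>h\<in>carrier G. hp k (bracket x (hp h y)))
      = (\<Sum>h\<in>carrier G. if h = inv g \<otimes> k then bracket x (hp h y) else 0)" by (intro sum.cong) auto
  also have "\<dots> = bracket x (hp (inv g \<otimes> k) y)" using assms finite_carrier by simp
  finally show ?thesis
    using sum_hp[of y] assms by (simp add: endo_sum[OF endo_hp, symmetric] bracket_sum[symmetric])
qed

lemma hp_bracket_right:
  assumes "h \<in> carrier G" "k \<in> carrier G" "y \<in> comp h"
  shows "hp k (bracket x y) = bracket (hp (k \<otimes> inv h) x) y"
proof -
  have "hp k (bracket (hp g x) y) = (if g = k \<otimes> inv h then bracket (hp g x) y else 0)"
    if g: "g \<in> carrier G" for g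
  proof -
    have "bracket (hp g x) y \<in> comp (g \<otimes> h)" using assms g by (intro bracket_comp hp_in_comp)
    moreover have "k = g \<otimes> h \<longleftrightarrow> g = k \<otimes> inv h" using assms g by (auto simp: m_assoc)
    ultimately show ?thesis using hp_comp[of k "g \<otimes> h"] assms g by simp
  qed
  then have "(\<Sum>g\<in>carrier G. hp k (bracket (hp g x) y))
      = (\<Sum>g\<in>carrier G. if g = k \<otimes> inv h then bracket (hp g x) y else 0)" by (intro sum.cong) auto
  also have "\<dots> = bracket (hp (k \<otimes> inv h) x) y" using assms finite_carrier by simp
  finally show ?thesis
    using sum_hp[of x] assms by (simp add: endo_sum[OF endo_hp, symmetric] bracket_sum[symmetric])
qed

section \<open>Degree-preserving operators\<close>

text \<open>The diagonal blocks of \<open>T\<close>. For abelian \<open>G\<close> this is the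
  average of the conjugates of \<open>T\<close> under the characters; the blocks make sense for
  every \<open>G\<close>.\<close>

definition degree_part :: "('a \<Rightarrow> 'a) \<Rightarrow> 'a \<Rightarrow> 'a" where
  "degree_part T x = (\<Sum>g\<in>carrier G. hp g (T (hp g x)))"

lemma endo_degree_part: "endo T \<Longrightarrow> endo (degree_part T)"
  unfolding degree_part_def[abs_def] by (rule endo_setsum, rule endo_comp[OF endo_hp endo_comp[OF _ endo_hp]])

lemma degree_part_in: "graded U \<Longrightarrow> (\<And>g. g \<in> carrier G \<Longrightarrow> T (hp g x) \<in> U) \<Longrightarrow> degree_part T x \<in> U"
  unfolding degree_part_def by (rule subspace_sum) (auto simp: graded_iff)

lemma hp_degree_part:
  assumes "endo T" "g \<in> carrier G"
  shows "hp g (degree_part T x) = hp g (T (hp g x))" "degree_part T (hp g x) = hp g (T (hp g x))"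
proof -
  show "hp g (degree_part T x) = hp g (T (hp g x))"
    using assms finite_carrier
    by (simp add: degree_part_def endo_simps[OF endo_hp] hp_hp)
  have "hp h (T (hp h (hp g x))) = (if h = g then hp g (T (hp g x)) else 0)" if "h \<in> carrier G" for h
    using assms that by (simp add: hp_hp endo_0[OF assms(1)] endo_0[OF endo_hp])
  then show "degree_part T (hp g x) = hp g (T (hp g x))"
    using assms finite_carrier by (simp add: degree_part_def)
qed

text \<open>By cyclicity a diagonal block has the trace of \<open>T\<close> composed with
  \<open>hp g\<close>, and the maps \<open>hp g\<close> add up to the identity.\<close>

lemma tr_degree_part:
  assumes "endo T" shows "tr (degree_part T) = tr T"
proof -
  have "tr (\<lambda>x. hp g (T (hp g x))) = tr (\<lambda>x. T (hp g x))" if g: "g \<in> carrier G" for g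
  proof -
    have "tr (\<lambda>x. hp g (T (hp g x))) = tr (\<lambda>x. T (hp g (hp g x)))"
      using tr_comm[OF endo_hp[OF g] endo_comp[OF assms endo_hp[OF g]]] .
    then show ?thesis using g by (simp add: hp_hp)
  qed
  then have "tr (degree_part T) = (\<Sum>g\<in>carrier G. tr (\<lambda>x. T (hp g x)))"
    unfolding degree_part_def[abs_def] tr_sum by (intro sum.cong) auto
  also have "\<dots> = tr (\<lambda>x. \<Sum>g\<in>carrier G. T (hp g x))" by (rule tr_sum[symmetric])
  also have "\<dots> = tr T" by (simp add: endo_sum[OF assms, symmetric] sum_hp)
  finally show ?thesis .
qed

text \<open>All diagonal blocks vanish because \<open>k \<otimes> g \<noteq> g\<close>.\<close>

lemma tr_shifting_degree:
  assumes T: "endo T" and "k \<in> carrier G" "k \<noteq> \<one>"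
    and "\<And>h x. h \<in> carrier G \<Longrightarrow> x \<in> comp h \<Longrightarrow> T x \<in> comp (k \<otimes> h)"
  shows "tr T = 0"
proof -
  have "hp g (T (hp g x)) = 0" if g: "g \<in> carrier G" for g x
  proof -
    have "T (hp g x) \<in> comp (k \<otimes> g)" using assms(4) g hp_in_comp by blast
    moreover have "g \<noteq> k \<otimes> g" using assms g r_cancel_one' by metis
    ultimately show ?thesis using hp_comp[of g "k \<otimes> g"] g assms by auto
  qed
  then have "degree_part T = (\<lambda>x. 0)" by (auto simp: degree_part_def)
  then show ?thesis using tr_degree_part[OF T] tr_zero by simp
qed

text \<open>The diagonal blocks of any projection onto \<open>U\<close> again make up a projection
  onto \<open>U\<close>, as \<open>U\<close> contains the components of its elements.\<close>

lemma graded_projection_exists: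
  assumes U: "graded U"
  obtains p where "endo p" "\<And>x. p x \<in> U" "\<And>x. x \<in> U \<Longrightarrow> p x = x"
    "\<And>g x. g \<in> carrier G \<Longrightarrow> hp g (p x) = p (hp g x)"
proof -
  have U': "subspace U" "\<And>x g. x \<in> U \<Longrightarrow> g \<in> carrier G \<Longrightarrow> hp g x \<in> U" using U by (auto simp: graded_iff)
  obtain p where p: "endo p" "\<And>x. p x \<in> U" "\<And>x. x \<in> U \<Longrightarrow> p x = x"
    using projection_exists[OF U'(1)] by blast
  show thesis
  proof (rule that[of "degree_part p"])
    show "endo (degree_part p)" by (rule endo_degree_part[OF p(1)])
    show "degree_part p x \<in> U" for x using p U by (intro degree_part_in)
    show "degree_part p x = x" if "x \<in> U" for x
    proof -
      have "hp g (p (hp g x)) = hp g x" if "g \<in> carrier G" for g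
        using p(3)[OF U'(2)[OF \<open>x \<in> U\<close> that]] that by (simp add: hp_hp)
      then show ?thesis by (simp add: degree_part_def sum_hp)
    qed
    show "hp g (degree_part p x) = degree_part p (hp g x)" if "g \<in> carrier G" for g x
      using hp_degree_part[OF p(1) that] by simp
  qed
qed

lemma graded_subquotient_proj_exists:
  assumes "graded U" "graded W" "W \<subseteq> U"
  obtains q where "subquotient_proj q U W" "\<And>g x. g \<in> carrier G \<Longrightarrow> hp g (q x) = q (hp g x)"
proof -
  obtain p where p: "endo p" "\<And>x. p x \<in> U" "\<And>x. x \<in> U \<Longrightarrow> p x = x"
    "\<And>g x. g \<in> carrier G \<Longrightarrow> hp g (p x) = p (hp g x)" using graded_projection_exists[OF assms(1)] by blast
  obtain r where r: "endo r" "\<And>x. r x \<in> W" "\<And>x. x \<in> W \<Longrightarrow> r x = x"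
    "\<And>g x. g \<in> carrier G \<Longrightarrow> hp g (r x) = r (hp g x)" using graded_projection_exists[OF assms(2)] by blast
  have sub: "subspace U" using assms by (simp add: graded_iff)
  show thesis
  proof (rule that[of "\<lambda>x. p x - r (p x)"])
    show "subquotient_proj (\<lambda>x. p x - r (p x)) U W"
      unfolding subquotient_proj_def
    proof (intro conjI allI ballI)
      show "endo (\<lambda>x. p x - r (p x))" by (rule endo_minus[OF p(1) endo_comp[OF r(1) p(1)]])
      show "p x - r (p x) \<in> U" for x using p r assms sub by (intro subspace_diff) auto
      show "p x - r (p x) = 0" if "x \<in> W" for x using that p r assms by auto
      show "x - (p x - r (p x)) \<in> W" if "x \<in> U" for x using that p r by simp
      have "r x \<in> U" for x using r(2) assms(3) by blast
      then show "p (p x - r (p x)) - r (p (p x - r (p x))) = p x - r (p x)" for x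
        using p(2,3) r(2,3) by (simp add: endo_diff[OF p(1)] endo_diff[OF r(1)])
    qed
    show "hp g (p x - r (p x)) = p (hp g x) - r (p (hp g x))" if "g \<in> carrier G" for g x
      using p r that by (simp add: endo_diff[OF endo_hp])
  qed
qed

text \<open>Components of degrees \<open>g\<close> and \<open>h\<close> are orthogonal unless
  \<open>h = inv g\<close>. Written as an adjunction, this shows at once that the orthogonal space
  of a graded subspace is graded.\<close>

definition graded_form :: "('a \<Rightarrow> 'a \<Rightarrow> 'k) \<Rightarrow> bool" where
  "graded_form \<beta> \<longleftrightarrow> (\<forall>g\<in>carrier G. \<forall>x y. \<beta> (hp g x) y = \<beta> x (hp (inv g) y))"

text \<open>For arguments of degrees \<open>g\<close> and \<open>h\<close> the operator under the
  trace multiplies every degree by \<open>g \<otimes> h\<close> on the left, so it is traceless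
  unless this product is \<open>\<one>\<close>.\<close>

lemma graded_form_trace_form:
  assumes rep: "lie_rep K (ad_sub q)" and q: "endo q"
    and qg: "\<And>g x. g \<in> carrier G \<Longrightarrow> hp g (q x) = q (hp g x)"
  shows "graded_form (trace_form (ad_sub q))"
proof -
  let ?\<beta> = "trace_form (ad_sub q)"
  note R = lie_repD[OF rep] and B = sym_form_simps[OF sym_form_trace_form[OF rep]]
  have qc: "q x \<in> comp g" if "x \<in> comp g" "g \<in> carrier G" for x g
    using that qg[of g x] by (simp add: in_comp_iff)
  have ad: "ad_sub q x v \<in> comp (g \<otimes> h)"
    if "x \<in> comp g" "v \<in> comp h" "g \<in> carrier G" "h \<in> carrier G" for x v g h
    unfolding ad_sub_def using that by (intro qc bracket_comp) auto
  have zero: "?\<beta> (hp g x) (hp h y) = 0" if gh: "g \<in> carrier G" "h \<in> carrier G" "h \<noteq> inv g" for g h x y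
    unfolding trace_form_def
  proof (rule tr_shifting_degree)
    show "endo (\<lambda>v. ad_sub q (hp g x) (ad_sub q (hp h y) v))" by (rule endo_comp[OF R(1) R(1)])
    show "g \<otimes> h \<in> carrier G" using gh by simp
    show "g \<otimes> h \<noteq> \<one>" using gh inv_equality l_inv r_inv by (metis inv_inv inv_closed inv_unique')
    show "ad_sub q (hp g x) (ad_sub q (hp h y) v) \<in> comp (g \<otimes> h \<otimes> k)"
      if "k \<in> carrier G" "v \<in> comp k" for k v
      using gh that by (simp add: m_assoc) (intro ad hp_in_comp, auto)
  qed
  have "?\<beta> (hp g x) y = ?\<beta> x (hp (inv g) y)" if g: "g \<in> carrier G" for g x y
  proof -
    have "?\<beta> (hp g x) y = (\<Sum>h\<in>carrier G. ?\<beta> (hp g x) (hp h y))"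
      by (subst sum_hp[of y, symmetric]) (simp add: B)
    also have "\<dots> = (\<Sum>h\<in>carrier G. if h = inv g then ?\<beta> (hp g x) (hp h y) else 0)"
      using zero g by (intro sum.cong) auto
    also have "\<dots> = ?\<beta> (hp g x) (hp (inv g) y)" using g finite_carrier by simp
    also have "\<dots> = (\<Sum>h\<in>carrier G. if h = g then ?\<beta> (hp h x) (hp (inv g) y) else 0)"
      using g finite_carrier by simp
    also have "\<dots> = (\<Sum>h\<in>carrier G. ?\<beta> (hp h x) (hp (inv g) y))"
    proof (intro sum.cong refl)
      fix h assume h: "h \<in> carrier G"
      have "inv g \<noteq> inv h" if "h \<noteq> g" using that g h by (metis inv_inv)
      then show "(if h = g then ?\<beta> (hp h x) (hp (inv g) y) else 0) = ?\<beta> (hp h x) (hp (inv g) y)"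
        using zero[OF h, of "inv g"] g by auto
    qed
    also have "\<dots> = ?\<beta> (\<Sum>h\<in>carrier G. hp h x) (hp (inv g) y)" by (simp only: B)
    finally show ?thesis by (simp add: sum_hp)
  qed
  then show ?thesis by (simp add: graded_form_def)
qed

lemma graded_perp:
  assumes "sym_form \<beta>" "graded_form \<beta>" "graded Y" shows "graded (perp \<beta> Y)"
  using assms subspace_perp[OF assms(1)] by (auto simp: graded_iff graded_form_def perp_def)

lemma graded_Int: "graded U \<Longrightarrow> graded V \<Longrightarrow> graded (U \<inter> V)"
  by (auto simp: graded_iff subspace_inter)

lemma graded_sum: "graded U \<Longrightarrow> graded V \<Longrightarrow> graded {u + v |u v. u \<in> U \<and> v \<in> V}"
  unfolding graded_iff by (auto intro: subspace_sums simp: endo_add[OF endo_hp]) blast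

lemma graded_UNIV: "graded UNIV"
  by (simp add: graded_iff)

lemma graded_zero: "graded {0}"
  by (simp add: graded_iff endo_0[OF endo_hp])

lemma graded_bracket_space:
  assumes U: "graded U" and V: "graded V" shows "graded (bracket_space U V)"
proof -
  let ?S = "bracket_space U V"
  have "?S \<subseteq> {x. hp k x \<in> ?S}" if k: "k \<in> carrier G" for k
  proof (rule bracket_space_subset)
    show "subspace {x. hp k x \<in> ?S}"
      by (rule subspace_preimage[OF endo_hp[OF k] subspace_bracket_space])
    fix x y assume xy: "x \<in> U" "y \<in> V"
    have "hp k (bracket x y) = (\<Sum>g\<in>carrier G. hp k (bracket (hp g x) y))"
      using k by (subst sum_hp[of x, symmetric]) (simp add: bracket_simps endo_simps[OF endo_hp])
    also have "\<dots> = (\<Sum>g\<in>carrier G. bracket (hp g x) (hp (inv g \<otimes> k) y))"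
      using k by (intro sum.cong refl hp_bracket_left hp_in_comp)
    also have "\<dots> \<in> ?S"
      using U V xy k by (intro subspace_sum[OF subspace_bracket_space] bracket_spaceI) (auto simp: graded_iff)
    finally show "bracket x y \<in> {x. hp k x \<in> ?S}" by simp
  qed
  then show ?thesis unfolding graded_iff using subspace_bracket_space by blast
qed

end

context fd_lie_algebra
begin

lemma lie_rep_subset: "lie_rep K \<rho> \<Longrightarrow> J \<subseteq> K \<Longrightarrow> lie_rep J \<rho>"
  unfolding lie_rep_def by blast

text \<open>Cartan's criterion for \<open>J\<close> acting on \<open>U / W\<close>, with the
  compressing projection removed from the conclusion.\<close>

lemma perfect_trace_form_zero:
  assumes q: "subquotient_proj q U W" "subspace W"
    and U: "\<And>x u. x \<in> K \<Longrightarrow> u \<in> U \<Longrightarrow> bracket x u \<in> U"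
    and W: "\<And>x u. x \<in> K \<Longrightarrow> u \<in> W \<Longrightarrow> bracket x u \<in> W"
    and J: "perfect J" "J \<subseteq> K" and zero: "\<And>x y. x \<in> J \<Longrightarrow> y \<in> J \<Longrightarrow> trace_form (ad_sub q) x y = 0"
    and xu: "x \<in> J" "u \<in> U"
  shows "bracket x u \<in> W"
proof -
  have "lie_rep J (ad_sub q)" using lie_rep_subset[OF lie_rep_ad_sub[OF q(1) U W] J(2)] .
  then have "\<forall>v. ad_sub q x v = 0" using cartan_criterion[OF J(1) _ zero xu(1)] by blast
  then show ?thesis using ad_sub_trivial_iff[OF q, of x] U W J(2) xu by blast
qed

end

context fd_graded_lie_algebra
begin

section \<open>The radical\<close>

lemma radical_exists:
  obtains R q where "solvable_radical UNIV R" "graded R" "subquotient_proj q UNIV R"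
    "\<And>g x. g \<in> carrier G \<Longrightarrow> hp g (q x) = q (hp g x)" "perp (trace_form (ad_sub q)) UNIV = R"
proof -
  define P where "P I \<longleftrightarrow> lie_ideal UNIV I \<and> solvable I \<and> graded I" for I
  have "P {0}" by (auto simp: P_def lie_ideal_def solvable_zero graded_zero bracket_0)
  moreover have "\<forall>I. P I \<longrightarrow> dim I < Suc (card Basis)"
    using dim_subset_UNIV by (simp add: dimension_def less_Suc_eq_le)
  ultimately obtain R where R: "P R" "\<And>I. P I \<Longrightarrow> dim I \<le> dim R"
    using ex_has_greatest_nat[of P "{0}" dim "Suc (card Basis)"] by blast
  have idR: "lie_ideal UNIV R" and solR: "solvable R" and grR: "graded R" using R by (auto simp: P_def)
  have subR: "subspace R" and brR: "\<And>x u. u \<in> R \<Longrightarrow> bracket x u \<in> R"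
    using idR by (auto simp: lie_ideal_def)
  have max: "I \<subseteq> R" if I: "P I" for I
  proof -
    let ?S = "{x + y |x y. x \<in> I \<and> y \<in> R}"
    have id: "lie_ideal UNIV ?S" using I idR by (intro lie_ideal_sum) (auto simp: P_def)
    have "solvable ?S"
      using I idR solR lie_ideal_subalgebra[OF id] lie_ideal_subalgebra[of UNIV I]
      by (intro solvable_sum[of I R ?S]) (auto simp: P_def)
    then have "P ?S" using id I grR by (auto simp: P_def graded_sum)
    then have "dim ?S \<le> dim R" by (rule R)
    moreover have "R \<subseteq> ?S"
    proof
      fix r assume "r \<in> R"
      moreover have "0 \<in> I" using I by (simp add: P_def lie_ideal_def subspace_0)
      moreover have "r = 0 + r" by simp
      ultimately show "r \<in> ?S" by blast
    qed
    ultimately have "R = ?S" using id subR by (intro subspace_dim_equal) (auto simp: lie_ideal_def)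
    moreover have "I \<subseteq> ?S"
    proof
      fix x assume "x \<in> I"
      moreover have "x = x + 0" by simp
      ultimately show "x \<in> ?S" using subspace_0[OF subR] by blast
    qed
    ultimately show "I \<subseteq> R" by blast
  qed
  obtain q where q: "subquotient_proj q UNIV R" and qg: "\<And>g x. g \<in> carrier G \<Longrightarrow> hp g (q x) = q (hp g x)"
    using graded_subquotient_proj_exists[OF graded_UNIV grR] by blast
  have q': "endo q" "\<And>w. w \<in> R \<Longrightarrow> q w = 0" "\<And>x. x - q x \<in> R"
    using q by (auto simp: subquotient_proj_def)
  let ?\<rho> = "ad_sub q" and ?\<beta> = "trace_form (ad_sub q)"
  have rep: "lie_rep UNIV ?\<rho>" using brR by (intro lie_rep_ad_sub[OF q]) auto
  note \<beta> = sym_form_trace_form[OF rep] and R' = lie_repD[OF rep]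
  note inv = trace_form_invariant[OF rep UNIV_I UNIV_I UNIV_I]
  define I where "I = perp ?\<beta> UNIV"
  have RI: "R \<subseteq> I"
  proof
    fix r assume r: "r \<in> R"
    have "?\<rho> r v = 0" for v
      unfolding ad_sub_def using lie_ideal_bracket2[OF idR r] q'(2) by blast
    then show "r \<in> I" by (simp add: I_def perp_def trace_form_def tr_zero)
  qed
  have idI: "lie_ideal UNIV I"
    unfolding lie_ideal_def
  proof (intro conjI ballI)
    show "subspace I" unfolding I_def by (rule subspace_perp[OF \<beta>])
    fix x y assume y: "y \<in> I"
    have "?\<beta> (bracket y x) z = 0" for z using y inv[of y x z] by (simp add: I_def perp_def)
    then have "bracket y x \<in> I" by (simp add: I_def perp_def)
    then show "bracket x y \<in> I" using bracket_in_sym \<open>subspace I\<close> by blast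
  qed simp
  \<comment> \<open>A perfect subalgebra \<open>J\<close> of \<open>I\<close> acts trivially on the
    quotient by \<open>R\<close>, so \<open>J = [J, J]\<close> lies in \<open>R\<close>.\<close>
  have "solvable I"
  proof (rule ccontr)
    assume "\<not> solvable I"
    then obtain J where J: "J \<subseteq> I" "perfect J" "J \<noteq> {0}"
      by (rule not_solvable_perfect[OF lie_ideal_subalgebra[OF idI]])
    have "bracket x u \<in> R" if x: "x \<in> J" for x u
      by (rule perfect_trace_form_zero[OF q subR, of UNIV J])
        (use J x brR in \<open>auto simp: I_def perp_def\<close>)
    then have "bracket_space J J \<subseteq> R" by (intro bracket_space_subset[OF subR])
    then have "J \<subseteq> R" using J by (simp add: perfect_def)
    then show False using perfect_subset_solvable J solR by blast
  qed
  moreover have "graded I"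
    unfolding I_def using graded_perp[OF \<beta> graded_form_trace_form[OF rep q'(1) qg] graded_UNIV] .
  ultimately have IR: "I = R" using max RI idI by (auto simp: P_def)
  \<comment> \<open>\<open>A\<close> need not be graded, so the maximality of \<open>R\<close> says
    nothing about it. The last derived ideal of \<open>A\<close> outside \<open>R\<close> is abelian
    modulo \<open>R\<close>, and such an ideal is orthogonal to everything.\<close>
  have "A \<subseteq> R" if A: "lie_ideal UNIV A" "solvable A" for A
  proof (rule ccontr)
    assume nR: "\<not> A \<subseteq> R"
    obtain n where "derived n A = {0}" using A(2) by (auto simp: solvable_def)
    then have "derived n A \<subseteq> R" using subspace_0[OF subR] by simp
    moreover have "\<not> derived 0 A \<subseteq> R" using nR by simp
    ultimately have "\<exists>k<n. (\<forall>i\<le>k. \<not> derived i A \<subseteq> R) \<and> derived (Suc k) A \<subseteq> R"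
      by (rule ex_least_nat_less)
    then obtain k where k: "\<not> derived k A \<subseteq> R" "derived (Suc k) A \<subseteq> R" by blast
    define A' where "A' = derived k A"
    have idA': "lie_ideal UNIV A'" unfolding A'_def by (rule lie_ideal_derived[OF A(1)])
    define M where "M = {x + y |x y. x \<in> A' \<and> y \<in> R}"
    have idM: "lie_ideal UNIV M" unfolding M_def by (rule lie_ideal_sum[OF idA' idR]) simp
    have subM: "subspace M" and brM: "\<And>x u. u \<in> M \<Longrightarrow> bracket x u \<in> M" using idM by (auto simp: lie_ideal_def)
    have A'M: "A' \<subseteq> M"
    proof
      fix x assume "x \<in> A'"
      moreover have "x = x + 0" by simp
      ultimately show "x \<in> M" unfolding M_def using subspace_0[OF subR] by blast
    qed
    have RM: "R \<subseteq> M"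
    proof
      fix x assume "x \<in> R"
      moreover have "x = 0 + x" by simp
      moreover have "0 \<in> A'" using idA' by (simp add: lie_ideal_def subspace_0)
      ultimately show "x \<in> M" unfolding M_def by blast
    qed
    have qM: "q z \<in> M" if "z \<in> M" for z
      using subspace_diff[OF subM that, of "z - q z"] q'(3) RM by auto
    have aM: "bracket a z \<in> R" if a: "a \<in> A'" and z: "z \<in> M" for a z
    proof -
      obtain x y where xy: "z = x + y" "x \<in> A'" "y \<in> R" using z by (auto simp: M_def)
      have "bracket a x \<in> derived (Suc k) A" using a xy by (simp add: A'_def bracket_spaceI)
      then show ?thesis using k(2) xy brR subR by (auto simp: bracket_simps intro: subspace_add)
    qed
    have "a \<in> I" if a: "a \<in> A'" for a
    proof -
      have "?\<beta> a y = 0" for y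
        unfolding trace_form_def
      \<comment> \<open>\<open>?\<rho> a\<close> maps into \<open>M\<close>,
        \<open>?\<rho> y\<close> preserves \<open>M\<close>, and \<open>?\<rho> a\<close> kills
        \<open>M\<close>; hence the product squares to zero.\<close>
      proof (rule tr_nilpotent[where n = 2])
        show "endo (\<lambda>v. ?\<rho> a (?\<rho> y v))" by (rule endo_comp[OF R'(1) R'(1)])
        have "?\<rho> a v \<in> M" for v
          unfolding ad_sub_def using lie_ideal_bracket2[OF idA' a] A'M by (intro qM) blast
        moreover have "?\<rho> y z \<in> M" if "z \<in> M" for z
          unfolding ad_sub_def using that by (intro qM brM)
        moreover have "?\<rho> a z = 0" if "z \<in> M" for z
          unfolding ad_sub_def using that by (intro q'(2) aM[OF a] qM)
        ultimately show "((\<lambda>v. ?\<rho> a (?\<rho> y v)) ^^ 2) x = 0" for x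
          by (simp add: numeral_2_eq_2)
      qed
      then show ?thesis by (simp add: I_def perp_def)
    qed
    then show False using k(1) IR by (auto simp: A'_def)
  qed
  then have "solvable_radical UNIV R" using idR solR by (simp add: solvable_radical_def)
  then show thesis using that[OF _ grR q qg] IR I_def by blast
qed

end

section \<open>The Killing form modulo the radical\<close>

locale levi_data = fd_graded_lie_algebra scale bracket G comp Basis
  for scale :: "'k::{alg_closed_field, field_char_0} \<Rightarrow> 'a::ab_group_add \<Rightarrow> 'a"
    and bracket :: "'a \<Rightarrow> 'a \<Rightarrow> 'a" and G :: "('g, 'm) monoid_scheme" (structure)
    and comp :: "'g \<Rightarrow> 'a set" and Basis +
  fixes R :: "'a set" and q :: "'a \<Rightarrow> 'a"
  assumes radical: "solvable_radical UNIV R" and graded_R: "graded R"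
    and q: "subquotient_proj q UNIV R"
    and q_graded: "\<And>g x. g \<in> carrier G \<Longrightarrow> hp g (q x) = q (hp g x)"
    and perp_UNIV: "perp (trace_form (ad_sub q)) UNIV = R"
begin

text \<open>The Killing form of \<open>L / R\<close>, pulled back to \<open>L\<close>; its radical
  is exactly \<open>R\<close>.\<close>

definition \<kappa> :: "'a \<Rightarrow> 'a \<Rightarrow> 'k" where "\<kappa> = trace_form (ad_sub q)"

lemma ideal_R: "lie_ideal UNIV R" and solvable_R: "solvable R" 
  and R_greatest: "lie_ideal UNIV I \<Longrightarrow> solvable I \<Longrightarrow> I \<subseteq> R"
  using radical by (auto simp: solvable_radical_def)

lemma subspace_R: "subspace R" and bracket_R: "x \<in> R \<Longrightarrow> bracket y x \<in> R" "x \<in> R \<Longrightarrow> bracket x y \<in> R"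
  using ideal_R lie_ideal_bracket2[OF ideal_R] by (auto simp: lie_ideal_def)

lemma endo_q: "endo q" and q_R: "x \<in> R \<Longrightarrow> q x = 0" and q_diff: "x - q x \<in> R"
  using q by (auto simp: subquotient_proj_def)

lemma rep_q: "lie_rep UNIV (ad_sub q)"
  using bracket_R by (intro lie_rep_ad_sub[OF q]) auto

lemma sym_\<kappa>: "sym_form \<kappa>"
  unfolding \<kappa>_def by (rule sym_form_trace_form[OF rep_q])

lemma \<kappa>_invariant: "\<kappa> (bracket x y) z = \<kappa> x (bracket y z)"
  unfolding \<kappa>_def by (rule trace_form_invariant[OF rep_q UNIV_I UNIV_I UNIV_I])

lemma graded_\<kappa>: "graded_form \<kappa>"
  unfolding \<kappa>_def by (rule graded_form_trace_form[OF rep_q endo_q q_graded])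

lemma \<kappa>_radical: "x \<in> R \<longleftrightarrow> (\<forall>y. \<kappa> x y = 0)"
  using perp_UNIV by (auto simp: \<kappa>_def perp_def)

lemma \<kappa>_R: "x \<in> R \<Longrightarrow> \<kappa> x y = 0" "x \<in> R \<Longrightarrow> \<kappa> y x = 0"
  using \<kappa>_radical sym_form_sym[OF sym_\<kappa>] by metis+

end

section \<open>Invariance of Casimir elements\<close>

context fd_lie_algebra
begin

text \<open>The sum of the tensors of \<open>c\<close> and \<open>b c\<close> is invariant under
  \<open>y\<close>. The tensor is tested by a bilinear map \<open>\<Phi>\<close>, so that the same
  argument covers the Casimir operators and the homotopy. The dual bases expand
  \<open>[y, c]\<close> and \<open>[y, b c]\<close> only modulo the radical of
  \<open>\<beta>\<close>; \<open>\<Phi>\<close> sends these errors to \<open>W\<close>.\<close>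

lemma casimir_invariance:
  assumes \<beta>: "sym_form \<beta>" and D: "D \<subseteq> K" "\<And>y d. y \<in> K \<Longrightarrow> d \<in> D \<Longrightarrow> bracket y d \<in> D"
    and inv: "\<And>x y z. x \<in> K \<Longrightarrow> y \<in> K \<Longrightarrow> z \<in> K \<Longrightarrow> \<beta> (bracket x y) z = \<beta> x (bracket y z)"
    and dual: "dual_pair \<beta> D C b"
    and \<Phi>: "\<And>v. endo (\<lambda>u. \<Phi> u v)" "\<And>u. endo (\<Phi> u)" and W: "subspace W"
      "\<And>n d. n \<in> D \<inter> perp \<beta> D \<Longrightarrow> d \<in> D \<Longrightarrow> \<Phi> n d \<in> W"
      "\<And>n d. n \<in> D \<inter> perp \<beta> D \<Longrightarrow> d \<in> D \<Longrightarrow> \<Phi> d n \<in> W" and y: "y \<in> K"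
  shows "(\<Sum>c\<in>C. \<Phi> (bracket y c) (b c) + \<Phi> c (bracket y (b c))) \<in> W"
proof -
  note C = dual_pairD(2,3,5,6)[OF dual]
  define n where "n c = bracket y c - (\<Sum>d\<in>C. scale (\<beta> (bracket y c) (b d)) d)" for c
  define m where "m c = bracket y (b c) - (\<Sum>d\<in>C. scale (\<beta> d (bracket y (b c))) (b d))" for c
  have nm: "n c \<in> D \<inter> perp \<beta> D" "m c \<in> D \<inter> perp \<beta> D" if c: "c \<in> C" for c
  proof -
    show "n c \<in> D \<inter> perp \<beta> D" unfolding n_def by (rule C(3)[OF D(2)[OF y subsetD[OF C(1) c]]])
    show "m c \<in> D \<inter> perp \<beta> D" unfolding m_def by (rule C(4)[OF D(2)[OF y C(2)[OF c]]])
  qed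
  have s: "\<beta> (bracket y c) (b d) = - \<beta> c (bracket y (b d))" if "c \<in> C" "d \<in> C" for c d
  proof -
    have "c \<in> K" "b d \<in> K" using that C D by auto
    then have "\<beta> (bracket c y) (b d) = \<beta> c (bracket y (b d))" using inv y by blast
    then show ?thesis
      using sym_form_left(2)[OF \<beta>, of "-1" "bracket c y" "b d"] bracket_anticomm[of y c] by simp
  qed
  have 1: "\<Phi> (bracket y c) (b c)
      = (\<Sum>d\<in>C. scale (\<beta> (bracket y c) (b d)) (\<Phi> d (b c))) + \<Phi> (n c) (b c)" for c
  proof -
    have "bracket y c = (\<Sum>d\<in>C. scale (\<beta> (bracket y c) (b d)) d) + n c" by (simp add: n_def)
    then have "\<Phi> (bracket y c) (b c)
      = \<Phi> ((\<Sum>d\<in>C. scale (\<beta> (bracket y c) (b d)) d) + n c) (b c)" by (rule arg_cong)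
    then show ?thesis by (simp only: endo_simps[OF \<Phi>(1)])
  qed
  have 2: "\<Phi> c (bracket y (b c))
      = (\<Sum>d\<in>C. scale (\<beta> d (bracket y (b c))) (\<Phi> c (b d))) + \<Phi> c (m c)" for c
  proof -
    have "bracket y (b c) = (\<Sum>d\<in>C. scale (\<beta> d (bracket y (b c))) (b d)) + m c" by (simp add: m_def)
    then have "\<Phi> c (bracket y (b c))
      = \<Phi> c ((\<Sum>d\<in>C. scale (\<beta> d (bracket y (b c))) (b d)) + m c)" by (rule arg_cong)
    then show ?thesis by (simp only: endo_simps[OF \<Phi>(2)])
  qed
  \<comment> \<open>By \<open>s\<close> the two coefficient matrices are negative transposes of each
    other, so the double sums cancel once the summation is exchanged.\<close>
  have 3: "(\<Sum>c\<in>C. \<Sum>d\<in>C. scale (\<beta> (bracket y c) (b d)) (\<Phi> d (b c)))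
      = - (\<Sum>c\<in>C. \<Sum>d\<in>C. scale (\<beta> d (bracket y (b c))) (\<Phi> c (b d)))"
    by (subst (2) sum.swap) (simp add: s sum_negf[symmetric] cong: sum.cong)
  have "(\<Sum>c\<in>C. \<Phi> (bracket y c) (b c) + \<Phi> c (bracket y (b c)))
      = (\<Sum>c\<in>C. \<Phi> (n c) (b c)) + (\<Sum>c\<in>C. \<Phi> c (m c))"
    unfolding 1 2 sum.distrib 3 by simp
  also have "\<dots> \<in> W"
    using nm C(1,2) W by (intro subspace_add subspace_sum) auto
  finally show ?thesis .
qed

end

context levi_data
begin

section \<open>Levi complements\<close>

text \<open>\<open>\<kappa>\<close> does not see \<open>R\<close>, so orthogonality to a supplement
  of \<open>R\<close> is orthogonality to everything.\<close>

lemma perp_supplement: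
  assumes "\<And>x. \<exists>k\<in>K. x - k \<in> R" shows "perp \<kappa> K = R"
proof
  show "R \<subseteq> perp \<kappa> K" using \<kappa>_R by (auto simp: perp_def)
  show "perp \<kappa> K \<subseteq> R"
  proof
    fix x assume x: "x \<in> perp \<kappa> K"
    have "\<kappa> x y = 0" for y
    proof -
      obtain k where k: "k \<in> K" "y - k \<in> R" using assms by blast
      have "\<kappa> x (y - k) = 0" using \<kappa>_R(2)[OF k(2)] .
      moreover have "\<kappa> x k = 0" using x k by (simp add: perp_def)
      ultimately show ?thesis by (simp add: sym_form_simps[OF sym_\<kappa>])
    qed
    then show "x \<in> R" by (simp add: \<kappa>_radical)
  qed
qed

text \<open>\<open>I + R\<close> is an ideal of the whole algebra, since \<open>K\<close> represents
  every element modulo \<open>R\<close> and \<open>R\<close> absorbs the difference; being solvable,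
  it lies in \<open>R\<close>.\<close>

lemma solvable_ideal_supplement:
  assumes K: "\<And>x. \<exists>k\<in>K. x - k \<in> R" and I: "lie_ideal K I" "solvable I"
  shows "I \<subseteq> R"
proof -
  let ?S = "{x + y |x y. x \<in> I \<and> y \<in> R}"
  have subI: "subspace I" and brI: "\<And>x u. x \<in> K \<Longrightarrow> u \<in> I \<Longrightarrow> bracket x u \<in> I"
    using I by (auto simp: lie_ideal_def)
  have id: "lie_ideal UNIV ?S"
    unfolding lie_ideal_def
  proof (intro conjI ballI)
    show "subspace ?S" using subI subspace_R by (rule subspace_sums)
    fix z w assume "w \<in> ?S"
    then obtain x y where xy: "w = x + y" "x \<in> I" "y \<in> R" by blast
    obtain k where k: "k \<in> K" "z - k \<in> R" using K by blast
    have "bracket z w = bracket k x + (bracket (z - k) x + bracket z y)"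
      by (simp add: xy bracket_simps)
    moreover have "bracket k x \<in> I" using brI k xy by blast
    moreover have "bracket (z - k) x + bracket z y \<in> R"
      using bracket_R k xy subspace_R by (auto intro: subspace_add)
    ultimately show "bracket z w \<in> ?S" by blast
  qed simp
  have "solvable ?S"
    using I ideal_R solvable_R lie_ideal_subalgebra[OF id] lie_ideal_subalgebra[OF I(1)]
    by (intro solvable_sum[of I R ?S]) auto
  then have "?S \<subseteq> R" using R_greatest id by blast
  moreover have "x = x + 0" for x :: 'a by simp
  ultimately show ?thesis using subspace_0[OF subspace_R] by blast
qed

lemma solvable_of_perfect_R:
  assumes "lie_subalgebra A" "\<And>J. perfect J \<Longrightarrow> J \<subseteq> A \<Longrightarrow> J \<subseteq> R" shows "solvable A"
proof (rule ccontr)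
  assume "\<not> solvable A"
  then obtain J where J: "J \<subseteq> A" "perfect J" "J \<noteq> {0}" by (rule not_solvable_perfect[OF assms(1)])
  show False using perfect_subset_solvable[OF J(2) assms(2)[OF J(2,1)] solvable_R] J(3) by simp
qed

text \<open>
  The Casimir operator \<open>\<Gamma>\<close> of \<open>\<kappa>\<close> is the identity modulo \<open>R\<close>. Hence \<open>1 - \<Gamma>\<close> maps \<open>[K, K]\<close> into \<open>W\<close>,
  whereas it is the identity on \<open>(K \<inter> R) / W\<close>.
\<close>

lemma levi_step_central:
  assumes K: "lie_subalgebra K" "graded K" "\<And>x. \<exists>k\<in>K. x - k \<in> R"
    and W: "lie_ideal K W" "graded W" "W \<subseteq> K \<inter> R" "\<not> K \<inter> R \<subseteq> W"
    and central: "\<And>x n. x \<in> K \<Longrightarrow> n \<in> K \<inter> R \<Longrightarrow> bracket x n \<in> W"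
  shows "\<exists>K'. lie_subalgebra K' \<and> graded K' \<and> K' \<subset> K \<and> (\<forall>x. \<exists>k\<in>K'. x - k \<in> R)"
proof -
  have subK: "subspace K" and brK: "\<And>x y. x \<in> K \<Longrightarrow> y \<in> K \<Longrightarrow> bracket x y \<in> K"
    using K by (auto simp: lie_subalgebra_def)
  have subW: "subspace W" and brW: "\<And>x y. x \<in> K \<Longrightarrow> y \<in> W \<Longrightarrow> bracket x y \<in> W"
    using W by (auto simp: lie_ideal_def)
  have perpK: "perp \<kappa> K = R" using perp_supplement K(3) by blast
  obtain C b where dual: "dual_pair \<kappa> K C b" using dual_bases[OF sym_\<kappa> subK] by blast
  note C = dual_pairD[OF dual]
  note B = sym_form_simps[OF sym_\<kappa>]
  define \<Gamma> where "\<Gamma> y = (\<Sum>c\<in>C. bracket (b c) (bracket c y))" for y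
  have \<Gamma>: "endo \<Gamma>" unfolding \<Gamma>_def
    by (rule endoI) (simp_all add: bracket_simps sum.distrib scale_sum_right)
  \<comment> \<open>The vectors \<open>q c\<close> span the model of \<open>L / R\<close>, with dual
    coordinates \<open>\<kappa> v (b c)\<close>. Traces on \<open>L / R\<close> can thus be read off
    from the dual bases instead of \<open>Basis\<close>.\<close>
  have q_expand: "q v = (\<Sum>c\<in>C. scale (\<kappa> v (b c)) (q c))" for v
  proof -
    obtain k where k: "k \<in> K" "v - k \<in> R" using K(3) by blast
    have "k - (\<Sum>c\<in>C. scale (\<kappa> k (b c)) c) \<in> R" using C(5)[OF k(1)] perpK by blast
    from q_R[OF this] have "q k = (\<Sum>c\<in>C. scale (\<kappa> k (b c)) (q c))"
      by (simp add: endo_simps[OF endo_q])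
    moreover have "q v = q k" using q_R[OF k(2)] by (simp add: endo_simps[OF endo_q])
    moreover have "\<kappa> v w = \<kappa> k w" for w using \<kappa>_R(1)[OF k(2), of w] by (simp add: B)
    ultimately show ?thesis by simp
  qed
  \<comment> \<open>The trace defining \<open>\<kappa> x y\<close> is evaluated in the dual bases;
    invariance then moves everything but \<open>x\<close> to the second argument, where
    \<open>\<Gamma> y\<close> appears.\<close>
  have \<kappa>\<Gamma>: "\<kappa> x y = \<kappa> x (\<Gamma> y)" for x y
  proof -
    define T where "T v = bracket x (q (q (bracket y (q v))))" for v
    have T: "endo T" unfolding T_def
      by (rule endoI) (simp_all add: bracket_simps endo_simps[OF endo_q])
    have "\<kappa> x y = tr (\<lambda>v. q (T v))" by (simp add: \<kappa>_def trace_form_def ad_sub_def T_def)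
    also have "\<dots> = tr (\<lambda>v. \<Sum>c\<in>C. scale (\<kappa> (T v) (b c)) (q c))" by (subst q_expand) simp
    also have "\<dots> = (\<Sum>c\<in>C. \<kappa> (T (q c)) (b c))"
      unfolding tr_sum by (intro sum.cong refl tr_rank_one) (simp_all add: endo_simps[OF T] B)
    also have "\<dots> = (\<Sum>c\<in>C. \<kappa> x (bracket (b c) (bracket c y)))"
    proof (intro sum.cong refl)
      fix c
      have qR: "u - q (q u) \<in> R" for u
        using subspace_add[OF subspace_R q_diff[of u] q_diff[of "q u"]] by simp
      have "bracket y (c - q (q c)) \<in> R" by (intro bracket_R qR)
      from subspace_add[OF subspace_R this qR[of "bracket y (q (q c))"]]
      have "bracket y c - q (q (bracket y (q (q c)))) \<in> R" by (simp add: bracket_simps)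
      then have "bracket x (bracket y c) - T (q c) \<in> R"
        unfolding T_def bracket_diff[symmetric] by (rule bracket_R)
      from \<kappa>_R(1)[OF this, of "b c"]
      have "\<kappa> (T (q c)) (b c) = \<kappa> (bracket x (bracket y c)) (b c)" by (simp add: B)
      also have "\<dots> = \<kappa> x (bracket (bracket y c) (b c))" by (rule \<kappa>_invariant)
      also have "bracket (bracket y c) (b c) = bracket (b c) (bracket c y)"
        by (subst bracket_anticomm, subst bracket_anticomm[of y c]) (simp add: bracket_simps)
      finally show "\<kappa> (T (q c)) (b c) = \<kappa> x (bracket (b c) (bracket c y))" .
    qed
    finally show ?thesis by (simp add: \<Gamma>_def B)
  qed
  have \<Gamma>R: "y - \<Gamma> y \<in> R" for y
    unfolding \<kappa>_radical by (subst sym_form_sym[OF sym_\<kappa>]) (simp add: B \<kappa>\<Gamma>[symmetric])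
  have \<Gamma>_comm: "bracket x (\<Gamma> y) - \<Gamma> (bracket x y) \<in> W" if xy: "x \<in> K" "y \<in> K" for x y
  proof -
    let ?\<Phi> = "\<lambda>u v. bracket v (bracket u y)"
    have "(\<Sum>c\<in>C. ?\<Phi> (bracket x c) (b c) + ?\<Phi> c (bracket x (b c))) \<in> W"
    proof (rule casimir_invariance[OF sym_\<kappa> order_refl brK \<kappa>_invariant dual _ _ subW _ _ xy(1)])
      show "endo (\<lambda>u. ?\<Phi> u v)" "endo (?\<Phi> u)" for u v by (rule endoI; simp add: bracket_simps)+
      fix n d assume nd: "n \<in> K \<inter> perp \<kappa> K" "d \<in> K"
      then have n: "n \<in> K \<inter> R" by (simp add: perpK)
      have ny: "bracket n y \<in> W" using central[OF xy(2) n] bracket_in_sym subW by blast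
      then show "?\<Phi> n d \<in> W" using brW nd by blast
      have "bracket (bracket d y) n \<in> W" using central[OF brK[OF nd(2) xy(2)] n] .
      then show "?\<Phi> d n \<in> W" using bracket_in_sym subW by blast
    qed
    moreover have "bracket x (\<Gamma> y) - \<Gamma> (bracket x y)
        = (\<Sum>c\<in>C. ?\<Phi> (bracket x c) (b c) + ?\<Phi> c (bracket x (b c)))"
      unfolding \<Gamma>_def bracket_sum(2) sum_subtractf[symmetric]
      by (intro sum.cong refl) (simp add: jacobi_left bracket_simps algebra_simps)
    ultimately show ?thesis by simp
  qed
  \<comment> \<open>For a bracket \<open>[x, y]\<close>: the difference
    \<open>y - \<Gamma> y\<close> lies in \<open>K \<inter> R\<close>, which is central modulo
    \<open>W\<close>, and \<open>\<Gamma>\<close> commutes with the action of \<open>x\<close>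
    modulo \<open>W\<close>.\<close>
  have id: "z - \<Gamma> z \<in> W" if "z \<in> bracket_space K K" for z
  proof -
    have "bracket_space K K \<subseteq> {z. z - \<Gamma> z \<in> W}"
    proof (rule bracket_space_subset)
      show "subspace {z. z - \<Gamma> z \<in> W}"
        by (rule subspace_preimage[OF endo_minus[OF endo_id \<Gamma>] subW])
      fix x y assume xy: "x \<in> K" "y \<in> K"
      have "\<Gamma> y \<in> K" unfolding \<Gamma>_def using C subK brK xy by (auto intro!: subspace_sum)
      then have "bracket x (y - \<Gamma> y) \<in> W"
        using central[OF xy(1)] \<Gamma>R xy(2) subK by (auto intro: subspace_diff)
      from subspace_add[OF subW this \<Gamma>_comm[OF xy]]
      show "bracket x y \<in> {z. z - \<Gamma> z \<in> W}" by (simp add: bracket_simps)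
    qed
    then show ?thesis using that by blast
  qed
  define K' where "K' = {x + y |x y. x \<in> bracket_space K K \<and> y \<in> W}"
  have idKK: "lie_ideal K (bracket_space K K)"
    using K(1) by (intro lie_ideal_bracket_space) (auto simp: lie_ideal_def lie_subalgebra_def)
  have idK': "lie_ideal K K'" unfolding K'_def by (rule lie_ideal_sum[OF idKK W(1) subK])
  have "graded K'" unfolding K'_def by (intro graded_sum graded_bracket_space K W)
  moreover have "K' \<noteq> K"
  proof
    assume KK: "K' = K"
    \<comment> \<open>Modulo \<open>W\<close> the operator \<open>\<Gamma>\<close> kills
      \<open>n\<close> by centrality, but it fixes the part of \<open>n\<close> in
      \<open>[K, K]\<close>.\<close>
    have "n \<in> W" if n: "n \<in> K \<inter> R" for n
    proof -
      obtain x y where xy: "n = x + y" "x \<in> bracket_space K K" "y \<in> W" using n KK K'_def by blast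
      have \<Gamma>W: "\<Gamma> n \<in> W"
        unfolding \<Gamma>_def using C central n subW brW by (auto intro!: subspace_sum)
      have \<Gamma>y: "\<Gamma> y \<in> W" unfolding \<Gamma>_def using C brW xy subW by (auto intro!: subspace_sum)
      have "(x - \<Gamma> x) + (y - \<Gamma> y) + \<Gamma> n \<in> W"
        by (rule subspace_add[OF subW subspace_add[OF subW id[OF xy(2)]
              subspace_diff[OF subW xy(3) \<Gamma>y]] \<Gamma>W])
      then show ?thesis using xy(1) by (simp add: endo_simps[OF \<Gamma>])
    qed
    then show False using W(4) by blast
  qed
  moreover have "K' \<subseteq> K" using idK' by (simp add: lie_ideal_def)
  moreover have "\<exists>k\<in>K'. x - k \<in> R" for x
  proof -
    obtain k where k: "k \<in> K" "x - k \<in> R" using K(3) by blast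
    \<comment> \<open>\<open>\<Gamma> k\<close> is a sum of brackets and congruent to
      \<open>k\<close> modulo \<open>R\<close>, so \<open>[K, K]\<close> still supplements
      \<open>R\<close>.\<close>
    have "\<Gamma> k \<in> bracket_space K K"
      unfolding \<Gamma>_def using C brK k by (intro subspace_sum subspace_bracket_space bracket_spaceI) auto
    moreover have "\<Gamma> k = \<Gamma> k + 0" by simp
    ultimately have "\<Gamma> k \<in> K'" unfolding K'_def using subspace_0[OF subW] by blast
    moreover have "x - \<Gamma> k \<in> R" using subspace_add[OF subspace_R k(2) \<Gamma>R[of k]] by simp
    ultimately show ?thesis by blast
  qed
  ultimately show ?thesis using lie_ideal_subalgebra[OF idK'] by blast
qed

end

context fd_graded_lie_algebra
begin

lemma tr_degree_part_conj:
  assumes s: "endo s" "\<And>g x. g \<in> carrier G \<Longrightarrow> hp g (s x) = s (hp g x)" and P: "endo P"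
  shows "tr (\<lambda>v. s (degree_part P (s v))) = tr (\<lambda>v. s (P (s v)))"
proof -
  have "s (degree_part P (s v)) = degree_part (\<lambda>v. s (P (s v))) v" for v
    by (simp add: degree_part_def s(2) endo_sum[OF s(1)] cong: sum.cong)
  then have "tr (\<lambda>v. s (degree_part P (s v))) = tr (degree_part (\<lambda>v. s (P (s v))))" by simp
  also have "\<dots> = tr (\<lambda>v. s (P (s v)))"
    by (rule tr_degree_part[OF endo_comp[OF s(1) endo_comp[OF P s(1)]]])
  finally show ?thesis .
qed

end

context levi_data
begin

text \<open>
  Here \<open>\<Gamma>\<close> is the Casimir operator of the trace form on \<open>N / W\<close>, \<open>p\<close> is a projection onto \<open>N\<close>, and \<open>F\<close> is
  the coboundary of \<open>p\<close>, which vanishes modulo \<open>W\<close> when an argument lies in \<open>N\<close>. The usual homotopy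
  \<open>y \<mapsto> (\<Sum>c. [c, F (b c) y])\<close> has coboundary \<open>\<Gamma> \<circ> F\<close> modulo \<open>W\<close>, so that subtracting it from \<open>\<Gamma> \<circ> p\<close>
  gives a derivation \<open>P\<close> modulo \<open>W\<close> with restriction \<open>\<Gamma>\<close> to \<open>N\<close>. The trace of \<open>\<Gamma>\<close> on \<open>N / W\<close> is the
  number of elements of \<open>C\<close>, in particular not zero.
\<close>

lemma levi_step_irreducible:
  assumes K: "lie_subalgebra K" "graded K" "\<And>x. \<exists>k\<in>K. x - k \<in> R"
    and N_def: "N = K \<inter> R"
    and W: "lie_ideal K W" "graded W" "W \<subseteq> N" "\<not> N \<subseteq> W"
    and NN: "\<And>m n. m \<in> N \<Longrightarrow> n \<in> N \<Longrightarrow> bracket m n \<in> W"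
    and Wmax: "\<And>I. lie_ideal K I \<Longrightarrow> graded I \<Longrightarrow> W \<subseteq> I \<Longrightarrow> I \<subseteq> N \<Longrightarrow> I = W \<or> I = N"
    and noncentral: "\<exists>x\<in>K. \<exists>n\<in>N. bracket x n \<notin> W"
  shows "\<exists>K'. lie_subalgebra K' \<and> graded K' \<and> K' \<subset> K \<and> (\<forall>x. \<exists>k\<in>K'. x - k \<in> R)"
proof -
  have subK: "subspace K" and brK: "\<And>x y. x \<in> K \<Longrightarrow> y \<in> K \<Longrightarrow> bracket x y \<in> K"
    using K by (auto simp: lie_subalgebra_def)
  have subW: "subspace W" and brW: "\<And>x y. x \<in> K \<Longrightarrow> y \<in> W \<Longrightarrow> bracket x y \<in> W"
    using W by (auto simp: lie_ideal_def)
  have idN: "lie_ideal K N"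
    unfolding N_def lie_ideal_def using subK subspace_R brK bracket_R by (auto intro: subspace_inter)
  have subN: "subspace N" and brN: "\<And>x y. x \<in> K \<Longrightarrow> y \<in> N \<Longrightarrow> bracket x y \<in> N"
    and brN': "\<And>x y. x \<in> N \<Longrightarrow> y \<in> K \<Longrightarrow> bracket x y \<in> N" and NK: "N \<subseteq> K"
    using idN lie_ideal_bracket2[OF idN] by (auto simp: lie_ideal_def)
  have grN: "graded N" unfolding N_def by (rule graded_Int[OF K(2) graded_R])
  have hpK: "hp g x \<in> K" if "x \<in> K" "g \<in> carrier G" for x g using K(2) that by (simp add: graded_iff)
  have hpN: "hp g x \<in> N" if "x \<in> N" "g \<in> carrier G" for x g using grN that by (simp add: graded_iff)
  have hpW: "hp g x \<in> W" if "x \<in> W" "g \<in> carrier G" for x g using W(2) that by (simp add: graded_iff)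
  have perpK: "perp \<kappa> K = R" using perp_supplement K(3) by blast
  obtain s where s: "subquotient_proj s N W" and sg: "\<And>g x. g \<in> carrier G \<Longrightarrow> hp g (s x) = s (hp g x)"
    using graded_subquotient_proj_exists[OF grN W(2,3)] by blast
  have s': "endo s" "\<And>x. s x \<in> N" "\<And>w. w \<in> W \<Longrightarrow> s w = 0" "\<And>x. x \<in> N \<Longrightarrow> x - s x \<in> W"
    "\<And>x. s (s x) = s x"
    using s by (auto simp: subquotient_proj_def)
  have s0: "x \<in> W" if "x \<in> N" "s x = 0" for x using s'(4)[OF that(1)] that(2) by simp
  define \<gamma> where "\<gamma> = trace_form (ad_sub s)"
  have rep: "lie_rep K (ad_sub s)" by (rule lie_rep_ad_sub[OF s brN brW])
  have sym\<gamma>: "sym_form \<gamma>" unfolding \<gamma>_def by (rule sym_form_trace_form[OF rep])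
  have inv\<gamma>: "\<gamma> (bracket x y) z = \<gamma> x (bracket y z)" if "x \<in> K" "y \<in> K" "z \<in> K" for x y z
    unfolding \<gamma>_def using trace_form_invariant[OF rep that] .
  note B = sym_form_simps[OF sym_\<kappa>] and B\<gamma> = sym_form_simps[OF sym\<gamma>]

  define I where "I = {x \<in> K. \<forall>n\<in>N. bracket x n \<in> W}"
  have subI: "subspace I" unfolding I_def
    by (rule subspaceI) (use subK subW in \<open>auto simp: subspace_0 subspace_add subspace_scale bracket_simps\<close>)
  have brI: "bracket x y \<in> I" if "x \<in> K" "y \<in> I" for x y
    using that brK brN brW subW by (auto simp: I_def jacobi_left intro!: subspace_diff)
  have idI: "lie_ideal K I" using subI brI by (auto simp: lie_ideal_def I_def)
  have NI: "N \<subseteq> I" using NN NK by (auto simp: I_def)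
  \<comment> \<open>The form \<open>\<gamma>\<close> vanishes on \<open>I\<close>, which acts
    trivially on \<open>N / W\<close>. The Casimir element is therefore taken from the orthogonal
    ideal \<open>D\<close>, which together with \<open>I\<close> fills \<open>K\<close> and meets
    \<open>I\<close> inside \<open>N\<close>.\<close>
  define D where "D = K \<inter> perp \<kappa> I"
  have subD: "subspace D" unfolding D_def by (rule subspace_inter[OF subK subspace_perp[OF sym_\<kappa>]])
  have DK: "D \<subseteq> K" by (auto simp: D_def)
  have brD: "bracket y x \<in> D" if "y \<in> K" "x \<in> D" for x y
  proof -
    have "\<kappa> (bracket x y) z = 0" if "z \<in> I" for z
      using \<kappa>_invariant[of x y z] brI[OF \<open>y \<in> K\<close> that] \<open>x \<in> D\<close> by (simp add: D_def perp_def)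
    then have "bracket x y \<in> D" using brK that by (auto simp: D_def perp_def)
    then show ?thesis using bracket_in_sym[OF subD] by blast
  qed
  have idD: "lie_ideal K D" using subD DK brD by (auto simp: lie_ideal_def)
  have ND: "N \<subseteq> D" using \<kappa>_R(1) NK by (auto simp: D_def perp_def N_def)
  \<comment> \<open>\<open>D\<close> is orthogonal to \<open>I\<close>, so by invariance brackets
    within the intersection are orthogonal to \<open>K\<close> and fall into
    \<open>R\<close>.\<close>
  have DI_R: "D \<inter> I \<subseteq> R"
  proof (rule solvable_ideal_supplement[OF K(3) lie_ideal_Int[OF idD idI]])
    have "bracket x y \<in> R" if xy: "x \<in> D \<inter> I" "y \<in> D \<inter> I" for x y
    proof -
      have "\<kappa> (bracket x y) z = 0" if z: "z \<in> K" for z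
      proof -
        have "bracket y z \<in> I" using brI[OF z, of y] xy bracket_in_sym[OF subI] by blast
        then show ?thesis using \<kappa>_invariant[of x y z] xy by (simp add: D_def perp_def)
      qed
      then show ?thesis using perpK by (auto simp: perp_def)
    qed
    then have "bracket_space (D \<inter> I) (D \<inter> I) \<subseteq> R" by (intro bracket_space_subset[OF subspace_R])
    then have "J \<subseteq> R" if "perfect J" "J \<subseteq> D \<inter> I" for J
      using that bracket_space_mono[of J "D \<inter> I" J "D \<inter> I"] by (auto simp: perfect_def)
    then show "solvable (D \<inter> I)"
      by (intro solvable_of_perfect_R lie_ideal_subalgebra[OF lie_ideal_Int[OF idD idI]])
  qed
  have KID: "\<exists>i\<in>I. x - i \<in> D" if x: "x \<in> K" for x
  proof (rule orthogonal_decomposition[OF sym_\<kappa> subI _ x])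
    show "\<kappa> y n = 0" if "y \<in> K" "n \<in> I \<inter> perp \<kappa> I" for y n
    proof -
      have "n \<in> D \<inter> I" using that(2) by (auto simp: D_def I_def)
      then show ?thesis using DI_R \<kappa>_R(2) by blast
    qed
    fix d assume d: "d \<in> I" "x - d \<in> perp \<kappa> I"
    then have "x - d \<in> D" using x subK by (auto simp: D_def I_def intro: subspace_diff)
    then show "\<exists>i\<in>I. x - i \<in> D" using d by blast
  qed
  \<comment> \<open>By Cartan's criterion a perfect subalgebra of the radical of
    \<open>\<gamma>\<close> on \<open>D\<close> acts trivially on \<open>N / W\<close>; it lies in
    \<open>D \<inter> I\<close>, hence in \<open>R\<close>.\<close>
  have radD: "D \<inter> perp \<gamma> D = N"
  proof
    show "N \<subseteq> D \<inter> perp \<gamma> D"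
    proof
      fix n assume n: "n \<in> N"
      have "ad_sub s n v = 0" for v unfolding ad_sub_def using NN[OF n s'(2)] by (rule s'(3))
      then have "\<gamma> n y = 0" for y by (simp add: \<gamma>_def trace_form_def tr_zero)
      then show "n \<in> D \<inter> perp \<gamma> D" using n ND by (auto simp: perp_def)
    qed
    let ?Z = "D \<inter> perp \<gamma> D"
    have subZ: "subspace ?Z" by (rule subspace_inter[OF subD subspace_perp[OF sym\<gamma>]])
    have idZ: "lie_ideal K ?Z"
      unfolding lie_ideal_def
    proof (intro conjI ballI)
      show "subspace ?Z" by (rule subZ)
      show "?Z \<subseteq> K" using DK by blast
      fix y x assume yx: "y \<in> K" "x \<in> ?Z"
      have "\<gamma> (bracket x y) d = 0" if d: "d \<in> D" for d
        using inv\<gamma>[of x y d] yx d DK brD[OF yx(1) d] by (auto simp: perp_def)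
      moreover have "bracket x y \<in> D" using brD[OF yx(1)] yx(2) bracket_in_sym[OF subD] by blast
      ultimately have "bracket x y \<in> ?Z" by (simp add: perp_def)
      then show "bracket y x \<in> ?Z" using bracket_in_sym[OF subZ] by blast
    qed
    have "?Z \<subseteq> R"
    proof (rule solvable_ideal_supplement[OF K(3) idZ])
      show "solvable ?Z"
      proof (rule solvable_of_perfect_R[OF lie_ideal_subalgebra[OF idZ]])
        fix J assume J: "perfect J" "J \<subseteq> ?Z"
        have "J \<subseteq> I"
        proof
          fix x assume x: "x \<in> J"
          have "bracket x n \<in> W" if n: "n \<in> N" for n
            by (rule perfect_trace_form_zero[OF s subW brN brW J(1) _ _ x n])
              (use J(2) DK in \<open>auto simp: perp_def \<gamma>_def\<close>)
          then show "x \<in> I" using x J(2) DK by (auto simp: I_def)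
        qed
        then show "J \<subseteq> R" using J(2) DI_R by blast
      qed
    qed
    then show "?Z \<subseteq> N" using DK by (auto simp: N_def)
  qed
  obtain C b where dual: "dual_pair \<gamma> D C b" using dual_bases[OF sym\<gamma> subD] by blast
  note C = dual_pairD[OF dual]
  have CK: "\<And>c. c \<in> C \<Longrightarrow> c \<in> K" "\<And>c. c \<in> C \<Longrightarrow> b c \<in> K" using C(2,3) DK by blast+
  \<comment> \<open>Otherwise \<open>D \<subseteq> N \<subseteq> I\<close>, and
    \<open>K = I + D\<close> would act trivially on \<open>N / W\<close>.\<close>
  have "C \<noteq> {}"
  proof
    assume "C = {}"
    then have "D \<subseteq> N" using C(5) radD by auto
    have "K \<subseteq> I"
    proof
      fix x assume "x \<in> K"
      then obtain i where "i \<in> I" "x - i \<in> D" using KID by blast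
      then have "i + (x - i) \<in> I" using \<open>D \<subseteq> N\<close> NI subI by (intro subspace_add) auto
      then show "x \<in> I" by simp
    qed
    then show False using noncentral by (auto simp: I_def)
  qed
  obtain p where p: "endo p" "\<And>x. p x \<in> N" "\<And>x. x \<in> N \<Longrightarrow> p x = x"
    using projection_exists[OF subN] by blast
  define F where "F u v = bracket u (p v) + bracket (p u) v - p (bracket u v)" for u v
  define \<Gamma> where "\<Gamma> n = (\<Sum>c\<in>C. bracket c (bracket (b c) n))" for n
  define P where "P y = (\<Sum>c\<in>C. bracket c (bracket (b c) (p y)) - bracket c (F (b c) y))" for y
  have F_endo: "endo (F u)" "endo (\<lambda>u. F u v)" for u v
    unfolding F_def by (rule endoI; simp add: endo_simps[OF p(1)] bracket_simps algebra_simps)+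
  note Fs = endo_simps[OF F_endo(1)]
  have F_anti: "F u v = - F v u" for u v
    unfolding F_def by (simp add: bracket_anticomm[of u] bracket_anticomm[of "p u"] endo_simps[OF p(1)])
  have FN: "F u v \<in> N" if "u \<in> K" "v \<in> K" for u v
    unfolding F_def using that brN brN' p(2) subN by (intro subspace_diff subspace_add) auto
  have FnW: "F n v \<in> W" if "n \<in> N" "v \<in> K" for n v
  proof -
    have "F n v = bracket n (p v)" using p(3) brN'[OF that] that by (simp add: F_def)
    then show ?thesis using NN that p(2) by simp
  qed
  have \<Gamma>: "endo \<Gamma>" unfolding \<Gamma>_def
    by (rule endoI) (simp_all add: bracket_simps sum.distrib scale_sum_right)
  have P: "endo P" unfolding P_def
    by (rule endoI) (simp_all add: bracket_simps endo_simps[OF p(1)] Fs sum.distrib sum_subtractf scale_sum_right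
        scale_right_diff_distrib)
  have PN: "P y \<in> N" if "y \<in> K" for y
    unfolding P_def using that CK FN brN p(2) subN by (intro subspace_sum subspace_diff) auto
  have P\<Gamma>: "P n - \<Gamma> n \<in> W" if n: "n \<in> N" for n
  proof -
    have "F (b c) n \<in> W" if "c \<in> C" for c
      using FnW[OF n CK(2)[OF that]] subW by (subst F_anti) (rule subspace_neg)
    then have "bracket c (F (b c) n) \<in> W" if "c \<in> C" for c
      using that CK brW by blast
    then have "- (\<Sum>c\<in>C. bracket c (F (b c) n)) \<in> W" using subW by (intro subspace_neg subspace_sum)
    then show ?thesis by (simp add: P_def \<Gamma>_def p(3)[OF n] sum_subtractf)
  qed
  have \<Gamma>_comm: "bracket y (\<Gamma> n) - \<Gamma> (bracket y n) \<in> W" if y: "y \<in> K" and n: "n \<in> N" for y n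
  proof -
    let ?\<Phi> = "\<lambda>u v. bracket u (bracket v n)"
    have "(\<Sum>c\<in>C. ?\<Phi> (bracket y c) (b c) + ?\<Phi> c (bracket y (b c))) \<in> W"
    proof (rule casimir_invariance[OF sym\<gamma> DK brD inv\<gamma> dual _ _ subW _ _ y])
      show "endo (\<lambda>u. ?\<Phi> u v)" "endo (?\<Phi> u)" for u v by (rule endoI; simp add: bracket_simps)+
      fix m d assume "m \<in> D \<inter> perp \<gamma> D" "d \<in> D"
      then have m: "m \<in> N" "d \<in> K" using radD DK by auto
      show "?\<Phi> m d \<in> W" using NN m brN n by blast
      show "?\<Phi> d m \<in> W" using NN m brW n by blast
    qed
    moreover have "bracket y (\<Gamma> n) - \<Gamma> (bracket y n)
        = (\<Sum>c\<in>C. ?\<Phi> (bracket y c) (b c) + ?\<Phi> c (bracket y (b c)))"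
      unfolding \<Gamma>_def bracket_sum(2) sum_subtractf[symmetric]
      by (intro sum.cong refl) (simp add: jacobi_left bracket_simps algebra_simps)
    ultimately show ?thesis by simp
  qed
  have F_inv: "(\<Sum>c\<in>C. bracket (bracket y c) (F (b c) z) + bracket c (F (bracket y (b c)) z)) \<in> W"
    if y: "y \<in> K" and z: "z \<in> K" for y z
  proof (rule casimir_invariance[OF sym\<gamma> DK brD inv\<gamma> dual _ _ subW _ _ y, where \<Phi> = "\<lambda>u v. bracket u (F v z)"])
    show "endo (\<lambda>u. bracket u (F v z))" "endo (\<lambda>v. bracket u (F v z))" for u v
      by (rule endoI; simp add: bracket_simps endo_simps[OF F_endo(2)])+
    fix m d assume "m \<in> D \<inter> perp \<gamma> D" "d \<in> D"
    then have m: "m \<in> N" "d \<in> K" using radD DK by auto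
    show "bracket m (F d z) \<in> W" using NN m FN z by blast
    show "bracket d (F m z) \<in> W" using brW m FnW z by blast
  qed
  \<comment> \<open>\<open>F\<close> is the coboundary of \<open>p\<close> with values in the
    adjoint module, so the cocycle identity holds exactly and not just modulo
    \<open>W\<close>.\<close>
  have cocycle: "F u (bracket y z) - bracket y (F u z) + bracket z (F u y)
      = F (bracket u y) z - F (bracket u z) y - bracket u (F y z)" for u y z
  proof -
    have "bracket u (bracket y z) = bracket (bracket u y) z - bracket (bracket u z) y"
      by (subst bracket_anticomm[of "bracket u z"]) (simp add: jacobi_left)
    then have p3: "p (bracket u (bracket y z)) = p (bracket (bracket u y) z) - p (bracket (bracket u z) y)"
      by (simp add: endo_simps[OF p(1)])
    have F2: "F u v = bracket u (p v) - bracket v (p u) - p (bracket u v)" for u v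
      unfolding F_def by (subst bracket_anticomm[of "p u"]) simp
    show ?thesis unfolding F2 p3 by (simp add: bracket_simps jacobi_left[of _ _ "p _"])
  qed
  have P_deriv: "P (bracket y z) - bracket y (P z) + bracket z (P y) \<in> W" if yz: "y \<in> K" "z \<in> K" for y z
  proof -
    define g where "g y = (\<Sum>c\<in>C. bracket c (F (b c) y))" for y
    have Pg: "P y = \<Gamma> (p y) - g y" for y by (simp add: P_def \<Gamma>_def g_def sum_subtractf)
    \<comment> \<open>\<open>A1\<close> to \<open>A4\<close> are the errors in \<open>W\<close> made
      by the invariance of the Casimir element. Up to them \<open>\<Gamma> \<circ> p\<close> and
      \<open>g\<close> have the same derivation defect \<open>- \<Gamma> (F y z)\<close>, which
      cancels in the difference \<open>P\<close>.\<close>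
    define A1 where "A1 = bracket y (\<Gamma> (p z)) - \<Gamma> (bracket y (p z))"
    define A2 where "A2 = bracket z (\<Gamma> (p y)) - \<Gamma> (bracket z (p y))"
    define A3 where "A3 = (\<Sum>c\<in>C. bracket (bracket y c) (F (b c) z) + bracket c (F (bracket y (b c)) z))"
    define A4 where "A4 = (\<Sum>c\<in>C. bracket (bracket z c) (F (b c) y) + bracket c (F (bracket z (b c)) y))"
    have A: "A1 \<in> W" "A2 \<in> W" "A3 \<in> W" "A4 \<in> W"
      unfolding A1_def A2_def A3_def A4_def using yz p(2) \<Gamma>_comm F_inv by blast+
    have 1: "\<Gamma> (p (bracket y z)) - bracket y (\<Gamma> (p z)) + bracket z (\<Gamma> (p y)) = A2 - A1 - \<Gamma> (F y z)"
    proof -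
      have "F y z = bracket y (p z) - bracket z (p y) - p (bracket y z)"
        unfolding F_def by (subst bracket_anticomm[of "p y"]) simp
      then show ?thesis by (simp add: A1_def A2_def endo_simps[OF \<Gamma>])
    qed
    have "g (bracket y z) - bracket y (g z) + bracket z (g y)
        = (\<Sum>c\<in>C. bracket c (F (b c) (bracket y z)) - bracket y (bracket c (F (b c) z))
            + bracket z (bracket c (F (b c) y)))"
      by (simp add: g_def bracket_sum sum.distrib sum_subtractf)
    also have "\<dots> = (\<Sum>c\<in>C. (bracket (bracket z c) (F (b c) y) + bracket c (F (bracket z (b c)) y))
        - (bracket (bracket y c) (F (b c) z) + bracket c (F (bracket y (b c)) z))
        - bracket c (bracket (b c) (F y z)))"
    proof (intro sum.cong refl)
      fix c
      have "bracket c (F (b c) (bracket y z)) - bracket y (bracket c (F (b c) z)) + bracket z (bracket c (F (b c) y))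
        = bracket c (F (b c) (bracket y z) - bracket y (F (b c) z) + bracket z (F (b c) y))
          - bracket (bracket y c) (F (b c) z) + bracket (bracket z c) (F (b c) y)"
        by (simp add: jacobi_left bracket_simps)
      also have "F (b c) (bracket y z) - bracket y (F (b c) z) + bracket z (F (b c) y)
          = - F (bracket y (b c)) z + F (bracket z (b c)) y - bracket (b c) (F y z)"
        unfolding cocycle bracket_anticomm[of "b c" y] bracket_anticomm[of "b c" z]
        by (simp add: endo_simps[OF F_endo(2)])
      finally show "bracket c (F (b c) (bracket y z)) - bracket y (bracket c (F (b c) z))
            + bracket z (bracket c (F (b c) y))
        = (bracket (bracket z c) (F (b c) y) + bracket c (F (bracket z (b c)) y))
        - (bracket (bracket y c) (F (b c) z) + bracket c (F (bracket y (b c)) z))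
        - bracket c (bracket (b c) (F y z))"
        by (simp add: bracket_simps)
    qed
    also have "\<dots> = A4 - A3 - \<Gamma> (F y z)" by (simp add: A3_def A4_def \<Gamma>_def sum_subtractf)
    finally have 2: "g (bracket y z) - bracket y (g z) + bracket z (g y) = A4 - A3 - \<Gamma> (F y z)" .
    have "P (bracket y z) - bracket y (P z) + bracket z (P y)
        = (\<Gamma> (p (bracket y z)) - bracket y (\<Gamma> (p z)) + bracket z (\<Gamma> (p y)))
          - (g (bracket y z) - bracket y (g z) + bracket z (g y))"
      by (simp add: Pg bracket_simps)
    then have "P (bracket y z) - bracket y (P z) + bracket z (P y) = (A2 - A1) - (A4 - A3)"
      unfolding 1 2 by simp
    moreover have "(A2 - A1) - (A4 - A3) \<in> W"
      using subspace_diff[OF subW subspace_diff[OF subW A(2,1)] subspace_diff[OF subW A(4,3)]] .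
    ultimately show ?thesis by simp
  qed

  define Q where "Q = degree_part P"
  have Q: "endo Q" unfolding Q_def by (rule endo_degree_part[OF P])
  have QN: "Q x \<in> N" if "x \<in> K" for x
    unfolding Q_def by (intro degree_part_in[OF grN] PN hpK that)
  have hpQ: "hp g (Q x) = Q (hp g x)" if "g \<in> carrier G" for g x
    unfolding Q_def using hp_degree_part[OF P that] by simp
  have QW: "Q w \<in> W" if w: "w \<in> W" for w
  proof -
    have PW: "P w \<in> W" if w: "w \<in> W" for w
    proof -
      have "\<Gamma> w \<in> W" unfolding \<Gamma>_def using CK brW w subW by (intro subspace_sum) auto
      from subspace_add[OF subW P\<Gamma>[OF subsetD[OF W(3) w]] this] show ?thesis by simp
    qed
    show ?thesis unfolding Q_def by (intro degree_part_in[OF W(2)] PW hpW[OF w])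
  qed
  \<comment> \<open>For homogeneous arguments each of the three terms is the component of degree
    \<open>g \<otimes> h\<close> of the corresponding term for \<open>P\<close>, and
    \<open>W\<close> is graded.\<close>
  have Q_hom: "Q (bracket x y) - bracket x (Q y) - bracket (Q x) y \<in> W"
    if x: "x \<in> K" "x \<in> comp g" "g \<in> carrier G" and y: "y \<in> K" "y \<in> comp h" "h \<in> carrier G" for x y g h
  proof -
    have gh: "g \<otimes> h \<in> carrier G" using x y by simp
    have hpx: "hp g x = x" "hp h y = y" using x y in_comp_iff by auto
    have "bracket x y \<in> comp (g \<otimes> h)" using x y by (intro bracket_comp)
    then have xy: "hp (g \<otimes> h) (bracket x y) = bracket x y" using in_comp_iff[OF gh] by blast
    have 1: "Q (bracket x y) = hp (g \<otimes> h) (P (bracket x y))"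
      using hp_degree_part(2)[OF P gh, of "bracket x y"] by (simp add: Q_def xy)
    have "Q y = hp h (P y)" using hp_degree_part(2)[OF P y(3), of y] by (simp add: Q_def hpx)
    then have 2: "bracket x (Q y) = hp (g \<otimes> h) (bracket x (P y))"
      using hp_bracket_left[OF x(3) gh x(2), of "P y"] x(3) y(3) by (simp add: m_assoc[symmetric])
    have "Q x = hp g (P x)" using hp_degree_part(2)[OF P x(3), of x] by (simp add: Q_def hpx)
    then have 3: "bracket (Q x) y = hp (g \<otimes> h) (bracket (P x) y)"
      using hp_bracket_right[OF y(3) gh y(2), of "P x"] x(3) y(3) by (simp add: m_assoc)
    have "P (bracket x y) - bracket x (P y) - bracket (P x) y \<in> W"
      using P_deriv[OF x(1) y(1)] by (subst bracket_anticomm[of "P x"]) simp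
    from hpW[OF this gh] show ?thesis unfolding 1 2 3 by (simp add: endo_diff[OF endo_hp[OF gh]])
  qed
  have Q_deriv: "Q (bracket x y) - bracket x (Q y) - bracket (Q x) y \<in> W" if xy: "x \<in> K" "y \<in> K" for x y
  proof -
    let ?E = "\<lambda>x y. Q (bracket x y) - bracket x (Q y) - bracket (Q x) y"
    have "?E x y = ?E (\<Sum>g\<in>carrier G. hp g x) (\<Sum>h\<in>carrier G. hp h y)" by (simp add: sum_hp)
    also have "\<dots> = (\<Sum>h\<in>carrier G. \<Sum>g\<in>carrier G. ?E (hp g x) (hp h y))"
      by (simp add: bracket_sum endo_sum[OF Q] sum_subtractf)
    also have "\<dots> \<in> W"
    proof (intro subspace_sum[OF subW])
      fix h g assume gh: "h \<in> carrier G" "g \<in> carrier G"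
      show "?E (hp g x) (hp h y) \<in> W"
        by (rule Q_hom[OF hpK[OF xy(1) gh(2)] hp_in_comp[OF gh(2)] gh(2)
              hpK[OF xy(2) gh(1)] hp_in_comp[OF gh(1)] gh(1)])
    qed
    finally show ?thesis .
  qed
  \<comment> \<open>\<open>Q\<close> commutes with the action of \<open>K\<close> on
    \<open>N / W\<close>: the extra term \<open>[Q x, n]\<close> is a bracket within
    \<open>N\<close>, hence in \<open>W\<close>. Its kernel there is a graded ideal, so it is zero
    or everything, and the trace excludes the latter.\<close>
  define I1 where "I1 = {n \<in> N. Q n \<in> W}"
  have idI1: "lie_ideal K I1"
    unfolding lie_ideal_def
  proof (intro conjI ballI)
    have "I1 = N \<inter> {n. Q n \<in> W}" by (auto simp: I1_def)
    then show "subspace I1" using subspace_inter[OF subN subspace_preimage[OF Q subW]] by simp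
    show "I1 \<subseteq> K" using NK by (auto simp: I1_def)
    fix x n assume xn: "x \<in> K" "n \<in> I1"
    then have n: "n \<in> N" "Q n \<in> W" by (auto simp: I1_def)
    have "bracket x (Q n) \<in> W" "bracket (Q x) n \<in> W" using brW NN QN xn n by auto
    from subspace_add[OF subW subspace_add[OF subW Q_deriv[OF xn(1) subsetD[OF NK n(1)]] this(2)] this(1)]
    show "bracket x n \<in> I1" using brN xn n by (simp add: I1_def)
  qed
  have "graded I1"
    using idI1 hpN hpW by (auto simp: graded_iff lie_ideal_def I1_def hpQ[symmetric])
  moreover have "W \<subseteq> I1" using W(3) QW by (auto simp: I1_def)
  moreover have "I1 \<subseteq> N" by (auto simp: I1_def)
  ultimately have "I1 = W \<or> I1 = N" using Wmax[OF idI1] by blast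
  moreover have "I1 \<noteq> N"
  proof
    assume "I1 = N"
    then have "s (Q (s v)) = 0" for v using s'(2,3) by (auto simp: I1_def)
    then have "0 = tr (\<lambda>v. s (Q (s v)))" by (simp add: tr_zero)
    also have "\<dots> = tr (\<lambda>v. s (P (s v)))" unfolding Q_def by (rule tr_degree_part_conj[OF s'(1) sg P])
    also have "(\<lambda>v. s (P (s v))) = (\<lambda>v. \<Sum>c\<in>C. ad_sub s c (ad_sub s (b c) v))"
    proof
      fix v
      have "s (P (s v)) = s (\<Gamma> (s v))"
        using s'(3)[OF P\<Gamma>[OF s'(2)[of v]]] by (simp add: endo_simps[OF s'(1)])
      also have "\<dots> = (\<Sum>c\<in>C. s (bracket c (bracket (b c) (s v))))"
        by (simp add: \<Gamma>_def endo_simps[OF s'(1)])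
      also have "\<dots> = (\<Sum>c\<in>C. ad_sub s c (ad_sub s (b c) v))"
      proof (intro sum.cong refl)
        fix c assume c: "c \<in> C"
        let ?u = "bracket (b c) (s v)"
        have "?u - s ?u \<in> W" using brN[OF CK(2)[OF c] s'(2)] by (rule s'(4))
        from s'(3)[OF brW[OF CK(1)[OF c] this]]
        show "s (bracket c ?u) = ad_sub s c (ad_sub s (b c) v)"
          by (simp add: ad_sub_def s'(5) bracket_simps endo_simps[OF s'(1)])
      qed
      finally show "s (P (s v)) = (\<Sum>c\<in>C. ad_sub s c (ad_sub s (b c) v))" .
    qed
    also have "tr \<dots> = (\<Sum>c\<in>C. \<gamma> c (b c))" by (simp add: tr_sum \<gamma>_def trace_form_def)
    also have "\<dots> = of_nat (card C)" using C(4) sym_form_sym[OF sym\<gamma>] by simp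
    finally have "card C = 0" by simp
    then show False using C(1) \<open>C \<noteq> {}\<close> by simp
  qed
  ultimately have I1W: "I1 = W" by blast
  have surj: "\<exists>n\<in>N. Q (k - n) \<in> W" if k: "k \<in> K" for k
  proof -
    \<comment> \<open>The operator induced by \<open>Q\<close> on the model of \<open>N / W\<close>,
      extended by the identity on the kernel of \<open>s\<close>, so that injectivity gives
      surjectivity.\<close>
    define T where "T v = s (Q (s v)) + (v - s v)" for v
    have T: "endo T" unfolding T_def
      by (rule endoI) (simp_all add: endo_simps[OF Q] endo_simps[OF s'(1)] scale_right_distrib
          scale_right_diff_distrib)
    have sT: "s (T v) = s (Q (s v))" for v by (simp add: T_def endo_simps[OF s'(1)] s'(5))
    have "inj T"
    proof (rule injI)
      fix x y assume "T x = T y"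
      then have z: "T (x - y) = 0" by (simp add: endo_simps[OF T])
      define v where "v = x - y"
      have sQ: "s (Q (s v)) = 0" using sT[of v] z endo_0[OF s'(1)] by (simp add: v_def)
      then have "Q (s v) \<in> W" using s0 QN s'(2) NK by blast
      then have "s v \<in> W" using s'(2) I1W by (auto simp: I1_def)
      then have "s v = 0" using s'(3)[of "s v"] s'(5) by simp
      then show "x = y" using z sQ by (simp add: T_def v_def)
    qed
    then have "surj T" using linear_inj_imp_surj[OF T] by blast
    then obtain v where "T v = Q k" by (metis surjD)
    then have sQ: "s (Q k - Q (s v)) = 0" using sT[of v] by (simp add: endo_simps[OF s'(1)])
    have "Q k - Q (s v) \<in> N" using QN k s'(2) NK subN by (intro subspace_diff) auto
    then have "Q (k - s v) \<in> W" using s0[OF _ sQ] by (simp add: endo_simps[OF Q])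
    then show ?thesis using s'(2) by blast
  qed
  define K' where "K' = {x \<in> K. Q x \<in> W}"
  have subK': "subspace K'"
  proof -
    have "K' = K \<inter> {n. Q n \<in> W}" by (auto simp: K'_def)
    then show ?thesis using subspace_inter[OF subK subspace_preimage[OF Q subW]] by simp
  qed
  have "bracket x y \<in> K'" if xy: "x \<in> K'" "y \<in> K'" for x y
  proof -
    have xy': "x \<in> K" "y \<in> K" "Q x \<in> W" "Q y \<in> W" using xy by (auto simp: K'_def)
    have 1: "bracket x (Q y) \<in> W" using brW xy' by blast
    have 2: "bracket (Q x) y \<in> W" using lie_ideal_bracket2[OF W(1)] xy' by blast
    have "Q (bracket x y) \<in> W"
      using subspace_add[OF subW subspace_add[OF subW Q_deriv[OF xy'(1,2)] 2] 1] by simp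
    then show ?thesis using brK xy' by (simp add: K'_def)
  qed
  then have "lie_subalgebra K'" using subK' by (simp add: lie_subalgebra_def)
  moreover have "graded K'"
    using subK' hpK hpW by (auto simp: graded_iff K'_def hpQ[symmetric])
  moreover have "K' \<subset> K"
  proof -
    have "\<not> N \<subseteq> K'" using W(4) I1W by (auto simp: K'_def I1_def)
    then show ?thesis using NK by (auto simp: K'_def)
  qed
  moreover have "\<exists>k\<in>K'. x - k \<in> R" for x
  proof -
    obtain k where k: "k \<in> K" "x - k \<in> R" using K(3) by blast
    obtain n where n: "n \<in> N" "Q (k - n) \<in> W" using surj[OF k(1)] by blast
    have "k - n \<in> K'" using k n NK subK by (auto simp: K'_def intro: subspace_diff)
    moreover have "x - (k - n) \<in> R"
      using subspace_add[OF subspace_R k(2), of n] n by (simp add: N_def algebra_simps)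
    ultimately show ?thesis by blast
  qed
  ultimately show ?thesis by blast
qed

end

context fd_lie_algebra
begin

lemma dim_less_of_psubset: "subspace U \<Longrightarrow> subspace V \<Longrightarrow> U \<subset> V \<Longrightarrow> dim U < dim V"
  using subspace_dim_equal[of U V] dim_subset[of U V] by (metis linorder_not_le order_le_less psubset_eq)

lemma maximal_dim_exists:
  assumes "P U" shows "\<exists>V. P V \<and> (\<forall>U. P U \<longrightarrow> dim U \<le> dim V)"
proof -
  have "\<forall>V. P V \<longrightarrow> dim V < Suc (card Basis)"
    using dim_subset_UNIV by (simp add: dimension_def less_Suc_eq_le)
  then show ?thesis using ex_has_greatest_nat[of P U dim] assms by blast
qed

lemma internal_direct_sum_insert:
  assumes ds: "internal_direct_sum {1..m} H J'" and I: "subspace I" "I \<inter> J' = {0}"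
  shows "internal_direct_sum {1..Suc m} (H(Suc m := I)) {x + y |x y. x \<in> I \<and> y \<in> J'}"
  unfolding internal_direct_sum_def
proof (intro conjI allI impI)
  let ?H = "H(Suc m := I)"
  have H: "\<And>i. i \<in> {1..m} \<Longrightarrow> subspace (H i)" and J': "J' = span (\<Union>i\<in>{1..m}. H i)"
    and ind: "\<And>S x. finite S \<Longrightarrow> S \<subseteq> {1..m} \<Longrightarrow> \<forall>j\<in>S. x j \<in> H j \<Longrightarrow> (\<Sum>j\<in>S. x j) = 0 \<Longrightarrow> \<forall>j\<in>S. x j = 0"
    using ds unfolding internal_direct_sum_def by blast+
  show "\<forall>i\<in>{1..Suc m}. subspace (?H i)" using H I by auto
  have "(\<Union>i\<in>{1..Suc m}. ?H i) = I \<union> (\<Union>i\<in>{1..m}. H i)"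
    by (auto simp: atLeastAtMostSuc_conv)
  then show "{x + y |x y. x \<in> I \<and> y \<in> J'} = span (\<Union>i\<in>{1..Suc m}. ?H i)"
    using I(1) span_eq_iff[THEN iffD2, OF I(1)] unfolding J' by (simp only: span_Un)
  fix S x assume S: "finite S \<and> S \<subseteq> {1..Suc m} \<and> (\<forall>j\<in>S. x j \<in> ?H j) \<and> (\<Sum>j\<in>S. x j) = 0"
  define S' where "S' = S - {Suc m}"
  have S': "finite S'" "S' \<subseteq> {1..m}" using S by (auto simp: S'_def atLeastAtMostSuc_conv)
  have "x j \<in> H j" if "j \<in> S'" for j
  proof -
    have "x j \<in> ?H j" "j \<noteq> Suc m" using S that by (auto simp: S'_def)
    then show ?thesis by simp
  qed
  then have S'': "\<forall>j\<in>S'. x j \<in> H j" by blast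
  have J's: "(\<Sum>j\<in>S'. x j) \<in> J'" unfolding J' using S'(2) S'' by (intro span_sum span_base) blast
  show "\<forall>j\<in>S. x j = 0"
  proof (cases "Suc m \<in> S")
    case True
    then have sum: "x (Suc m) + (\<Sum>j\<in>S'. x j) = 0" 
      using S sum.remove[of S "Suc m" x] by (simp add: S'_def)
    then have "x (Suc m) = - (\<Sum>j\<in>S'. x j)" by (simp add: eq_neg_iff_add_eq_0)
    then have "x (Suc m) \<in> J'" using J's unfolding J' by (simp add: span_neg)
    moreover have "x (Suc m) \<in> I" using S True by fastforce
    ultimately have "x (Suc m) = 0" using I(2) by blast
    moreover from this have "\<forall>j\<in>S'. x j = 0" using ind[OF S' S''] sum by simp
    ultimately show ?thesis by (auto simp: S'_def)
  next
    case False
    then have "S' = S" by (auto simp: S'_def)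
    then show ?thesis using ind[OF S' S''] S by simp
  qed
qed

end

context fd_graded_lie_algebra
begin

section \<open>Semisimple graded subalgebras\<close>

lemma comp_disjoint: "g \<in> carrier G \<Longrightarrow> h \<in> carrier G \<Longrightarrow> g \<noteq> h \<Longrightarrow> x \<in> comp g \<Longrightarrow> x \<in> comp h \<Longrightarrow> x = 0"
  using hp_comp[of g g x] hp_comp[of g h x] by simp

text \<open>
  Fix \<open>g\<close> in the support. The elements supported on the centralizer of \<open>g\<close> and annihilated by
  all components outside that centralizer form a graded ideal containing the component of degree \<open>g\<close>,
  because \<open>[x, y] = - [y, x]\<close> lies in two different components when the degrees do not commute.
\<close>

lemma graded_simple_support:
  assumes H: "graded_simple H" shows "commutative_subset G (support H)"
  unfolding commutative_subset_def
proof (intro ballI)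
  have subH: "subspace H" and brH: "\<And>x y. x \<in> H \<Longrightarrow> y \<in> H \<Longrightarrow> bracket x y \<in> H" and grH: "graded H"
    and min: "\<And>I. lie_ideal H I \<Longrightarrow> graded I \<Longrightarrow> I = {0} \<or> I = H"
    using H by (auto simp: graded_simple_def lie_subalgebra_def)
  have hpH: "hp k x \<in> H" if "x \<in> H" "k \<in> carrier G" for x k using grH that by (simp add: graded_iff)
  fix g h assume "g \<in> support H" "h \<in> support H"
  then have g: "g \<in> carrier G" "H \<inter> comp g \<noteq> {0}" and h: "h \<in> carrier G" "H \<inter> comp h \<noteq> {0}"
    by (auto simp: support_def)
  define Z where "Z = centralizer {g}"
  have subZ: "subgroup Z G" unfolding Z_def by (rule subgroup_centralizer) (use g in simp)
  note Zmult = subgroup.m_closed[OF subZ] and Zinv = subgroup.m_inv_closed[OF subZ]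
  define W where "W = {w \<in> H. (\<forall>t\<in>carrier G - Z. hp t w = 0) \<and>
      (\<forall>k\<in>carrier G - Z. \<forall>x\<in>H \<inter> comp k. bracket x w = 0)}"
  have subW: "subspace W"
    unfolding W_def by (rule subspaceI)
      (use subH in \<open>auto simp: subspace_0 subspace_add subspace_scale bracket_simps endo_simps[OF endo_hp]\<close>)
  \<comment> \<open>For \<open>k\<close> outside \<open>Z\<close> the bracket vanishes by the choice
    of \<open>W\<close>. For \<open>k\<close> in \<open>Z\<close>, multiplication by
    \<open>k\<close> maps degrees outside the subgroup \<open>Z\<close> to such degrees, so both
    conditions persist.\<close>
  have homog: "bracket x w \<in> W" if x: "x \<in> H" "x \<in> comp k" "k \<in> carrier G" and w: "w \<in> W" for x w k
  proof (cases "k \<in> Z")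
    case False
    then show ?thesis using x w subspace_0[OF subW] by (auto simp: W_def)
  next
    case True
    have wH: "w \<in> H" using w by (simp add: W_def)
    have "hp t (bracket x w) = 0" if t: "t \<in> carrier G - Z" for t
    proof -
      have "inv k \<otimes> t \<notin> Z"
      proof
        assume "inv k \<otimes> t \<in> Z"
        then have "k \<otimes> (inv k \<otimes> t) \<in> Z" by (rule Zmult[OF True])
        then show False using t x(3) by (simp add: m_assoc[symmetric])
      qed
      then have "hp (inv k \<otimes> t) w = 0" using w t x(3) by (simp add: W_def)
      then show ?thesis using hp_bracket_left[OF x(3) _ x(2), of t w] t by (simp add: bracket_0)
    qed
    moreover have "bracket y (bracket x w) = 0" if y: "y \<in> H \<inter> comp l" and l: "l \<in> carrier G - Z" for y l
    proof -
      have "l \<otimes> k \<notin> Z"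
      proof
        assume "l \<otimes> k \<in> Z"
        then have "(l \<otimes> k) \<otimes> inv k \<in> Z" using Zmult Zinv True by blast
        then show False using l x(3) by (simp add: m_assoc)
      qed
      moreover have "bracket y x \<in> H \<inter> comp (l \<otimes> k)"
        using y l x brH by (auto intro: bracket_comp)
      ultimately have "bracket (bracket y x) w = 0" using w l x(3) by (auto simp: W_def)
      moreover have "bracket y w = 0" using w y l by (auto simp: W_def)
      ultimately show ?thesis by (simp add: bracket_bracket[of y x w] bracket_0)
    qed
    ultimately show ?thesis using brH[OF x(1) wH] by (auto simp: W_def)
  qed
  have "lie_ideal H W"
    unfolding lie_ideal_def
  proof (intro conjI ballI)
    show "subspace W" by (rule subW)
    show "W \<subseteq> H" by (auto simp: W_def)
    fix x w assume xw: "x \<in> H" "w \<in> W"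
    have "bracket x w = (\<Sum>k\<in>carrier G. bracket (hp k x) w)" by (simp add: bracket_sum(1)[symmetric] sum_hp)
    also have "\<dots> \<in> W" using xw by (intro subspace_sum[OF subW] homog[OF hpH hp_in_comp])
    finally show "bracket x w \<in> W" .
  qed
  moreover have "graded W"
    unfolding graded_iff
  proof (intro conjI ballI)
    show "subspace W" by (rule subW)
    fix w s assume w: "w \<in> W" and s: "s \<in> carrier G"
    have "bracket x (hp s w) = 0" if x: "x \<in> H \<inter> comp k" and k: "k \<in> carrier G - Z" for x k
    proof -
      have "bracket x (hp s w) = hp (k \<otimes> s) (bracket x w)"
        using hp_bracket_left[of k "k \<otimes> s" x w] x k s by (simp add: m_assoc[symmetric])
      then show ?thesis using w x k s by (auto simp: W_def endo_0[OF endo_hp])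
    qed
    then show "hp s w \<in> W" using w s hpH by (auto simp: W_def hp_hp)
  qed
  ultimately have "W = {0} \<or> W = H" by (rule min)
  moreover have "H \<inter> comp g \<subseteq> W"
  proof
    fix w assume w: "w \<in> H \<inter> comp g"
    have gZ: "g \<in> Z" using g by (simp add: Z_def centralizer_def)
    have "bracket x w = 0" if x: "x \<in> H \<inter> comp k" and k: "k \<in> carrier G - Z" for x k
    proof (rule comp_disjoint)
      show "k \<otimes> g \<in> carrier G" "g \<otimes> k \<in> carrier G" "k \<otimes> g \<noteq> g \<otimes> k" using k g by (auto simp: Z_def centralizer_def)
      show "bracket x w \<in> comp (k \<otimes> g)" using x k w g by (intro bracket_comp) auto
      have "bracket w x \<in> comp (g \<otimes> k)" using x k w g by (intro bracket_comp) auto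
      then show "bracket x w \<in> comp (g \<otimes> k)" using bracket_in_sym subspace_comp k g by blast
    qed
    moreover have "hp t w = 0" if "t \<in> carrier G - Z" for t
      using hp_comp[of t g w] that gZ g w by auto
    ultimately show "w \<in> W" using w by (auto simp: W_def)
  qed
  ultimately have WH: "W = H" using g(2) subspace_0[OF subH] subspace_0[OF subspace_comp[OF g(1)]] by blast
  obtain x where x: "x \<in> H" "x \<in> comp h" "x \<noteq> 0"
    using h subspace_0[OF subH] subspace_0[OF subspace_comp[OF h(1)]] by blast
  then have "hp h x \<noteq> 0" using in_comp_iff[OF h(1)] by simp
  then have "h \<in> Z" using x(1) WH h(1) by (auto simp: W_def)
  then show "g \<otimes> h = h \<otimes> g" by (simp add: Z_def centralizer_def)
qed

end

context levi_data
begin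

text \<open>A nonzero \<open>N\<close> is solvable, so \<open>[N, N]\<close> is proper, and a graded
  ideal \<open>W\<close> of largest dimension between it and \<open>N\<close> makes
  \<open>N / W\<close> graded-irreducible with \<open>N\<close> acting trivially. Either reduction
  step then contradicts the minimality of \<open>K\<close>.\<close>

lemma levi_complement_exists:
  "\<exists>B. lie_subalgebra B \<and> graded B \<and> B \<inter> R = {0} \<and> (\<forall>x. \<exists>k\<in>B. x - k \<in> R)"
proof -
  define P where "P K \<longleftrightarrow> lie_subalgebra K \<and> graded K \<and> (\<forall>x. \<exists>k\<in>K. x - k \<in> R)" for K
  have "\<exists>k\<in>UNIV. x - k \<in> R" for x
    by (rule bexI[of _ x]) (simp_all add: subspace_0[OF subspace_R])
  then have "P UNIV" using graded_UNIV by (simp add: P_def lie_subalgebra_def)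
  then obtain K where K: "P K" "\<And>K'. P K' \<Longrightarrow> dim K \<le> dim K'" using ex_has_least_nat[of P UNIV dim] by blast
  have K': "lie_subalgebra K" "graded K" "\<And>x. \<exists>k\<in>K. x - k \<in> R" using K(1) by (auto simp: P_def)
  have subK: "subspace K" and brK: "\<And>x y. x \<in> K \<Longrightarrow> y \<in> K \<Longrightarrow> bracket x y \<in> K"
    using K' by (auto simp: lie_subalgebra_def)
  define N where "N = K \<inter> R"
  have idN: "lie_ideal K N"
    unfolding N_def lie_ideal_def using subK subspace_R brK bracket_R by (auto intro: subspace_inter)
  have grN: "graded N" unfolding N_def by (rule graded_Int[OF K'(2) graded_R])
  note subalgN = lie_ideal_subalgebra[OF idN]
  have "N = {0}"
  proof (rule ccontr)
    assume "N \<noteq> {0}"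
    have "solvable N" using solvable_subset[OF subalgN _ solvable_R] by (simp add: N_def)
    then have "\<not> perfect N" using perfect_subset_solvable[of N N] \<open>N \<noteq> {0}\<close> by blast
    define M where "M = bracket_space N N"
    have "M \<noteq> N" using \<open>\<not> perfect N\<close> subalgN by (simp add: perfect_def M_def)
    moreover have "M \<subseteq> N" using derived_Suc_subset[OF subalgN, of 0] by (simp add: M_def)
    moreover have "lie_ideal K M" "graded M"
      unfolding M_def using lie_ideal_bracket_space[OF idN idN] graded_bracket_space[OF grN grN] by auto
    ultimately have "lie_ideal K M \<and> graded M \<and> M \<subseteq> M \<and> M \<subset> N" by blast
    then obtain W where W: "lie_ideal K W \<and> graded W \<and> M \<subseteq> W \<and> W \<subset> N"
      and Wdim: "\<And>I. lie_ideal K I \<and> graded I \<and> M \<subseteq> I \<and> I \<subset> N \<Longrightarrow> dim I \<le> dim W"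
      using maximal_dim_exists[of "\<lambda>I. lie_ideal K I \<and> graded I \<and> M \<subseteq> I \<and> I \<subset> N" M] by blast
    have Wmax: "I = W \<or> I = N" if I: "lie_ideal K I" "graded I" "W \<subseteq> I" "I \<subseteq> N" for I
    proof (rule ccontr)
      assume n: "\<not> (I = W \<or> I = N)"
      then have "dim I \<le> dim W" using I W by (intro Wdim) blast
      moreover have "dim W < dim I" using n I W by (intro dim_less_of_psubset) (auto simp: lie_ideal_def)
      ultimately show False by simp
    qed
    have NN: "bracket m n \<in> W" if "m \<in> N" "n \<in> N" for m n
      using bracket_spaceI[OF that] W by (auto simp: M_def)
    have "\<exists>K'. lie_subalgebra K' \<and> graded K' \<and> K' \<subset> K \<and> (\<forall>x. \<exists>k\<in>K'. x - k \<in> R)"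
    proof (cases "\<exists>x\<in>K. \<exists>n\<in>N. bracket x n \<notin> W")
      case True
      show ?thesis
        by (rule levi_step_irreducible[OF K' N_def, of W]) (use W NN Wmax True in auto)
    next
      case False
      show ?thesis
        by (rule levi_step_central[OF K', of W]) (use W False in \<open>auto simp: N_def\<close>)
    qed
    then obtain K'' where K'': "P K''" "K'' \<subset> K" by (auto simp: P_def)
    then have "dim K'' < dim K" using subK by (intro dim_less_of_psubset) (auto simp: P_def lie_subalgebra_def)
    then show False using K(2)[OF K''(1)] by simp
  qed
  then show ?thesis using K' unfolding N_def by blast
qed

end

section \<open>Ideals of a graded Levi complement\<close>

locale levi_complement = levi_data scale bracket G comp Basis R q
  for scale :: "'k::{alg_closed_field, field_char_0} \<Rightarrow> 'a::ab_group_add \<Rightarrow> 'a"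
    and bracket :: "'a \<Rightarrow> 'a \<Rightarrow> 'a" and G :: "('g, 'm) monoid_scheme" (structure)
    and comp :: "'g \<Rightarrow> 'a set" and Basis and R :: "'a set" and q :: "'a \<Rightarrow> 'a" +
  fixes B :: "'a set"
  assumes subalgebra_B: "lie_subalgebra B" and graded_B: "graded B" and B_Int_R: "B \<inter> R = {0}"
    and B_supplement: "\<And>x. \<exists>k\<in>B. x - k \<in> R"
begin

lemma subspace_B: "subspace B" and bracket_B: "x \<in> B \<Longrightarrow> y \<in> B \<Longrightarrow> bracket x y \<in> B"
  using subalgebra_B by (auto simp: lie_subalgebra_def)

lemma solvable_ideal_B: "lie_ideal B I \<Longrightarrow> solvable I \<Longrightarrow> I = {0}"
  using solvable_ideal_supplement[OF B_supplement, of I] B_Int_R subspace_0[of I]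
  by (auto simp: lie_ideal_def)

lemma semisimple_B: "semisimple_subalgebra B"
  unfolding semisimple_subalgebra_def solvable_radical_def
  using subalgebra_B solvable_zero solvable_ideal_B subspace_0[OF subspace_B]
  by (auto simp: lie_ideal_def bracket_0)

text \<open>A larger semisimple subalgebra meets \<open>R\<close> in a solvable ideal, hence in
  zero, while its elements differ from those of \<open>B\<close> by elements of this
  intersection.\<close>

lemma levi_B: "levi_subalgebra B"
  unfolding levi_subalgebra_def
proof (intro conjI allI impI semisimple_B)
  fix C assume C: "semisimple_subalgebra C \<and> B \<subseteq> C"
  then have subC: "subspace C" and brC: "\<And>x y. x \<in> C \<Longrightarrow> y \<in> C \<Longrightarrow> bracket x y \<in> C"
    and radC: "\<And>I. lie_ideal C I \<Longrightarrow> solvable I \<Longrightarrow> I \<subseteq> {0}"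
    by (auto simp: semisimple_subalgebra_def lie_subalgebra_def solvable_radical_def)
  have id: "lie_ideal C (C \<inter> R)"
    unfolding lie_ideal_def using subC subspace_R brC bracket_R by (auto intro: subspace_inter)
  have "C \<inter> R \<subseteq> {0}"
    using radC[OF id] solvable_subset[OF lie_ideal_subalgebra[OF id] _ solvable_R] by simp
  have "C \<subseteq> B"
  proof
    fix x assume x: "x \<in> C"
    obtain k where k: "k \<in> B" "x - k \<in> R" using B_supplement by blast
    then have "x - k \<in> C \<inter> R" using x C subC by (auto intro: subspace_diff)
    then show "x \<in> B" using k \<open>C \<inter> R \<subseteq> {0}\<close> by auto
  qed
  then show "C = B" using C by blast
qed

text \<open>Brackets within \<open>I \<inter> perp \<kappa> I\<close> are orthogonal to
  \<open>B\<close> by invariance, hence in \<open>R\<close>; the intersection is therefore a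
  solvable ideal of \<open>B\<close>.\<close>

lemma ideal_Int_perp:
  assumes I: "lie_ideal B I" shows "lie_ideal B (B \<inter> perp \<kappa> I)" "I \<inter> perp \<kappa> I = {0}"
proof -
  have subI: "subspace I" "I \<subseteq> B" and brI: "\<And>x y. x \<in> B \<Longrightarrow> y \<in> I \<Longrightarrow> bracket x y \<in> I"
    using I by (auto simp: lie_ideal_def)
  show id: "lie_ideal B (B \<inter> perp \<kappa> I)"
    unfolding lie_ideal_def
  proof (intro conjI ballI)
    show sub: "subspace (B \<inter> perp \<kappa> I)" by (rule subspace_inter[OF subspace_B subspace_perp[OF sym_\<kappa>]])
    fix y x assume y: "y \<in> B" and x: "x \<in> B \<inter> perp \<kappa> I"
    have "\<kappa> (bracket x y) z = 0" if "z \<in> I" for z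
      using \<kappa>_invariant[of x y z] brI[OF y that] x by (simp add: perp_def)
    then have "bracket x y \<in> B \<inter> perp \<kappa> I" using bracket_B x y by (auto simp: perp_def)
    then show "bracket y x \<in> B \<inter> perp \<kappa> I" using bracket_in_sym[OF sub] by blast
  qed simp
  let ?A = "I \<inter> perp \<kappa> I"
  have A: "?A = I \<inter> (B \<inter> perp \<kappa> I)" using subI by blast
  have idA: "lie_ideal B ?A" unfolding A by (rule lie_ideal_Int[OF I id])
  have "bracket x y \<in> R" if xy: "x \<in> ?A" "y \<in> ?A" for x y
  proof -
    have "\<kappa> (bracket x y) z = 0" if z: "z \<in> B" for z
      using \<kappa>_invariant[of x y z] lie_ideal_bracket2[OF I _ z, of y] xy by (simp add: perp_def)
    then show ?thesis using perp_supplement[OF B_supplement] by (auto simp: perp_def)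
  qed
  then have "bracket_space ?A ?A \<subseteq> R" by (intro bracket_space_subset[OF subspace_R])
  then have "J \<subseteq> R" if "perfect J" "J \<subseteq> ?A" for J
    using that bracket_space_mono[of J ?A J ?A] by (auto simp: perfect_def)
  then have "solvable ?A" by (intro solvable_of_perfect_R lie_ideal_subalgebra[OF idA])
  then show "?A = {0}" by (rule solvable_ideal_B[OF idA])
qed

lemma ideal_complement:
  assumes I: "lie_ideal B I" and x: "x \<in> B"
  obtains d where "d \<in> I" "x - d \<in> B \<inter> perp \<kappa> I"
proof (rule orthogonal_decomposition[OF sym_\<kappa> _ _ x, of I])
  show "subspace I" using I by (simp add: lie_ideal_def)
  show "\<kappa> y n = 0" if "y \<in> B" "n \<in> I \<inter> perp \<kappa> I" for y n
    using that(2) ideal_Int_perp(2)[OF I] sym_form_right(3)[OF sym_\<kappa>] by auto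
  fix d assume "d \<in> I" "x - d \<in> perp \<kappa> I"
  then show thesis using that I x subspace_B by (auto simp: lie_ideal_def intro: subspace_diff)
qed

text \<open>The orthogonal ideal of \<open>H\<close> centralizes \<open>H\<close>, so every element
  of \<open>B\<close> acts on \<open>H\<close> like an element of \<open>H\<close>.\<close>

lemma ideal_of_ideal:
  assumes H: "lie_ideal B H" and I: "lie_ideal H I" shows "lie_ideal B I"
  unfolding lie_ideal_def
proof (intro conjI ballI)
  show "subspace I" "I \<subseteq> B" using H I by (auto simp: lie_ideal_def)
  fix x y assume x: "x \<in> B" and y: "y \<in> I"
  then have yH: "y \<in> H" "y \<in> B" using H I by (auto simp: lie_ideal_def)
  obtain d where d: "d \<in> H" "x - d \<in> B \<inter> perp \<kappa> H" by (rule ideal_complement[OF H x])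
  have "bracket (x - d) y \<in> H" using H d(2) yH by (auto simp: lie_ideal_def)
  moreover have "bracket (x - d) y \<in> B \<inter> perp \<kappa> H"
    by (rule lie_ideal_bracket2[OF ideal_Int_perp(1)[OF H] d(2) yH(2)])
  ultimately have "bracket (x - d) y = 0" using ideal_Int_perp(2)[OF H] by blast
  then have "bracket x y = bracket d y" by (simp add: bracket_simps)
  then show "bracket x y \<in> I" using I d(1) y by (simp add: lie_ideal_def)
qed

text \<open>
  The predicate \<open>Q\<close> allows to treat ideals and graded ideals at the same time.
\<close>

lemma ideal_decomposition:
  assumes Q: "\<And>I J. Q I \<Longrightarrow> Q J \<Longrightarrow> Q (J \<inter> perp \<kappa> I)" and J: "lie_ideal B J" "Q J"
  shows "\<exists>m H. lie_direct_sum {1..m::nat} H J \<and> (\<forall>i\<in>{1..m}. lie_ideal B (H i) \<and> Q (H i) \<and> H i \<noteq> {0} \<and>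
    (\<forall>I. lie_ideal (H i) I \<and> Q I \<longrightarrow> I = {0} \<or> I = H i))"
  using J
proof (induction "dim J" arbitrary: J rule: less_induct)
  case less
  have subJ: "subspace J" "J \<subseteq> B" using less.prems by (auto simp: lie_ideal_def)
  show ?case
  proof (cases "J = {0}")
    case True
    then have "lie_direct_sum {1..0::nat} (\<lambda>_. {0}) J"
      by (simp add: lie_direct_sum_def internal_direct_sum_def)
    then show ?thesis by (intro exI[of _ 0] exI[of _ "\<lambda>_. {0}"]) simp
  next
    case False
    let ?P = "\<lambda>I. lie_ideal B I \<and> Q I \<and> I \<subseteq> J \<and> I \<noteq> {0}"
    obtain I where I: "?P I" and min: "\<And>I'. ?P I' \<Longrightarrow> dim I \<le> dim I'"
      using ex_has_least_nat[of ?P J dim] less.prems False by blast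
    have subI: "subspace I" using I by (simp add: lie_ideal_def)
    have idI: "lie_ideal B I" using I by blast
    define J' where "J' = J \<inter> perp \<kappa> I"
    have "J' = J \<inter> (B \<inter> perp \<kappa> I)" using subJ by (auto simp: J'_def)
    then have idJ': "lie_ideal B J'" using lie_ideal_Int[OF less.prems(1) ideal_Int_perp(1)[OF idI]] by simp
    have QJ': "Q J'" unfolding J'_def using Q I less.prems(2) by blast
    have IJ': "I \<inter> J' = {0}"
      using ideal_Int_perp(2)[OF idI] subspace_0[OF subI] idJ' subspace_0[of J'] 
      by (auto simp: J'_def lie_ideal_def)
    have "J' \<subset> J" using IJ' I by (auto simp: J'_def)
    then have "dim J' < dim J" using idJ' subJ(1) by (intro dim_less_of_psubset) (auto simp: lie_ideal_def)
    from less.hyps[OF this idJ' QJ'] obtain m :: nat and H where ds: "lie_direct_sum {1..m} H J'"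
      and H: "\<forall>i\<in>{1..m}. lie_ideal B (H i) \<and> Q (H i) \<and> H i \<noteq> {0} \<and>
        (\<forall>I. lie_ideal (H i) I \<and> Q I \<longrightarrow> I = {0} \<or> I = H i)" by blast
    have HJ': "H i \<subseteq> J'" if "i \<in> {1..m}" for i
    proof -
      have "H i \<subseteq> span (\<Union>i\<in>{1..m}. H i)" using that by (blast intro: span_base)
      then show ?thesis using ds by (simp add: lie_direct_sum_def internal_direct_sum_def)
    qed
    have J: "J = {x + y |x y. x \<in> I \<and> y \<in> J'}"
    proof
      show "{x + y |x y. x \<in> I \<and> y \<in> J'} \<subseteq> J"
        using I subJ(1) by (auto simp: J'_def intro: subspace_add)
      show "J \<subseteq> {x + y |x y. x \<in> I \<and> y \<in> J'}"
      proof
        fix x assume x: "x \<in> J"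
        then obtain d where d: "d \<in> I" "x - d \<in> B \<inter> perp \<kappa> I"
          using ideal_complement[OF idI, of x] subJ(2) by blast
        then have "x - d \<in> J'" using x I subJ(1) by (auto simp: J'_def intro: subspace_diff)
        moreover have "x = d + (x - d)" by simp
        ultimately show "x \<in> {x + y |x y. x \<in> I \<and> y \<in> J'}" using d(1) by blast
      qed
    qed
    have comm: "bracket x y = 0" "bracket y x = 0" if "x \<in> I" "y \<in> J'" for x y
    proof -
      have "bracket x y \<in> I" "bracket x y \<in> J'"
        using that idI idJ' lie_ideal_bracket2[OF idI] by (auto simp: lie_ideal_def)
      then show "bracket x y = 0" using IJ' by blast
      then show "bracket y x = 0" using bracket_anticomm[of y x] by simp
    qed
    let ?H = "H(Suc m := I)"
    have ints: "{1..Suc m} = insert (Suc m) {1..m}" by auto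
    have "lie_direct_sum {1..Suc m} ?H J"
      unfolding lie_direct_sum_def
    proof (intro conjI ballI impI)
      show "internal_direct_sum {1..Suc m} ?H J"
        unfolding J using ds subI IJ' by (intro internal_direct_sum_insert) (auto simp: lie_direct_sum_def)
      show "lie_subalgebra (?H i)" if "i \<in> {1..Suc m}" for i
        using that ds lie_ideal_subalgebra[OF idI] by (auto simp: lie_direct_sum_def ints)
      show "bracket x y = 0" if "i \<in> {1..Suc m}" "j \<in> {1..Suc m}" "i \<noteq> j" "x \<in> ?H i" "y \<in> ?H j" for i j x y
        using that ds comm HJ' unfolding lie_direct_sum_def ints
        by (cases "i = Suc m"; cases "j = Suc m") (auto simp: subset_iff)
    qed
    \<comment> \<open>Ideals of \<open>I\<close> are ideals of \<open>B\<close>, so they compete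
      with \<open>I\<close> for the least dimension.\<close>
    moreover have "I' = {0} \<or> I' = I" if I': "lie_ideal I I'" "Q I'" for I'
    proof (rule ccontr)
      assume n: "\<not> (I' = {0} \<or> I' = I)"
      then have "?P I'" using ideal_of_ideal[OF idI I'(1)] I' I by (auto simp: lie_ideal_def)
      then have "dim I \<le> dim I'" by (rule min)
      moreover have "dim I' < dim I"
        using n I' subI by (intro dim_less_of_psubset) (auto simp: lie_ideal_def)
      ultimately show False by simp
    qed
    ultimately show ?thesis using H I
      by (intro exI[of _ "Suc m"] exI[of _ ?H]) (auto simp: ints)
  qed
qed

lemma ideal_not_abelian:
  assumes "lie_ideal B H" "H \<noteq> {0}" shows "bracket_space H H \<noteq> {0}"
proof
  assume "bracket_space H H = {0}"
  then have "derived 1 H = {0}" by simp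
  then have "solvable H" unfolding solvable_def by (rule exI[of _ 1])
  then show False using solvable_ideal_B[OF assms(1)] assms(2) by simp
qed

end

context fd_graded_lie_algebra
begin

section \<open>Twisting by characters\<close>

text \<open>The usual action of a character by automorphisms. A character of \<open>A\<close> is
  arbitrary off \<open>A\<close>, but on a subspace supported in \<open>A\<close> those values meet
  zero components only.\<close>

definition twist :: "('g \<Rightarrow> 'k) \<Rightarrow> 'a \<Rightarrow> 'a" where
  "twist \<chi> x = (\<Sum>g\<in>carrier G. scale (\<chi> g) (hp g x))"

lemma endo_twist: "endo (twist \<chi>)"
  unfolding twist_def[abs_def] by (rule endo_setsum, rule endo_scaled, rule endo_hp)

lemma hp_twist:
  assumes "g \<in> carrier G" shows "hp g (twist \<chi> x) = scale (\<chi> g) (hp g x)"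
proof -
  have "hp g (twist \<chi> x) = (\<Sum>h\<in>carrier G. if h = g then scale (\<chi> g) (hp g x) else 0)"
    unfolding twist_def endo_sum[OF endo_hp[OF assms]]
    by (rule sum.cong) (use assms in \<open>auto simp: endo_simps[OF endo_hp] hp_hp\<close>)
  then show ?thesis using assms finite_carrier by simp
qed

lemma twist_comp:
  assumes "g \<in> carrier G" "x \<in> comp g" shows "twist \<chi> x = scale (\<chi> g) x"
proof -
  have "twist \<chi> x = (\<Sum>h\<in>carrier G. if h = g then scale (\<chi> g) x else 0)"
    unfolding twist_def by (rule sum.cong) (use assms hp_comp in auto)
  then show ?thesis using assms finite_carrier by simp
qed

lemma twist_twist: "twist \<chi> (twist \<psi> x) = twist (\<lambda>g. \<chi> g * \<psi> g) x"
  by (simp add: twist_def[of \<chi>] twist_def[of "\<lambda>g. \<chi> g * \<psi> g"] hp_twist)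

lemma twist_one: "twist (\<lambda>_. 1) x = x"
  by (simp add: twist_def sum_hp)

lemma twist_in: "graded V \<Longrightarrow> x \<in> V \<Longrightarrow> twist \<chi> x \<in> V"
  unfolding twist_def by (rule subspace_sum) (auto simp: graded_iff subspace_scale)

context
  fixes H A
  assumes H: "graded H" and A: "subgroup A G" "support H \<subseteq> A" "commutative_subset G A"
begin

lemma hp_outside: "x \<in> H \<Longrightarrow> g \<in> carrier G \<Longrightarrow> g \<notin> A \<Longrightarrow> hp g x = 0"
  using A(2) H hp_in_comp[of g x] unfolding support_def graded_iff by blast

lemma twist_bracket:
  assumes \<chi>: "character A \<chi>" and xy: "x \<in> H" "y \<in> H"
  shows "twist \<chi> (bracket x y) = bracket (twist \<chi> x) (twist \<chi> y)"
proof -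
  have "twist \<chi> (bracket (hp g x) (hp h y)) = bracket (scale (\<chi> g) (hp g x)) (scale (\<chi> h) (hp h y))"
    if gh: "g \<in> carrier G" "h \<in> carrier G" for g h
  proof (cases "g \<in> A \<and> h \<in> A")
    case True
    have "bracket (hp g x) (hp h y) \<in> comp (g \<otimes> h)" using gh by (intro bracket_comp hp_in_comp)
    then have "twist \<chi> (bracket (hp g x) (hp h y)) = scale (\<chi> (g \<otimes> h)) (bracket (hp g x) (hp h y))"
      using gh by (intro twist_comp) auto
    then show ?thesis using True characterD(1)[OF \<chi>, of g h] by (simp add: bracket_simps)
  next
    case False
    then have "hp g x = 0 \<or> hp h y = 0" using hp_outside xy gh by blast
    then show ?thesis by (auto simp: bracket_0 endo_0[OF endo_twist])
  qed
  then have "(\<Sum>h\<in>carrier G. \<Sum>g\<in>carrier G. twist \<chi> (bracket (hp g x) (hp h y)))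
      = (\<Sum>h\<in>carrier G. \<Sum>g\<in>carrier G. bracket (scale (\<chi> g) (hp g x)) (scale (\<chi> h) (hp h y)))"
    by (intro sum.cong refl)
  also have "\<dots> = bracket (twist \<chi> x) (twist \<chi> y)" by (simp only: twist_def bracket_sum)
  also have "(\<Sum>h\<in>carrier G. \<Sum>g\<in>carrier G. twist \<chi> (bracket (hp g x) (hp h y)))
      = twist \<chi> (bracket (\<Sum>g\<in>carrier G. hp g x) (\<Sum>h\<in>carrier G. hp h y))"
    by (simp only: bracket_sum endo_sum[OF endo_twist])
  finally show ?thesis by (simp only: sum_hp)
qed

lemma twist_inverse:
  assumes \<chi>: "character A \<chi>" and x: "x \<in> H"
  shows "twist (\<lambda>g. inverse (\<chi> g)) (twist \<chi> x) = x" "twist \<chi> (twist (\<lambda>g. inverse (\<chi> g)) x) = x"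
proof -
  have "twist (\<lambda>g. \<chi> g * inverse (\<chi> g)) x = (\<Sum>g\<in>carrier G. hp g x)"
    unfolding twist_def
  proof (intro sum.cong refl)
    fix g assume g: "g \<in> carrier G"
    show "scale (\<chi> g * inverse (\<chi> g)) (hp g x) = hp g x"
      using hp_outside[OF x g] characterD(2)[OF \<chi>, of g] by (cases "g \<in> A") auto
  qed
  then show "twist (\<lambda>g. inverse (\<chi> g)) (twist \<chi> x) = x" "twist \<chi> (twist (\<lambda>g. inverse (\<chi> g)) x) = x"
    by (simp_all add: twist_twist sum_hp mult.commute)
qed

lemma twist_ideal:
  assumes \<chi>: "character A \<chi>" and S: "lie_ideal H S" shows "lie_ideal H (twist \<chi> ` S)"
  unfolding lie_ideal_def
proof (intro conjI ballI)
  have SH: "S \<subseteq> H" using S by (simp add: lie_ideal_def)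
  show "subspace (twist \<chi> ` S)" using S by (intro subspace_image endo_twist) (simp add: lie_ideal_def)
  show "twist \<chi> ` S \<subseteq> H" using SH twist_in[OF H] by blast
  fix y x assume y: "y \<in> H" and "x \<in> twist \<chi> ` S"
  then obtain s where s: "x = twist \<chi> s" "s \<in> S" by blast
  let ?y = "twist (\<lambda>g. inverse (\<chi> g)) y"
  have yH: "?y \<in> H" by (rule twist_in[OF H y])
  have "bracket y x = twist \<chi> (bracket ?y s)"
    using twist_bracket[OF \<chi> yH, of s] twist_inverse(2)[OF \<chi> y] s SH by auto
  moreover have "bracket ?y s \<in> S" using S yH s(2) by (simp add: lie_ideal_def)
  ultimately show "bracket y x \<in> twist \<chi> ` S" by blast
qed

text \<open>The component of degree \<open>g\<close> is isolated by removing the other degrees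
  \<open>h\<close> one at a time, each with a character that separates \<open>h\<close> from
  \<open>g\<close>.\<close>

lemma graded_if_twist_invariant:
  assumes V: "subspace V" "V \<subseteq> H" "\<And>\<chi> x. character A \<chi> \<Longrightarrow> x \<in> V \<Longrightarrow> twist \<chi> x \<in> V"
  shows "graded V"
  unfolding graded_iff
proof (intro conjI ballI V(1))
  fix x g assume x: "x \<in> V" and g: "g \<in> carrier G"
  show "hp g x \<in> V"
  proof (cases "g \<in> A")
    case False
    then show ?thesis using hp_outside V x g subspace_0[OF V(1)] by auto
  next
    case True
    have step: "hp g x \<in> V" if "finite X" "g \<notin> X" "X \<subseteq> carrier G" "x \<in> V"
      "\<forall>t\<in>carrier G - insert g X. hp t x = 0" for X x
      using that
    proof (induction X arbitrary: x rule: finite_induct)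
      case empty
      then have "(\<Sum>t\<in>carrier G. hp t x) = (\<Sum>t\<in>carrier G. if t = g then hp g x else 0)"
        by (intro sum.cong) auto
      then have "x = hp g x" using g finite_carrier by (simp add: sum_hp)
      then show ?case using empty by simp
    next
      case (insert h X)
      have hc: "h \<in> carrier G" "h \<noteq> g" using insert.prems by auto
      show ?case
      proof (cases "h \<in> A")
        case False
        then have "hp h x = 0" using hp_outside V(2) insert.prems hc by blast
        then show ?thesis using insert.prems insert.IH[of x] by auto
      next
        case hA: True
        have iA: "inv g \<in> A" "h \<otimes> inv g \<in> A"
          using A(1) True hA by (auto intro: subgroup.m_inv_closed subgroup.m_closed)
        have "h \<otimes> inv g \<noteq> \<one>" using hc g inv_equality[of h "inv g"] by auto
        then obtain \<chi> :: "'g \<Rightarrow> 'k" where \<chi>: "character A \<chi>" "\<chi> (h \<otimes> inv g) \<noteq> 1"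
          using characters_separate[OF finite_carrier A(1) _ iA(2)] A(3)
          by (auto simp: commutative_subset_def)
        have "\<chi> h = \<chi> (h \<otimes> inv g) * \<chi> g"
          using characterD(1)[OF \<chi>(1) iA(2) True] hc g by (simp add: m_assoc)
        then have ne: "\<chi> g - \<chi> h \<noteq> 0" using \<chi>(2) characterD(2)[OF \<chi>(1) True] by auto
        \<comment> \<open>This combination has no component of degree \<open>h\<close> and the same
          component of degree \<open>g\<close> as \<open>x\<close>.\<close>
        define y where "y = scale (inverse (\<chi> g - \<chi> h)) (twist \<chi> x - scale (\<chi> h) x)"
        have y: "y \<in> V" unfolding y_def
          using V(1) insert.prems by (intro subspace_scale subspace_diff V(3)[OF \<chi>(1)]) auto
        have hpy: "hp t y = scale (inverse (\<chi> g - \<chi> h) * (\<chi> t - \<chi> h)) (hp t x)" if "t \<in> carrier G" for t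
          unfolding y_def using that
          by (simp add: endo_simps[OF endo_hp] hp_twist scale_left_diff_distrib[symmetric])
        have "hp g y \<in> V"
        proof (rule insert.IH)
          show "\<forall>t\<in>carrier G - insert g X. hp t y = 0"
            using hpy insert.prems(4) by auto
        qed (use insert.prems y in auto)
        then show ?thesis using hpy[OF g] ne by simp
      qed
    qed
    show ?thesis by (rule step[of "carrier G - {g}"]) (use x finite_carrier in auto)
  qed
qed

end

text \<open>The twists of \<open>S j\<close> span a graded ideal, which is all of \<open>H\<close>.
  So some twist does not commute with \<open>S k\<close>; two minimal ideals with a nonzero bracket
  coincide, and the twist is the isomorphism.\<close>

lemma simple_summands_isomorphic:
  assumes H: "graded_simple H" and ds: "lie_direct_sum {1..n::nat} S H"
    and simple: "\<And>j. j \<in> {1..n} \<Longrightarrow> simple_subalgebra (S j)" and jk: "j \<in> {1..n}" "k \<in> {1..n}"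
  shows "lie_isomorphic (S j) (S k)"
proof -
  have grH: "graded H" and brH: "\<And>x y. x \<in> H \<Longrightarrow> y \<in> H \<Longrightarrow> bracket x y \<in> H" and subH: "subspace H"
    and simpH: "\<And>I. lie_ideal H I \<Longrightarrow> graded I \<Longrightarrow> I = {0} \<or> I = H"
    using H by (auto simp: graded_simple_def lie_subalgebra_def)
  have "support H \<subseteq> carrier G" by (auto simp: support_def)
  then obtain A where A: "subgroup A G" "support H \<subseteq> A" "commutative_subset G A"
    by (rule commutative_subset_in_abelian_subgroup[OF _ graded_simple_support[OF H]])
  note tw = twist_bracket[OF grH A] twist_inverse[OF grH A] twist_ideal[OF grH A]
  have Hspan: "H = span (\<Union>i\<in>{1..n}. S i)"
    using ds by (simp add: lie_direct_sum_def internal_direct_sum_def)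
  have SH: "S i \<subseteq> H" if "i \<in> {1..n}" for i unfolding Hspan using that by (blast intro: span_base)
  have subS: "subspace (S i)" and brS: "\<And>x y. x \<in> S i \<Longrightarrow> y \<in> S i \<Longrightarrow> bracket x y \<in> S i"
    if "i \<in> {1..n}" for i
    using ds that by (auto simp: lie_direct_sum_def lie_subalgebra_def)
  have idS: "lie_ideal H (S i)" if i: "i \<in> {1..n}" for i
    unfolding lie_ideal_def
  proof (intro conjI ballI subS[OF i] SH[OF i])
    fix x y assume x: "x \<in> H" and y: "y \<in> S i"
    have "bracket x y \<in> S i" if "l \<in> {1..n}" "x \<in> S l" for l x
    proof (cases "l = i")
      case True
      then show ?thesis using brS[OF i] that y by blast
    next
      case False
      then have "bracket x y = 0" using ds that i y by (auto simp: lie_direct_sum_def)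
      then show ?thesis using subspace_0[OF subS[OF i]] by simp
    qed
    then have "(\<Union>l\<in>{1..n}. S l) \<subseteq> {x. bracket x y \<in> S i}" by blast
    then have "H \<subseteq> {x. bracket x y \<in> S i}"
      unfolding Hspan using subspace_preimage[OF endo_bracket(2) subS[OF i]] by (rule span_minimal)
    then show "bracket x y \<in> S i" using x by blast
  qed
  have min: "I = {0} \<or> I = S i" if "i \<in> {1..n}" "lie_ideal H I" "I \<subseteq> S i" for I i
  proof -
    have "lie_ideal (S i) I" using that SH[OF that(1)] by (auto simp: lie_ideal_def)
    then show ?thesis using simple[OF that(1)] by (simp add: simple_subalgebra_def)
  qed
  have nonabelian: "\<exists>x\<in>S i. \<exists>y\<in>S i. bracket x y \<noteq> 0" if i: "i \<in> {1..n}" for i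
  proof (rule ccontr)
    assume "\<not> ?thesis"
    then have "bracket_space (S i) (S i) \<subseteq> {0}" by (intro bracket_space_subset) auto
    then show False
      using simple[OF i] subspace_0[OF subspace_bracket_space[of "S i" "S i"]]
      by (auto simp: simple_subalgebra_def)
  qed
  define V where "V = span (\<Union>\<chi>\<in>{\<chi> :: 'g \<Rightarrow> 'k. character A \<chi>}. twist \<chi> ` S j)"
  have subV: "subspace V" by (simp add: V_def)
  have VI: "twist \<chi> s \<in> V" if "character A \<chi>" "s \<in> S j" for \<chi> s
    unfolding V_def using that by (intro span_base) blast
  have V_min: "V \<subseteq> U" if "subspace U" "\<And>\<chi> s. character A \<chi> \<Longrightarrow> s \<in> S j \<Longrightarrow> twist \<chi> s \<in> U" for U
    unfolding V_def using that by (intro span_minimal) auto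
  have VH: "V \<subseteq> H" using SH[OF jk(1)] twist_in[OF grH] by (intro V_min[OF subH]) blast
  have "lie_ideal H V"
    unfolding lie_ideal_def
  proof (intro conjI ballI subV VH)
    fix y x assume y: "y \<in> H" and x: "x \<in> V"
    have "V \<subseteq> {x. bracket y x \<in> V}"
    proof (rule V_min[OF subspace_preimage[OF endo_bracket(1) subV]])
      fix \<chi> :: "'g \<Rightarrow> 'k" and s assume \<chi>: "character A \<chi>" and s: "s \<in> S j"
      have "bracket y (twist \<chi> s) \<in> twist \<chi> ` S j"
        using tw(4)[OF \<chi> idS[OF jk(1)]] y s by (auto simp: lie_ideal_def)
      then show "twist \<chi> s \<in> {x. bracket y x \<in> V}" using VI[OF \<chi>] by auto
    qed
    then show "bracket y x \<in> V" using x by blast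
  qed
  moreover have "graded V"
  proof (rule graded_if_twist_invariant[OF grH A subV VH])
    fix \<psi> :: "'g \<Rightarrow> 'k" and x assume \<psi>: "character A \<psi>" and x: "x \<in> V"
    have "V \<subseteq> {x. twist \<psi> x \<in> V}"
    proof (rule V_min[OF subspace_preimage[OF endo_twist subV]])
      fix \<chi> :: "'g \<Rightarrow> 'k" and s assume \<chi>: "character A \<chi>" and s: "s \<in> S j"
      have "character A (\<lambda>g. \<psi> g * \<chi> g)" using \<psi> \<chi> by (auto simp: character_def)
      then show "twist \<chi> s \<in> {x. twist \<psi> x \<in> V}" using VI s by (simp add: twist_twist)
    qed
    then show "twist \<psi> x \<in> V" using x by blast
  qed
  moreover have "S j \<subseteq> V"
  proof
    fix s assume "s \<in> S j"
    then have "twist (\<lambda>_. 1) s \<in> V" by (intro VI) (simp_all add: character_def)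
    then show "s \<in> V" by (simp add: twist_one)
  qed
  moreover have "S j \<noteq> {0}"
  proof
    assume z: "S j = {0}"
    show False using nonabelian[OF jk(1)] unfolding z by (simp add: bracket_0)
  qed
  ultimately have "V = H" using simpH subspace_0[OF subS[OF jk(1)]] by blast
  \<comment> \<open>If \<open>S k\<close> commuted with all twists of \<open>S j\<close>, it would
    commute with \<open>H\<close> and be abelian.\<close>
  have "\<exists>\<chi>. character A \<chi> \<and> (\<exists>t\<in>S k. \<exists>s\<in>S j. bracket t (twist \<chi> s) \<noteq> 0)"
  proof (rule ccontr)
    assume n: "\<not> ?thesis"
    have "bracket t y = 0" if t: "t \<in> S k" and y: "y \<in> S k" for t y
    proof -
      have "subspace {x. bracket t x \<in> {0}}" by (rule subspace_preimage[OF endo_bracket(1) subspace_single_0])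
      then have "V \<subseteq> {x. bracket t x \<in> {0}}" by (rule V_min) (use n t in auto)
      then show ?thesis using y SH[OF jk(2)] \<open>V = H\<close> by auto
    qed
    then show False using nonabelian[OF jk(2)] by blast
  qed
  then obtain \<chi> t s where \<chi>: "character A \<chi>" and ts: "t \<in> S k" "s \<in> S j" "bracket t (twist \<chi> s) \<noteq> 0"
    by blast
  let ?\<psi> = "\<lambda>g. inverse (\<chi> g)"
  have \<psi>: "character A ?\<psi>" using \<chi> by (auto simp: character_def)
  have inH: "t \<in> H" "s \<in> H" "twist \<chi> s \<in> H" using ts SH jk twist_in[OF grH] by auto
  have image_k: "S k \<subseteq> twist \<chi> ` S j"
  proof -
    have id: "lie_ideal H (twist \<chi> ` S j)" by (rule tw(4)[OF \<chi> idS[OF jk(1)]])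
    have "lie_ideal H (twist \<chi> ` S j \<inter> S k)" by (rule lie_ideal_Int[OF id idS[OF jk(2)]])
    moreover have "bracket t (twist \<chi> s) \<in> twist \<chi> ` S j \<inter> S k"
      using id ts(2) inH lie_ideal_bracket2[OF idS[OF jk(2)] ts(1)] by (auto simp: lie_ideal_def)
    ultimately show ?thesis using min[OF jk(2), of "twist \<chi> ` S j \<inter> S k"] ts(3) by blast
  qed
  \<comment> \<open>The opposite inclusion comes from the inverse character, applied to the same
    nonzero bracket.\<close>
  have image_j: "S j \<subseteq> twist ?\<psi> ` S k"
  proof -
    have id: "lie_ideal H (twist ?\<psi> ` S k)" by (rule tw(4)[OF \<psi> idS[OF jk(2)]])
    have "lie_ideal H (twist ?\<psi> ` S k \<inter> S j)" by (rule lie_ideal_Int[OF id idS[OF jk(1)]])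
    moreover have eq: "twist ?\<psi> (bracket t (twist \<chi> s)) = bracket (twist ?\<psi> t) s"
      using tw(1)[OF \<psi> inH(1,3)] tw(2)[OF \<chi> inH(2)] by simp
    moreover have "bracket (twist ?\<psi> t) s \<in> S j"
      using idS[OF jk(1)] ts(2) twist_in[OF grH inH(1)] by (simp add: lie_ideal_def)
    moreover have "bracket (twist ?\<psi> t) s \<in> twist ?\<psi> ` S k"
      by (rule lie_ideal_bracket2[OF id _ inH(2)]) (use ts(1) in blast)
    moreover have "bracket (twist ?\<psi> t) s \<noteq> 0"
    proof
      assume "bracket (twist ?\<psi> t) s = 0"
      then have "twist \<chi> (twist ?\<psi> (bracket t (twist \<chi> s))) = 0" by (simp add: eq endo_0[OF endo_twist])
      then show False using tw(3)[OF \<chi> brH[OF inH(1,3)]] ts(3) by simp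
    qed
    ultimately show ?thesis using min[OF jk(1), of "twist ?\<psi> ` S k \<inter> S j"] by blast
  qed
  have "twist \<chi> ` S j \<subseteq> S k"
  proof clarify
    fix x assume "x \<in> S j"
    then obtain y where y: "y \<in> S k" "x = twist ?\<psi> y" using image_j by blast
    then show "twist \<chi> x \<in> S k" using tw(3)[OF \<chi>, of y] SH[OF jk(2)] by auto
  qed
  then have "twist \<chi> ` S j = S k" using image_k by blast
  moreover have "inj_on (twist \<chi>) (S j)"
    by (rule inj_on_inverseI[of _ "twist ?\<psi>"]) (use tw(2)[OF \<chi>] SH[OF jk(1)] in blast)
  ultimately have "bij_betw (twist \<chi>) (S j) (S k)" by (simp add: bij_betw_def)
  then show ?thesis
    unfolding lie_isomorphic_def
    using tw(1)[OF \<chi>] SH[OF jk(1)] by (intro exI[of _ "twist \<chi>"]) (auto simp: endo_simps[OF endo_twist])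
qed

end

section \<open>Assembly of the decomposition\<close>

context levi_complement
begin

text \<open>The decomposition of ideals is used twice, for \<open>B\<close> with graded ideals and
  for each summand with all ideals. The parts are ideals of \<open>B\<close> in both cases, which is
  why none of them is abelian.\<close>

lemma graded_simple_decomposition:
  "\<exists>(m::nat) H. lie_direct_sum {1..m} H B \<and>
    (\<forall>i\<in>{1..m}. graded_simple (H i) \<and> commutative_subset G (support (H i)) \<and>
      (\<exists>(n::nat) S. lie_direct_sum {1..n} S (H i) \<and> (\<forall>j\<in>{1..n}. simple_subalgebra (S j)) \<and>
        (\<forall>j\<in>{1..n}. \<forall>k\<in>{1..n}. lie_isomorphic (S j) (S k))))"
proof -
  have idB: "lie_ideal B B" using subspace_B bracket_B by (simp add: lie_ideal_def)
  have gr: "graded (J \<inter> perp \<kappa> I)" if "graded I" "graded J" for I J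
    by (rule graded_Int[OF that(2) graded_perp[OF sym_\<kappa> graded_\<kappa> that(1)]])
  obtain m :: nat and H where ds: "lie_direct_sum {1..m} H B"
    and H: "\<forall>i\<in>{1..m}. lie_ideal B (H i) \<and> graded (H i) \<and> H i \<noteq> {0} \<and>
      (\<forall>I. lie_ideal (H i) I \<and> graded I \<longrightarrow> I = {0} \<or> I = H i)"
    using ideal_decomposition[of graded B, OF gr idB graded_B] by blast
  have "graded_simple (H i) \<and> commutative_subset G (support (H i)) \<and>
      (\<exists>(n::nat) S. lie_direct_sum {1..n} S (H i) \<and> (\<forall>j\<in>{1..n}. simple_subalgebra (S j)) \<and>
        (\<forall>j\<in>{1..n}. \<forall>k\<in>{1..n}. lie_isomorphic (S j) (S k)))" if i: "i \<in> {1..m}" for i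
  proof -
    have Hi: "lie_ideal B (H i)" "graded (H i)" "H i \<noteq> {0}"
      "\<And>I. lie_ideal (H i) I \<Longrightarrow> graded I \<Longrightarrow> I = {0} \<or> I = H i" using H i by blast+
    have simple: "graded_simple (H i)"
      unfolding graded_simple_def
      using lie_ideal_subalgebra[OF Hi(1)] Hi ideal_not_abelian[OF Hi(1,3)] by blast
    obtain n :: nat and S where S: "lie_direct_sum {1..n} S (H i)"
      "\<forall>j\<in>{1..n}. lie_ideal B (S j) \<and> True \<and> S j \<noteq> {0} \<and>
        (\<forall>I. lie_ideal (S j) I \<and> True \<longrightarrow> I = {0} \<or> I = S j)"
      using ideal_decomposition[of "\<lambda>_. True" "H i", OF _ Hi(1)] by blast
    have sS: "simple_subalgebra (S j)" if "j \<in> {1..n}" for j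
    proof -
      have Sj: "lie_ideal B (S j)" "S j \<noteq> {0}" "\<forall>I. lie_ideal (S j) I \<longrightarrow> I = {0} \<or> I = S j"
        using S(2) that by blast+
      show ?thesis
        unfolding simple_subalgebra_def
        using lie_ideal_subalgebra[OF Sj(1)] ideal_not_abelian[OF Sj(1,2)] Sj(3) by simp
    qed
    have "\<forall>j\<in>{1..n}. \<forall>k\<in>{1..n}. lie_isomorphic (S j) (S k)"
      by (intro ballI simple_summands_isomorphic[OF simple S(1)] sS)
    with S(1) sS have "\<exists>(n::nat) S. lie_direct_sum {1..n} S (H i) \<and> (\<forall>j\<in>{1..n}. simple_subalgebra (S j)) \<and>
        (\<forall>j\<in>{1..n}. \<forall>k\<in>{1..n}. lie_isomorphic (S j) (S k))" by blast
    then show ?thesis using simple graded_simple_support[OF simple] by simp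
  qed
  then show ?thesis using ds by blast
qed

end

theorem theorem3p4:
  fixes scale :: "'k::{alg_closed_field, field_char_0} \<Rightarrow> 'a::ab_group_add \<Rightarrow> 'a"
    and bracket :: "'a \<Rightarrow> 'a \<Rightarrow> 'a"
    and G :: "('g, 'm) monoid_scheme"
    and L :: "'g \<Rightarrow> 'a set"
    and Basis :: "'a set"
  assumes "graded_lie_algebra scale bracket G L"
    and "finite (carrier G)"
    and "finite_dimensional_vector_space scale Basis"
  shows "\<exists>R. lie_algebra.solvable_radical scale bracket UNIV R \<and>
    graded_lie_algebra.graded scale G L R \<and>
    (\<exists>B. lie_algebra.levi_subalgebra scale bracket B \<and>
      {b + r |b r. b \<in> B \<and> r \<in> R} = UNIV \<and> B \<inter> R = {0} \<and>
      graded_lie_algebra.graded scale G L B \<and>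
      (\<exists>(m::nat) H. lie_algebra.lie_direct_sum scale bracket {1..m} H B \<and>
        (\<forall>i\<in>{1..m}.
          graded_lie_algebra.graded_simple scale bracket G L (H i) \<and>
          commutative_subset G (graded_lie_algebra.support G L (H i)) \<and>
          (\<exists>(n::nat) S. lie_algebra.lie_direct_sum scale bracket {1..n} S (H i) \<and>
            (\<forall>j\<in>{1..n}. lie_algebra.simple_subalgebra scale bracket (S j)) \<and>
            (\<forall>j\<in>{1..n}. \<forall>k\<in>{1..n}. lie_algebra.lie_isomorphic scale bracket (S j) (S k))))))"
proof -
  interpret graded_lie_algebra scale bracket G L by (rule assms(1))
  interpret finite_dimensional_vector_space scale Basis by (rule assms(3))
  interpret fd_graded_lie_algebra scale bracket G L Basis by unfold_locales (rule assms(2))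
  show ?thesis
  proof (rule radical_exists)
    fix R q assume R: "solvable_radical UNIV R" "graded R" "subquotient_proj q UNIV R"
      "\<And>g x. g \<in> carrier G \<Longrightarrow> hp g (q x) = q (hp g x)" "perp (trace_form (ad_sub q)) UNIV = R"
    interpret levi_data scale bracket G L Basis R q by unfold_locales (rule R, assumption?)+
    obtain B where B: "lie_subalgebra B" "graded B" "B \<inter> R = {0}" "\<And>x. \<exists>k\<in>B. x - k \<in> R"
      using levi_complement_exists by blast
    interpret levi_complement scale bracket G L Basis R q B by unfold_locales (rule B)+
    have "{b + r |b r. b \<in> B \<and> r \<in> R} = UNIV"
    proof (intro equalityI subsetI UNIV_I)
      fix x
      obtain k where "k \<in> B" "x - k \<in> R" using B(4) by blast
      moreover have "x = k + (x - k)" by simp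
      ultimately show "x \<in> {b + r |b r. b \<in> B \<and> r \<in> R}" by blast
    qed
    then show ?thesis using R(1,2) levi_B B(2,3) graded_simple_decomposition by blast
  qed
qed

end
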